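(* Let $T>0$ and suppose that the system $$|x_\rho|^2 x_t = x_{\rho\rho}, \qquad x(\cdot,0)=x_0,$$ has a smooth solution $x: I\times[0,T+\delta)\to\mathbb{R}^d$ on the time interval $[0,T+\delta)$ satisfying $$c_0\le |x_\rho|\le C_0\quad\text{in } I\times[0,T]$$ for some constants $\delta,c_0,C_0\in\mathbb{R}_{>0}$. Then there exist $\gamma>0$, $h_0>0$ and a constant $c>0$ (independent of $h$ and $\Delta t$) such that if $0<h\le h_0$ and $\Delta t=\frac TM\le\gamma h^{\frac14}$ (with $M\in\mathbb{N}$, $M\ge1$), then the following fully discrete scheme has a unique solution $(x^m_h)_{m=0,\ldots,M}$: $x^0_h=I_hx_0\in\underline{V}^h$ and, for $m=0,\ldots,M-1$, first find $x^{m+\frac12}_h\in\underline{V}^h$ such that $$\left(\frac{x^{m+\frac12}_h-x^m_h}{\frac12\Delta t} , \eta_h |x^m_{h,\rho}|^2 \right)^h + \left( x^{m+\frac12}_{h,\rho} , \eta_{h,\rho} \right) = 0 \qquad \forall\ \eta_h \in \underline{V}^h,$$ and then find $x^{m+1}_h\in\underline{V}^h$ such that $$\left( \frac{x^{m+1}_h-x^m_h}{\Delta t} , \eta_h |x^{m+\frac12}_{h,\rho}|^2 \right)^h + \tfrac12 \left(x^{m+1}_{h,\rho} + x^{m}_{h,\rho} , \eta_{h,\rho} \right) = 0 \qquad \forall\ \eta_h \in \underline{V}^h.$$ Moreover, the following error bounds hold: $$\max_{0\le m\le M}\|x(\cdot,t_m)-x^m_h\|_0+h\max_{0\le m\le M}|x(\cdot,t_m)-x^m_h|_1\le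 c\bigl(h^2+(\Delta t)^2\bigr),$$ $$\sum_{m=0}^{M-1}\Delta t\,\left\|x_t(\cdot,t_{m+\frac12})-\frac{x^{m+1}_h-x^m_h}{\Delta t}\right\|_0^2\le c\bigl(h^4+(\Delta t)^4\bigr).$$
   Context: Let $d\ge 2$ and let $I=\mathbb{R}/\mathbb{Z}$ be the periodic unit interval. Subscripts $\rho$ and $t$ denote partial derivatives with respect to the parameter $\rho\in I$ and time $t$. Spatial mesh: $[0,1]=\bigcup_{j=1}^J I_j$, $J\ge 3$, with $I_j=[\rho_{j-1},\rho_j]$, $0=\rho_0<\rho_1<\dots<\rho_J=1$, where $\rho_0$ and $\rho_J$ are identified by periodicity. Let $h_j=\rho_j-\rho_{j-1}$ and let the grid size be $h=\max_{1\le j\le J}h_j$. Throughout, the (family of) meshes considered is assumed to satisfy, for a fixed constant $c$ independent of $h$, $$|h_j-h_{j-1}|\le c h^2,\qquad h\le c h_j,\qquad j=1,\ldots,J,$$ with indices understood periodically (so that the first condition for $j=1$ compares $h_1$ with $h_J$). The constants $\gamma,h_0,c$ in the claim do not depend on the particular mesh in the family nor on $\Delta t$. Finite element spaces: $V^h=\{\chi\in C^0(I): \chi|_{I_j}\text{ is affine},\ j=1,\ldots,J\}$, $\underline{V}^h=[V^h]^d$. $I_h$ denotes the standard piecewise affine interpolation operator at the nodes $\{\rho_j\}_{j=1}^J$, applied componentwise to vector-valued functions. $(\cdot,\cdot)$ denotes the $L^2$-inner product on $I$, $\|\cdot\|_0$ the $L^2(I)$-norm and $|u|_1=\|u_\rho\|_0$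 the $H^1(I)$-seminorm. For piecewise continuous functions $u,v$ with possible jumps at the nodes, the mass lumped inner product is $$(u,v)^h=\tfrac12\sum_{j=1}^J h_j\left[(u\cdot v)(\rho_j^-)+(u\cdot v)(\rho_{j-1}^+)\right],\qquad (u\cdot v)(\rho_j^\pm)=\lim_{\delta'\searrow0}(u\cdot v)(\rho_j\pm\delta').$$ Time discretization: $\Delta t=\frac TM>0$, $t_m=m\Delta t$ for $m=0,\ldots,M$, and $t_{m+\frac12}=(m+\frac12)\Delta t$ for $m=0,\ldots,M-1$. $|\cdot|$ denotes the Euclidean norm in $\mathbb{R}^d$. *)

theory Defs
  imports "HOL-Analysis.Analysis"
begin

text \<open>Functions on the periodic unit interval \<open>I = \<real>/\<int>\<close> are modelled as functions on \<open>\<real>\<close> with period 1;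
  space-time functions are curried: space variable first, then time.\<close>

definition periodic1 :: "(real \<Rightarrow> 'a) \<Rightarrow> bool" where
  "periodic1 f \<longleftrightarrow> (\<forall>r. f (r + 1) = f r)"

definition pd_rho :: "(real \<Rightarrow> real \<Rightarrow> 'a::real_normed_vector) \<Rightarrow> real \<Rightarrow> real \<Rightarrow> 'a" where
  "pd_rho u r t = vector_derivative (\<lambda>s. u s t) (at r)"

text \<open>The time derivative is taken within the time interval \<open>S\<close>, hence one-sided at its end points.\<close>

definition pd_t :: "real set \<Rightarrow> (real \<Rightarrow> real \<Rightarrow> 'a::real_normed_vector) \<Rightarrow> real \<Rightarrow> real \<Rightarrow> 'a" where
  "pd_t S u r t = vector_derivative (\<lambda>s. u r s) (at t within S)"

inductive_set iterated_pds ::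
    "real set \<Rightarrow> (real \<Rightarrow> real \<Rightarrow> 'a::real_normed_vector) \<Rightarrow> (real \<Rightarrow> real \<Rightarrow> 'a) set"
  for S :: "real set" and u :: "real \<Rightarrow> real \<Rightarrow> 'a::real_normed_vector" where
  base: "u \<in> iterated_pds S u"
| rho: "v \<in> iterated_pds S u \<Longrightarrow> pd_rho v \<in> iterated_pds S u"
| time: "v \<in> iterated_pds S u \<Longrightarrow> pd_t S v \<in> iterated_pds S u"

text \<open>\<open>C\<^sup>\<infinity>\<close> on \<open>\<real> \<times> S\<close>: partial derivatives of all orders, in any order of differentiation,
  exist and are jointly continuous, up to the end points belonging to \<open>S\<close>.\<close>

definition smooth_spacetime :: "real set \<Rightarrow> (real \<Rightarrow> real \<Rightarrow> 'a::real_normed_vector) \<Rightarrow> bool" where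
  "smooth_spacetime S u \<longleftrightarrow>
     (\<forall>v\<in>iterated_pds S u.
        continuous_on (UNIV \<times> S) (\<lambda>(r, t). v r t) \<and>
        (\<forall>r. \<forall>t\<in>S. (\<lambda>s. v s t) differentiable (at r) \<and>
                    (\<lambda>s. v r s) differentiable (at t within S)))"

text \<open>A mesh with \<open>J\<close> elements is given by its nodes \<open>p 0, \<dots>, p J\<close>; values of \<open>p\<close> beyond \<open>J\<close> are
  irrelevant.\<close>

definition is_mesh :: "nat \<Rightarrow> (nat \<Rightarrow> real) \<Rightarrow> bool" where
  "is_mesh J p \<longleftrightarrow> J \<ge> 3 \<and> p 0 = 0 \<and> p J = 1 \<and> strict_mono_on {0..J} p"

definition elem_size :: "(nat \<Rightarrow> real) \<Rightarrow> nat \<Rightarrow> real" where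
  "elem_size p j = p j - p (j - 1)"

definition mesh_size :: "nat \<Rightarrow> (nat \<Rightarrow> real) \<Rightarrow> real" where
  "mesh_size J p = (MAX j\<in>{1..J}. elem_size p j)"

definition regular_mesh :: "real \<Rightarrow> nat \<Rightarrow> (nat \<Rightarrow> real) \<Rightarrow> bool" where
  "regular_mesh K J p \<longleftrightarrow> is_mesh J p \<and>
     (\<forall>j\<in>{1..J}.
        \<bar>elem_size p j - elem_size p (if j = 1 then J else j - 1)\<bar> \<le> K * (mesh_size J p)\<^sup>2 \<and>
        mesh_size J p \<le> K * elem_size p j)"

definition fe_space :: "nat \<Rightarrow> (nat \<Rightarrow> real) \<Rightarrow> (real \<Rightarrow> real) set" where
  "fe_space J p = {f. continuous_on UNIV f \<and> periodic1 f \<and>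
     (\<forall>j\<in>{1..J}. \<exists>a b. \<forall>r\<in>{p (j - 1)..p j}. f r = a + b * r)}"

definition vfe_space :: "nat \<Rightarrow> (nat \<Rightarrow> real) \<Rightarrow> (real \<Rightarrow> real^'d) set" where
  "vfe_space J p = {f. \<forall>i. (\<lambda>r. f r $ i) \<in> fe_space J p}"

definition interp :: "nat \<Rightarrow> (nat \<Rightarrow> real) \<Rightarrow> (real \<Rightarrow> real) \<Rightarrow> real \<Rightarrow> real" where
  "interp J p f = (THE g. g \<in> fe_space J p \<and> (\<forall>j\<in>{1..J}. g (p j) = f (p j)))"

definition vinterp :: "nat \<Rightarrow> (nat \<Rightarrow> real) \<Rightarrow> (real \<Rightarrow> real^'d) \<Rightarrow> real \<Rightarrow> real^'d" where
  "vinterp J p f r = (\<chi> i. interp J p (\<lambda>s. f s $ i) r)"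

text \<open>These notions are only applied to piecewise continuous integrands, for which the
  Henstock-Kurzweil integral agrees with the Lebesgue integral. The unspecified value of
  \<^const>\<open>vector_derivative\<close> at the nodes, where piecewise affine functions need not be
  differentiable, affects neither the integrals nor the one-sided limits in the mass lumped
  inner product.\<close>

definition L2_inner :: "(real \<Rightarrow> 'a::real_inner) \<Rightarrow> (real \<Rightarrow> 'a) \<Rightarrow> real" where
  "L2_inner u v = integral {0..1} (\<lambda>r. u r \<bullet> v r)"

definition L2_norm :: "(real \<Rightarrow> 'a::real_inner) \<Rightarrow> real" where
  "L2_norm u = sqrt (L2_inner u u)"

definition d_rho :: "(real \<Rightarrow> 'a::real_normed_vector) \<Rightarrow> real \<Rightarrow> 'a" where
  "d_rho u r = vector_derivative u (at r)"

definition H1_seminorm :: "(real \<Rightarrow> 'a::real_inner) \<Rightarrow> real" where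
  "H1_seminorm u = L2_norm (d_rho u)"

definition lumped_inner ::
    "nat \<Rightarrow> (nat \<Rightarrow> real) \<Rightarrow> (real \<Rightarrow> 'a::real_inner) \<Rightarrow> (real \<Rightarrow> 'a) \<Rightarrow> real" where
  "lumped_inner J p u v =
     1/2 * (\<Sum>j=1..J. elem_size p j *
       (Lim (at_left (p j)) (\<lambda>r. u r \<bullet> v r) + Lim (at_right (p (j - 1))) (\<lambda>r. u r \<bullet> v r)))"

text \<open>\<open>X m\<close> is the approximation at time \<open>m \<Delta>t\<close> for \<open>m \<le> M\<close>, and \<open>Y m\<close> is the intermediate value
  at time \<open>(m + 1/2) \<Delta>t\<close> for \<open>m < M\<close>. The finite families are extensional functions, so that
  equality of pairs \<open>(X, Y)\<close> is equality of the families.\<close>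

definition scheme_solution ::
    "nat \<Rightarrow> (nat \<Rightarrow> real) \<Rightarrow> nat \<Rightarrow> real \<Rightarrow> (real \<Rightarrow> real^'d) \<Rightarrow>
     (nat \<Rightarrow> real \<Rightarrow> real^'d) \<Rightarrow> (nat \<Rightarrow> real \<Rightarrow> real^'d) \<Rightarrow> bool" where
  "scheme_solution J p M \<Delta>t x0 X Y \<longleftrightarrow>
     X \<in> {0..M} \<rightarrow>\<^sub>E vfe_space J p \<and>
     Y \<in> {0..<M} \<rightarrow>\<^sub>E vfe_space J p \<and>
     X 0 = vinterp J p x0 \<and>
     (\<forall>m<M.
        (\<forall>\<eta>\<in>vfe_space J p.
           lumped_inner J p (\<lambda>r. (Y m r - X m r) /\<^sub>R (1/2 * \<Delta>t))
                            (\<lambda>r. (norm (d_rho (X m) r))\<^sup>2 *\<^sub>R \<eta> r)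
           + L2_inner (d_rho (Y m)) (d_rho \<eta>) = 0) \<and>
        (\<forall>\<eta>\<in>vfe_space J p.
           lumped_inner J p (\<lambda>r. (X (Suc m) r - X m r) /\<^sub>R \<Delta>t)
                            (\<lambda>r. (norm (d_rho (Y m) r))\<^sup>2 *\<^sub>R \<eta> r)
           + 1/2 * L2_inner (\<lambda>r. d_rho (X (Suc m)) r + d_rho (X m) r) (d_rho \<eta>) = 0))"

end

theory Submission
  imports Defs
begin

text \<open>The scheme is a finite difference scheme in disguise: mass lumping turns the weighted inner
  products into weighted sums over the nodes, and the stiffness form only sees difference quotients of
  nodal values. So everything is proved for nodal values first (\<open>predictor_nodal\<close>,
  \<open>corrector_nodal\<close> give the translation), by consistency, stability and a continuation argument.

  \<^bold>\<open>Consistency.\<close> Neighbouring elements differ in length by \<open>O(h\<^sup>2)\<close> only, so the three-point second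
  difference and the lumped coefficient are second order accurate on the nonuniform mesh
  (\<open>second_difference\<close>, \<open>lumped_coefficient\<close>). In time the corrector is a midpoint rule, but the
  predictor is a backward Euler step and only first order accurate. Comparing the intermediate
  solution with \<open>x(t + \<Delta>t/2)\<close> itself would cost half a power of \<open>\<Delta>t\<close> in the energy norm. The leading
  defect of the predictor is however \<open>\<Delta>t\<close> times a smooth function, and it is cancelled by comparing
  with \<open>x(t + \<Delta>t/2) + \<Delta>t\<^sup>2 z\<close> instead, where \<open>z\<close> is a smooth function computed from the derivatives of
  \<open>x\<close>. With this choice both stages have residuals \<open>O(h\<^sup>2 + \<Delta>t\<^sup>2)\<close> (\<open>predictor_residual\<close>,
  \<open>corrector_residual\<close>), while the extra term changes the coefficient of the corrector by
  \<open>O(\<Delta>t\<^sup>2)\<close> only.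

  \<^bold>\<open>Stability.\<close> Let \<open>e\<close>, \<open>E\<close> be the nodal errors before and after the predictor. Testing the error
  equation of the predictor with \<open>E - e\<close> and that of the corrector with the discrete time derivative of
  the error bounds the growth of the discrete \<open>H\<^sup>1\<close> seminorm (\<open>predictor_stability\<close>,
  \<open>corrector_stability\<close>). The nonlinearity only sits in the coefficient \<open>|x\<^sub>\<rho>|\<^sup>2\<close>, whose perturbation is
  linear in the difference quotients of the error as long as these are at most 1 (\<open>error_residual\<close>).
  Since the corrector also controls the time derivative of the error in \<open>L\<^sup>2\<close>, Gronwall's argument gives
  \<open>O(h\<^sup>2 + \<Delta>t\<^sup>2)\<close> for the \<open>H\<^sup>1\<close> seminorm at the nodes, for the time derivative and, by summation in
  time, for the \<open>L\<^sup>2\<close> norm (\<open>nodal_error_bounds\<close>).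

  \<^bold>\<open>Continuation.\<close> The difference quotients of the error are at most \<open>h\<^sup>-\<^sup>1\<^sup>/\<^sup>2\<close> times the \<open>H\<^sup>1\<close> seminorm,
  up to a constant, hence bounded by a multiple of \<open>h\<^sup>3\<^sup>/\<^sup>2 + \<Delta>t\<^sup>2 h\<^sup>-\<^sup>1\<^sup>/\<^sup>2\<close>. This is small exactly because
  \<open>\<Delta>t \<le> \<gamma> h\<^sup>1\<^sup>/\<^sup>4\<close>. So the bound at one time level keeps the coefficients of the next step bounded below
  by a positive constant; this makes the next step uniquely solvable and carries the bound to the next
  time level (\<open>energy_growth\<close>, \<open>run_weights\<close>). Any solution of the scheme satisfies the bounds, so
  uniqueness follows by the same induction.\<close>

section \<open>Taylor estimates for vector-valued functions\<close>

lemma taylor_remainder_bound: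
  fixes F :: "nat \<Rightarrow> real \<Rightarrow> 'a::real_normed_vector"
  assumes S: "convex S" and "a \<in> S" "b \<in> S"
    and der: "\<And>k s. k < n \<Longrightarrow> s \<in> S \<Longrightarrow> (F k has_vector_derivative F (Suc k) s) (at s within S)"
    and bnd: "\<And>s. s \<in> S \<Longrightarrow> norm (F n s) \<le> B"
  shows "norm (F 0 b - (\<Sum>k<n. ((b - a)^k / fact k) *\<^sub>R F k a)) \<le> B * \<bar>b - a\<bar>^n"
  using \<open>b \<in> S\<close> der bnd
proof (induction n arbitrary: F b)
  case 0
  then show ?case by simp
next
  case (Suc n)
  define g where "g = (\<lambda>s. F 0 s - (\<Sum>k<Suc n. ((s - a)^k / fact k) *\<^sub>R F k a))"
  define g' where "g' = (\<lambda>s. F 1 s - (\<Sum>k<n. ((s - a)^k / fact k) *\<^sub>R F (Suc k) a))"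
  have B0: "B \<ge> 0" using Suc.prems(3)[OF \<open>a \<in> S\<close>] norm_ge_zero order_trans by blast
  have seg: "closed_segment a b \<subseteq> S"
    using S \<open>a \<in> S\<close> Suc.prems(1) by (simp add: closed_segment_subset)
  have g': "(g has_vector_derivative g' s) (at s within closed_segment a b)"
    if s: "s \<in> closed_segment a b" for s
  proof -
    have 1: "(F 0 has_vector_derivative F 1 s) (at s within closed_segment a b)"
      using Suc.prems(2)[of 0 s] s seg
      by (auto intro: has_vector_derivative_within_subset)
    have 2: "((\<lambda>s. ((s - a)^Suc k / fact (Suc k)) *\<^sub>R F (Suc k) a)
         has_vector_derivative ((s - a)^k / fact k) *\<^sub>R F (Suc k) a) (at s within T)" for k T
    proof -
      have "((\<lambda>s. (s - a)^Suc k) has_real_derivative (1 + real k) * (s - a)^k) (at s within T)"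
        by (rule derivative_eq_intros refl | simp)+
      then have "((\<lambda>s. (s - a)^Suc k / fact (Suc k)) has_real_derivative
           ((1 + real k) * (s - a)^k) / fact (Suc k)) (at s within T)"
        by (rule DERIV_cdivide)
      moreover have "((1 + real k) * (s - a)^k) / fact (Suc k) = (s - a)^k / fact k"
        by (simp add: add_eq_0_iff)
      ultimately have "((\<lambda>s. (s - a)^Suc k / fact (Suc k)) has_real_derivative
           (s - a)^k / fact k) (at s within T)" by simp
      then show ?thesis
        unfolding has_field_derivative_def has_vector_derivative_def
        by (rule has_derivative_scaleR_left[THEN has_derivative_eq_rhs])
          (simp add: fun_eq_iff mult_ac)
    qed
    have 3: "g = (\<lambda>s. F 0 s - F 0 a - (\<Sum>k<n. ((s - a)^Suc k / fact (Suc k)) *\<^sub>R F (Suc k) a))"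
      unfolding g_def by (subst sum.lessThan_Suc_shift) (simp add: algebra_simps)
    have "((\<lambda>s. F 0 s - F 0 a - (\<Sum>k<n. ((s - a)^Suc k / fact (Suc k)) *\<^sub>R F (Suc k) a))
       has_vector_derivative (F 1 s - 0 - (\<Sum>k<n. ((s - a)^k / fact k) *\<^sub>R F (Suc k) a)))
       (at s within closed_segment a b)"
      by (intro has_vector_derivative_diff has_vector_derivative_sum has_vector_derivative_const 1 2)
    then show ?thesis unfolding 3 g'_def by simp
  qed
  have bd: "norm (g' s) \<le> B * \<bar>b - a\<bar>^n" if s: "s \<in> closed_segment a b" for s
  proof -
    have "norm (F (Suc 0) s - (\<Sum>k<n. ((s - a)^k / fact k) *\<^sub>R F (Suc k) a)) \<le> B * \<bar>s - a\<bar>^n"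
      using Suc.IH[of s "\<lambda>k. F (Suc k)"] Suc.prems s seg by auto
    also have "\<dots> \<le> B * \<bar>b - a\<bar>^n"
      using s by (intro mult_left_mono power_mono B0)
        (auto simp: closed_segment_eq_real_ivl split: if_splits)
    finally show ?thesis by (simp add: g'_def)
  qed
  have "norm (g b - g a) \<le> B * \<bar>b - a\<bar>^n * norm (b - a)"
  proof (rule differentiable_bound[where S = "closed_segment a b" and f' = "\<lambda>s h. h *\<^sub>R g' s"])
    show "onorm (\<lambda>h. h *\<^sub>R g' s) \<le> B * \<bar>b - a\<bar>^n" if "s \<in> closed_segment a b" for s
      using bd[OF that] by (intro onorm_le) (simp add: mult.commute mult_left_mono)
  qed (use g' in \<open>auto simp: has_vector_derivative_def\<close>)
  moreover have "g a = 0" unfolding g_def by (subst sum.lessThan_Suc_shift) simp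
  ultimately show ?case by (simp add: g_def mult_ac)
qed

lemma taylor1:
  fixes f :: "real \<Rightarrow> 'a::real_normed_vector"
  assumes "convex S" "a \<in> S" "b \<in> S"
    and "\<And>s. s \<in> S \<Longrightarrow> (f has_vector_derivative f1 s) (at s within S)"
    and "\<And>s. s \<in> S \<Longrightarrow> norm (f1 s) \<le> B"
  shows "norm (f b - f a) \<le> B * \<bar>b - a\<bar>"
  using taylor_remainder_bound[of S a b 1 "\<lambda>k. [f, f1] ! k" B] assms by (simp add: less_Suc_eq)

lemma taylor2:
  fixes f :: "real \<Rightarrow> 'a::real_normed_vector"
  assumes "convex S" "a \<in> S" "b \<in> S"
    and "\<And>s. s \<in> S \<Longrightarrow> (f has_vector_derivative f1 s) (at s within S)"
    and "\<And>s. s \<in> S \<Longrightarrow> (f1 has_vector_derivative f2 s) (at s within S)"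
    and "\<And>s. s \<in> S \<Longrightarrow> norm (f2 s) \<le> B"
  shows "norm (f b - f a - (b - a) *\<^sub>R f1 a) \<le> B * \<bar>b - a\<bar>^2"
proof -
  have "norm (([f, f1, f2] ! 0) b - (\<Sum>k<2. ((b - a)^k / fact k) *\<^sub>R ([f, f1, f2] ! k) a)) \<le> B * \<bar>b - a\<bar>^2"
    by (rule taylor_remainder_bound[of S]) (use assms in \<open>auto simp: less_Suc_eq numeral_2_eq_2\<close>)
  then show ?thesis by (simp add: eval_nat_numeral algebra_simps)
qed

lemma taylor3:
  fixes f :: "real \<Rightarrow> 'a::real_normed_vector"
  assumes "convex S" "a \<in> S" "b \<in> S"
    and "\<And>s. s \<in> S \<Longrightarrow> (f has_vector_derivative f1 s) (at s within S)"
    and "\<And>s. s \<in> S \<Longrightarrow> (f1 has_vector_derivative f2 s) (at s within S)"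
    and "\<And>s. s \<in> S \<Longrightarrow> (f2 has_vector_derivative f3 s) (at s within S)"
    and "\<And>s. s \<in> S \<Longrightarrow> norm (f3 s) \<le> B"
  shows "norm (f b - f a - (b - a) *\<^sub>R f1 a - ((b - a)^2 / 2) *\<^sub>R f2 a) \<le> B * \<bar>b - a\<bar>^3"
proof -
  have "norm (([f, f1, f2, f3] ! 0) b - (\<Sum>k<3. ((b - a)^k / fact k) *\<^sub>R ([f, f1, f2, f3] ! k) a)) \<le> B * \<bar>b - a\<bar>^3"
    by (rule taylor_remainder_bound[of S]) (use assms in \<open>auto simp: less_Suc_eq numeral_3_eq_3\<close>)
  then show ?thesis by (simp add: eval_nat_numeral diff_diff_eq)
qed

lemma taylor4:
  fixes f :: "real \<Rightarrow> 'a::real_normed_vector"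
  assumes "convex S" "a \<in> S" "b \<in> S"
    and "\<And>s. s \<in> S \<Longrightarrow> (f has_vector_derivative f1 s) (at s within S)"
    and "\<And>s. s \<in> S \<Longrightarrow> (f1 has_vector_derivative f2 s) (at s within S)"
    and "\<And>s. s \<in> S \<Longrightarrow> (f2 has_vector_derivative f3 s) (at s within S)"
    and "\<And>s. s \<in> S \<Longrightarrow> (f3 has_vector_derivative f4 s) (at s within S)"
    and "\<And>s. s \<in> S \<Longrightarrow> norm (f4 s) \<le> B"
  shows "norm (f b - f a - (b - a) *\<^sub>R f1 a - ((b - a)^2 / 2) *\<^sub>R f2 a
     - ((b - a)^3 / 6) *\<^sub>R f3 a) \<le> B * \<bar>b - a\<bar>^4"
proof -
  have "norm (([f, f1, f2, f3, f4] ! 0) b - (\<Sum>k<4. ((b - a)^k / fact k) *\<^sub>R ([f, f1, f2, f3, f4] ! k) a)) \<le> B * \<bar>b - a\<bar>^4"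
    by (rule taylor_remainder_bound[of S]) (use assms in \<open>auto simp: less_Suc_eq eval_nat_numeral\<close>)
  then show ?thesis by (simp add: eval_nat_numeral diff_diff_eq)
qed

section \<open>Elementary inequalities\<close>

lemma norm_quotient_le:
  fixes v :: "'a::real_normed_vector"
  assumes "norm v \<le> C * \<bar>s\<bar>" "s \<noteq> 0"
  shows "norm (v /\<^sub>R s) \<le> C"
proof -
  have "norm v / \<bar>s\<bar> \<le> C" using assms by (simp add: pos_divide_le_eq)
  then show ?thesis by (simp add: divide_inverse_commute)
qed

lemma young:
  fixes A n \<omega> :: real
  assumes "0 < \<omega>"
  shows "A * n \<le> \<omega> * n\<^sup>2 / 2 + A\<^sup>2 / (2 * \<omega>)"
proof -
  have "0 \<le> (\<omega> * n - A)\<^sup>2 / (2 * \<omega>)" using assms by simp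
  also have "\<dots> = \<omega> * n\<^sup>2 / 2 + A\<^sup>2 / (2 * \<omega>) - A * n"
    using assms by (simp add: power2_eq_square field_simps)
  finally show ?thesis by simp
qed

text \<open>The energy argument of one stage as an inequality between real numbers: \<open>A * n\<close> is the residual
  tested with the increment, \<open>n\<close> the norm of the increment, and \<open>a\<close>, \<open>c\<close> are the squared seminorms after and
  before the step. Young's inequality absorbs the increment into the lumped mass term. The implicit
  Euler step uses up the whole mass term; the corrector keeps half of it, to control the discrete time
  derivative.\<close>

lemma predictor_algebra:
  fixes \<tau> \<omega> w s A n a b c d :: real
  assumes "inverse \<tau> * w + s \<le> A * n" "\<omega> * n\<^sup>2 \<le> w" "s = a - b" "d = a - 2 * b + c" "0 \<le> d"
    and "0 < \<tau>" "0 < \<omega>"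
  shows "a \<le> c + \<tau> / (2 * \<omega>) * A\<^sup>2"
proof -
  have "inverse \<tau> * (\<omega> * n\<^sup>2) \<le> inverse \<tau> * w"
    using assms by (intro mult_left_mono) auto
  moreover have "A * n \<le> inverse \<tau> * (\<omega> * n\<^sup>2) + \<tau> / (4 * \<omega>) * A\<^sup>2"
    using young[of "2 * \<omega> / \<tau>" A n] assms(6,7) by (simp add: field_simps)
  ultimately have "s \<le> \<tau> / (4 * \<omega>) * A\<^sup>2" using assms(1) by linarith
  then have "a - c \<le> 2 * (\<tau> / (4 * \<omega>) * A\<^sup>2)" using assms(3-5) by linarith
  then show ?thesis by simp
qed

lemma corrector_algebra:
  fixes \<tau> \<omega> w s A n a c :: real
  assumes "w + s \<le> A * n" "\<omega> * n\<^sup>2 \<le> w" "s = (a - c) / (2 * \<tau>)"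
    and "0 < \<tau>" "0 < \<omega>"
  shows "a + \<omega> * \<tau> * n\<^sup>2 \<le> c + \<tau> / \<omega> * A\<^sup>2"
proof -
  have "\<omega> * n\<^sup>2 / 2 + (a - c) / (2 * \<tau>) \<le> A\<^sup>2 / (2 * \<omega>)"
    using young[OF assms(5), of A n] assms(1-3) by linarith
  then have "(2 * \<tau>) * (\<omega> * n\<^sup>2 / 2 + (a - c) / (2 * \<tau>)) \<le> (2 * \<tau>) * (A\<^sup>2 / (2 * \<omega>))"
    using assms(4) by (intro mult_left_mono) auto
  moreover have "(2 * \<tau>) * (\<omega> * n\<^sup>2 / 2 + (a - c) / (2 * \<tau>)) = \<omega> * \<tau> * n\<^sup>2 + (a - c)"
    "(2 * \<tau>) * (A\<^sup>2 / (2 * \<omega>)) = \<tau> / \<omega> * A\<^sup>2"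
    using assms(4) by (simp_all add: field_simps)
  ultimately show ?thesis by linarith
qed

section \<open>Nodal functions on a periodic grid\<close>

text \<open>A periodic nodal function is a function on \<open>{0..J}\<close> with equal values at \<open>0\<close> and \<open>J\<close>; only the element
  lengths matter.\<close>

locale grid =
  fixes J :: nat and h :: "nat \<Rightarrow> real"
  assumes J_pos: "1 \<le> J" and h_pos: "\<And>j. j \<in> {1..J} \<Longrightarrow> 0 < h j"
begin

definition dq :: "(nat \<Rightarrow> 'a::real_inner) \<Rightarrow> nat \<Rightarrow> 'a" where
  "dq U j = (U j - U (j - 1)) /\<^sub>R h j"

abbreviation speed2 :: "(nat \<Rightarrow> 'a::real_inner) \<Rightarrow> nat \<Rightarrow> real" where
  "speed2 U \<equiv> \<lambda>j. (norm (dq U j))\<^sup>2"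

text \<open>The mass lumped inner product with an elementwise constant weight.\<close>

definition wip :: "(nat \<Rightarrow> real) \<Rightarrow> (nat \<Rightarrow> 'a::real_inner) \<Rightarrow> (nat \<Rightarrow> 'a) \<Rightarrow> real" where
  "wip w U V = (\<Sum>j=1..J. h j * w j * (U j \<bullet> V j + U (j - 1) \<bullet> V (j - 1)) / 2)"

definition stiff :: "(nat \<Rightarrow> 'a::real_inner) \<Rightarrow> (nat \<Rightarrow> 'a) \<Rightarrow> real" where
  "stiff U V = (\<Sum>j=1..J. h j * (dq U j \<bullet> dq V j))"

definition nrm0 :: "(nat \<Rightarrow> 'a::real_inner) \<Rightarrow> real" where
  "nrm0 U = sqrt (wip (\<lambda>_. 1) U U)"

definition nrm1 :: "(nat \<Rightarrow> 'a::real_inner) \<Rightarrow> real" where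
  "nrm1 U = sqrt (stiff U U)"

text \<open>Elements are numbered by their right end nodes, so the two elements at node \<open>j \<in> {1..J}\<close> are \<open>j\<close> and
  \<open>nxt j\<close>, and \<open>mu j\<close> is the lumped mass of the node.\<close>

definition nxt :: "nat \<Rightarrow> nat" where
  "nxt j = (if j = J then 1 else Suc j)"

definition mu :: "nat \<Rightarrow> real" where
  "mu j = (h j + h (nxt j)) / 2"

lemma nxt_mem: "j \<in> {1..J} \<Longrightarrow> nxt j \<in> {1..J}"
  using J_pos by (auto simp: nxt_def)

lemma mu_pos: "j \<in> {1..J} \<Longrightarrow> 0 < mu j"
  using h_pos[of j] h_pos[OF nxt_mem, of j] by (simp add: mu_def)

lemma sum_shift:
  fixes a :: "nat \<Rightarrow> 'b \<Rightarrow> real"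
  assumes "V 0 = V J"
  shows "(\<Sum>j=1..J. a j (V (j - 1))) = (\<Sum>j=1..J. a (nxt j) (V j))"
proof -
  obtain n where n: "J = Suc n" using J_pos by (cases J) auto
  have nx: "\<And>j. j \<in> {1..n} \<Longrightarrow> nxt j = Suc j" "nxt J = 1" unfolding nxt_def using n by auto
  have "(\<Sum>j=1..J. a j (V (j - 1))) = a 1 (V J) + (\<Sum>j=1..n. a (Suc j) (V j))"
    unfolding n using assms n
    by (simp add: sum.atLeast_Suc_atMost sum.shift_bounds_cl_Suc_ivl del: sum.cl_ivl_Suc)
  also have "\<dots> = (\<Sum>j=1..n. a (nxt j) (V j)) + a (nxt J) (V J)"
    using nx by (simp add: add.commute)
  also have "\<dots> = (\<Sum>j=1..J. a (nxt j) (V j))"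
    unfolding n by simp
  finally show ?thesis .
qed

text \<open>Collecting the two contributions of each node turns both forms into sums over the nodes. This is
  the finite difference form, needed for consistency and for solvability; stability is easier in the
  elementwise form.\<close>

lemma wip_nodal:
  assumes "U 0 = U J" "V 0 = V J"
  shows "wip w U V = (\<Sum>j=1..J. (h j * w j + h (nxt j) * w (nxt j)) / 2 * (U j \<bullet> V j))"
proof -
  have "wip w U V = (\<Sum>j=1..J. h j * w j / 2 * (U j \<bullet> V j))
      + (\<Sum>j=1..J. h j * w j / 2 * (U (j - 1) \<bullet> V (j - 1)))"
    unfolding wip_def by (simp add: sum.distrib[symmetric] algebra_simps add_divide_distrib)
  also have "(\<Sum>j=1..J. h j * w j / 2 * (U (j - 1) \<bullet> V (j - 1)))
      = (\<Sum>j=1..J. h (nxt j) * w (nxt j) / 2 * (U j \<bullet> V j))"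
    using sum_shift[of "\<lambda>j. (U j, V j)" "\<lambda>j (u, v). h j * w j / 2 * (u \<bullet> v)"] assms by simp
  finally show ?thesis by (simp add: sum.distrib[symmetric] algebra_simps add_divide_distrib)
qed

lemma stiff_nodal:
  assumes "V 0 = V J"
  shows "stiff U V = (\<Sum>j=1..J. (dq U j - dq U (nxt j)) \<bullet> V j)"
proof -
  have "stiff U V = (\<Sum>j=1..J. dq U j \<bullet> (V j - V (j - 1)))"
    unfolding stiff_def
  proof (rule sum.cong)
    fix j assume "j \<in> {1..J}"
    then have "h j \<noteq> 0" using h_pos by force
    then show "h j * (dq U j \<bullet> dq V j) = dq U j \<bullet> (V j - V (j - 1))"
      by (simp add: dq_def[of V])
  qed simp
  also have "\<dots> = (\<Sum>j=1..J. dq U j \<bullet> V j) - (\<Sum>j=1..J. dq U j \<bullet> V (j - 1))"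
    by (simp add: inner_diff_right sum_subtractf)
  also have "(\<Sum>j=1..J. dq U j \<bullet> V (j - 1)) = (\<Sum>j=1..J. dq U (nxt j) \<bullet> V j)"
    using sum_shift[of V "\<lambda>j v. dq U j \<bullet> v"] assms by simp
  finally show ?thesis by (simp add: inner_diff_left sum_subtractf)
qed

lemma nrm0_nonneg [simp]: "0 \<le> nrm0 U" and nrm1_nonneg [simp]: "0 \<le> nrm1 U"
  by (auto simp: nrm0_def nrm1_def wip_def stiff_def less_imp_le[OF h_pos]
      intro!: sum_nonneg)

lemma nrm0_sq: "(nrm0 U)\<^sup>2 = (\<Sum>j=1..J. h j * ((norm (U j))\<^sup>2 + (norm (U (j - 1)))\<^sup>2) / 2)"
proof -
  have "0 \<le> wip (\<lambda>_. 1) U U"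
    by (auto simp: wip_def less_imp_le[OF h_pos] intro!: sum_nonneg)
  then show ?thesis
    by (simp add: nrm0_def wip_def power2_norm_eq_inner)
qed

lemma nrm1_sq: "(nrm1 U)\<^sup>2 = (\<Sum>j=1..J. h j * (norm (dq U j))\<^sup>2)"
proof -
  have "0 \<le> stiff U U"
    by (auto simp: stiff_def less_imp_le[OF h_pos] intro!: sum_nonneg)
  then show ?thesis
    by (simp add: nrm1_def stiff_def power2_norm_eq_inner)
qed

lemma nrm1_sq_stiff: "(nrm1 U)\<^sup>2 = stiff U U"
  by (simp add: nrm1_sq stiff_def power2_norm_eq_inner)

lemma dq_add: "dq (\<lambda>j. U j + V j) j = dq U j + dq V j"
  and dq_diff: "dq (\<lambda>j. U j - V j) j = dq U j - dq V j"
  and dq_scale: "dq (\<lambda>j. a *\<^sub>R U j) j = a *\<^sub>R dq U j"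
  by (simp_all add: dq_def algebra_simps)

lemma stiff_add: "stiff (\<lambda>j. U j + V j) W = stiff U W + stiff V W"
  and stiff_diff: "stiff (\<lambda>j. U j - V j) W = stiff U W - stiff V W"
  and stiff_scale: "stiff (\<lambda>j. a *\<^sub>R U j) W = a * stiff U W"
  by (simp_all add: stiff_def dq_add dq_diff dq_scale inner_simps algebra_simps sum.distrib
      sum_subtractf sum_distrib_left)

lemma stiff_commute: "stiff U V = stiff V U"
  by (simp add: stiff_def inner_commute)

lemma stiff_scale_right: "stiff U (\<lambda>j. a *\<^sub>R V j) = a * stiff U V"
  unfolding stiff_commute[of U] by (rule stiff_scale)

lemma stiff_sum_diff:
  "stiff (\<lambda>j. U j + V j) (\<lambda>j. U j - V j) = stiff U U - stiff V V"
proof -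
  let ?d = "\<lambda>j. U j - V j"
  have "stiff (\<lambda>j. U j + V j) ?d = stiff U ?d + stiff V ?d" by (rule stiff_add)
  moreover have "stiff U ?d = stiff U U - stiff V U" using stiff_commute stiff_diff by metis
  moreover have "stiff V ?d = stiff U V - stiff V V" using stiff_commute stiff_diff by metis
  moreover have "stiff V U = stiff U V" by (rule stiff_commute)
  ultimately show ?thesis by simp
qed

lemma wip_diff: "wip w (\<lambda>j. U j - V j) W = wip w U W - wip w V W"
  and wip_scale: "wip w (\<lambda>j. a *\<^sub>R U j) W = a * wip w U W"
  and wip_weight_diff: "wip (\<lambda>j. w j - v j) U W = wip w U W - wip v U W"
  by (simp_all add: wip_def inner_simps algebra_simps sum.distrib diff_divide_distrib add_divide_distrib
      sum_subtractf sum_distrib_left)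

lemma wip_lower:
  assumes "\<And>j. j \<in> {1..J} \<Longrightarrow> \<omega> \<le> w j"
  shows "\<omega> * (nrm0 U)\<^sup>2 \<le> wip w U U"
proof -
  have "\<omega> * (nrm0 U)\<^sup>2 = (\<Sum>j=1..J. \<omega> * (h j * ((norm (U j))\<^sup>2 + (norm (U (j - 1)))\<^sup>2) / 2))"
    by (simp add: nrm0_sq sum_distrib_left)
  also have "\<dots> \<le> wip w U U"
    unfolding wip_def
  proof (rule sum_mono)
    fix j assume j: "j \<in> {1..J}"
    let ?s = "h j * ((norm (U j))\<^sup>2 + (norm (U (j - 1)))\<^sup>2) / 2"
    have "\<omega> * ?s \<le> w j * ?s"
      using assms[OF j] h_pos[OF j] by (intro mult_right_mono) auto
    then show "\<omega> * ?s \<le> h j * w j * (U j \<bullet> U j + U (j - 1) \<bullet> U (j - 1)) / 2"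
      by (simp add: power2_norm_eq_inner mult_ac)
  qed
  finally show ?thesis .
qed

text \<open>The inverse inequality that costs \<open>h\<^sup>-\<^sup>1\<^sup>/\<^sup>2\<close>.\<close>

lemma dq_le_nrm1:
  assumes "j \<in> {1..J}"
  shows "norm (dq U j) \<le> nrm1 U / sqrt (h j)"
proof -
  have "h j * (norm (dq U j))\<^sup>2 \<le> (nrm1 U)\<^sup>2"
    unfolding nrm1_sq using assms
    by (intro member_le_sum) (auto simp: less_imp_le[OF h_pos])
  then have "(sqrt (h j) * norm (dq U j))\<^sup>2 \<le> (nrm1 U)\<^sup>2"
    using h_pos[OF assms] by (simp add: power_mult_distrib)
  then have "sqrt (h j) * norm (dq U j) \<le> nrm1 U"
    by (rule power2_le_imp_le) simp
  then show ?thesis using h_pos[OF assms] by (simp add: field_simps)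
qed

text \<open>The Cauchy-Schwarz inequality between an elementwise quantity and a nodal function.\<close>

lemma sum_mean_le_nrm0:
  assumes g: "\<And>j. j \<in> {1..J} \<Longrightarrow> 0 \<le> g j"
  shows "(\<Sum>j=1..J. h j * g j * ((norm (V j) + norm (V (j - 1))) / 2))
         \<le> sqrt (\<Sum>j=1..J. h j * (g j)\<^sup>2) * nrm0 V"
proof -
  let ?b = "\<lambda>j. (norm (V j) + norm (V (j - 1))) / 2"
  have hp: "0 \<le> h j" if "j \<in> {1..J}" for j using h_pos[OF that] by simp
  have mean_sq: "((a + b) / 2)\<^sup>2 \<le> (a\<^sup>2 + b\<^sup>2) / 2" for a b :: real
  proof -
    have "(a\<^sup>2 + b\<^sup>2) / 2 - ((a + b) / 2)\<^sup>2 = ((a - b) / 2)\<^sup>2"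
      by (simp add: power2_eq_square field_simps)
    then show ?thesis by (metis diff_ge_0_iff_ge zero_le_power2)
  qed
  have "(\<Sum>j=1..J. h j * g j * ?b j)
      = (\<Sum>j=1..J. (sqrt (h j) * g j) * (sqrt (h j) * ?b j))"
  proof (rule sum.cong)
    fix j assume "j \<in> {1..J}"
    then have "sqrt (h j) * sqrt (h j) = h j" using hp by simp
    then have "h j * g j * ?b j = (sqrt (h j) * sqrt (h j)) * g j * ?b j" by simp
    then show "h j * g j * ?b j = (sqrt (h j) * g j) * (sqrt (h j) * ?b j)"
      by (simp only: mult_ac)
  qed simp
  also have "\<dots> \<le> L2_set (\<lambda>j. sqrt (h j) * g j) {1..J} * L2_set (\<lambda>j. sqrt (h j) * ?b j) {1..J}"
  proof -
    have "(\<Sum>j=1..J. (sqrt (h j) * g j) * (sqrt (h j) * ?b j))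
       = (\<Sum>j=1..J. \<bar>sqrt (h j) * g j\<bar> * \<bar>sqrt (h j) * ?b j\<bar>)"
      by (rule sum.cong) (use hp g in \<open>auto simp: abs_mult\<close>)
    then show ?thesis
      using L2_set_mult_ineq[of "\<lambda>j. sqrt (h j) * g j" "\<lambda>j. sqrt (h j) * ?b j" "{1..J}"] by simp
  qed
  also have "L2_set (\<lambda>j. sqrt (h j) * g j) {1..J} = sqrt (\<Sum>j=1..J. h j * (g j)\<^sup>2)"
  proof -
    have "(\<Sum>j=1..J. (sqrt (h j) * g j)\<^sup>2) = (\<Sum>j=1..J. h j * (g j)\<^sup>2)"
      by (rule sum.cong) (simp_all add: power_mult_distrib hp)
    then show ?thesis by (simp only: L2_set_def)
  qed
  also have "sqrt (\<Sum>j=1..J. h j * (g j)\<^sup>2) * L2_set (\<lambda>j. sqrt (h j) * ?b j) {1..J}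
      \<le> sqrt (\<Sum>j=1..J. h j * (g j)\<^sup>2) * nrm0 V"
  proof (rule mult_left_mono)
    have "(\<Sum>j=1..J. (sqrt (h j) * ?b j)\<^sup>2) \<le> (nrm0 V)\<^sup>2"
      unfolding nrm0_sq
    proof (rule sum_mono)
      fix j assume j: "j \<in> {1..J}"
      have "(?b j)\<^sup>2 \<le> ((norm (V j))\<^sup>2 + (norm (V (j - 1)))\<^sup>2) / 2"
        by (rule mean_sq)
      then have "h j * (?b j)\<^sup>2 \<le> h j * (((norm (V j))\<^sup>2 + (norm (V (j - 1)))\<^sup>2) / 2)"
        using hp[OF j] by (rule mult_left_mono)
      then show "(sqrt (h j) * ?b j)\<^sup>2 \<le> h j * ((norm (V j))\<^sup>2 + (norm (V (j - 1)))\<^sup>2) / 2"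
        using hp[OF j] by (simp only: power_mult_distrib) simp
    qed
    then show "L2_set (\<lambda>j. sqrt (h j) * ?b j) {1..J} \<le> nrm0 V"
      unfolding L2_set_def by (intro real_le_lsqrt) (auto intro: sum_nonneg)
  qed (use hp in \<open>auto intro!: sum_nonneg\<close>)
  finally show ?thesis .
qed

section \<open>Stability of the two stages\<close>

lemma wip_weight_perturbation:
  assumes v: "\<And>j. j \<le> J \<Longrightarrow> norm (v j) \<le> B"
    and w: "\<And>j. j \<in> {1..J} \<Longrightarrow> \<bar>w j - w' j\<bar> \<le> G * norm (dq E j)"
    and "0 \<le> G"
  shows "\<bar>wip w v V - wip w' v V\<bar> \<le> B * G * nrm1 E * nrm0 V"
proof -
  have B: "0 \<le> B" using v[of 0] norm_ge_zero order_trans by blast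
  have "\<bar>wip w v V - wip w' v V\<bar>
     \<le> (\<Sum>j=1..J. \<bar>h j * (w j - w' j) * (v j \<bullet> V j + v (j - 1) \<bullet> V (j - 1)) / 2\<bar>)"
    unfolding wip_weight_diff[symmetric] unfolding wip_def by (rule sum_abs)
  also have "\<dots> \<le> (\<Sum>j=1..J. B * G * (h j * norm (dq E j) * ((norm (V j) + norm (V (j - 1))) / 2)))"
  proof (rule sum_mono)
    fix j assume j: "j \<in> {1..J}"
    have "\<bar>v j \<bullet> V j + v (j - 1) \<bullet> V (j - 1)\<bar> \<le> norm (v j) * norm (V j) + norm (v (j - 1)) * norm (V (j - 1))"
      using Cauchy_Schwarz_ineq2[of "v j" "V j"] Cauchy_Schwarz_ineq2[of "v (j-1)" "V (j-1)"] by linarith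
    also have "\<dots> \<le> B * norm (V j) + B * norm (V (j - 1))"
      using j v[of j] v[of "j - 1"] by (intro add_mono mult_right_mono) auto
    finally have 1: "\<bar>v j \<bullet> V j + v (j - 1) \<bullet> V (j - 1)\<bar> \<le> B * (norm (V j) + norm (V (j - 1)))"
      by (simp add: algebra_simps)
    have hj: "0 < h j" by (rule h_pos[OF j])
    have "\<bar>h j * (w j - w' j) * (v j \<bullet> V j + v (j - 1) \<bullet> V (j - 1)) / 2\<bar>
       = h j * \<bar>w j - w' j\<bar> * \<bar>v j \<bullet> V j + v (j - 1) \<bullet> V (j - 1)\<bar> / 2"
      using hj by (simp add: abs_mult)
    also have "\<dots> \<le> h j * (G * norm (dq E j)) * (B * (norm (V j) + norm (V (j - 1)))) / 2"
      using hj w[OF j] 1 B \<open>0 \<le> G\<close> by (intro divide_right_mono mult_mono) auto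
    finally show "\<bar>h j * (w j - w' j) * (v j \<bullet> V j + v (j - 1) \<bullet> V (j - 1)) / 2\<bar>
       \<le> B * G * (h j * norm (dq E j) * ((norm (V j) + norm (V (j - 1))) / 2))"
      by (simp add: mult_ac)
  qed
  also have "\<dots> = B * G * (\<Sum>j=1..J. h j * norm (dq E j) * ((norm (V j) + norm (V (j - 1))) / 2))"
    by (simp add: sum_distrib_left)
  also have "\<dots> \<le> B * G * (sqrt (\<Sum>j=1..J. h j * (norm (dq E j))\<^sup>2) * nrm0 V)"
    using B \<open>0 \<le> G\<close> by (intro mult_left_mono sum_mean_le_nrm0) auto
  also have "sqrt (\<Sum>j=1..J. h j * (norm (dq E j))\<^sup>2) = nrm1 E"
    unfolding nrm1_sq[symmetric] by simp
  finally show ?thesis by (simp add: mult_ac)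
qed

text \<open>The quadratic dependence of the coefficient on the solution becomes linear in the error once the
  difference quotients of the error are at most 1.\<close>

lemma sq_length_perturbation:
  assumes "norm (dq y j) \<le> G" "norm (dq (\<lambda>j. y j - Y j) j) \<le> 1"
  shows "\<bar>(norm (dq Y j))\<^sup>2 - (norm (dq y j))\<^sup>2\<bar> \<le> (2 * G + 1) * norm (dq (\<lambda>j. y j - Y j) j)"
proof -
  let ?e = "dq (\<lambda>j. y j - Y j) j"
  have Y: "dq Y j = dq y j - ?e" by (simp add: dq_diff)
  have "\<bar>norm (dq Y j) - norm (dq y j)\<bar> \<le> norm ?e"
    unfolding dq_diff using norm_triangle_ineq3[of "dq Y j" "dq y j"] by (simp add: norm_minus_commute)
  moreover have "norm (dq Y j) + norm (dq y j) \<le> 2 * G + 1"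
    using assms norm_triangle_ineq4[of "dq y j" ?e] unfolding Y by linarith
  ultimately have "\<bar>norm (dq Y j) - norm (dq y j)\<bar> * (norm (dq Y j) + norm (dq y j)) \<le> norm ?e * (2 * G + 1)"
    by (intro mult_mono) auto
  moreover have "(norm (dq Y j))\<^sup>2 - (norm (dq y j))\<^sup>2
     = (norm (dq Y j) - norm (dq y j)) * (norm (dq Y j) + norm (dq y j))"
    by (simp add: power2_eq_square algebra_simps)
  ultimately show ?thesis by (simp add: abs_mult mult.commute)
qed

text \<open>Common to both stages: \<open>y\<close> and \<open>Y\<close> are the exact and the discrete function in the coefficient, \<open>v\<close> and \<open>v'\<close>
  the exact and the discrete rate of change, \<open>s\<close> and \<open>s'\<close> the arguments of the stiffness form. Subtracting the
  scheme from the exact equation, both with the discrete coefficient, leaves the truncation error and the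
  effect of exchanging the coefficient in front of the bounded exact rate.\<close>

lemma error_residual:
  assumes w: "\<And>j. j \<in> {1..J} \<Longrightarrow> norm (dq y j) \<le> G" "\<And>j. j \<in> {1..J} \<Longrightarrow> norm (dq (\<lambda>j. y j - Y j) j) \<le> 1"
    and v: "\<And>j. j \<le> J \<Longrightarrow> norm (v j) \<le> B" and G: "0 \<le> G"
    and res: "\<bar>wip (speed2 y) v V + stiff s V\<bar> \<le> \<epsilon> * nrm0 V"
    and scheme: "wip (speed2 Y) v' V + stiff s' V = 0"
  shows "wip (speed2 Y) (\<lambda>j. v j - v' j) V + stiff (\<lambda>j. s j - s' j) V
     \<le> (\<epsilon> + B * (2 * G + 1) * nrm1 (\<lambda>j. y j - Y j)) * nrm0 V"
proof -
  have "\<bar>wip (speed2 Y) v V - wip (speed2 y) v V\<bar>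
     \<le> B * (2 * G + 1) * nrm1 (\<lambda>j. y j - Y j) * nrm0 V"
    by (rule wip_weight_perturbation[OF v sq_length_perturbation[OF w]]) (use G in auto)
  then show ?thesis using res scheme
    unfolding wip_diff stiff_diff by (simp add: ring_distribs)
qed

text \<open>Test function: the increment of the error. The identity
  \<open>2 a(E, E - e) = a(E, E) - a(e, e) + a(E - e, E - e)\<close> produces the seminorms.\<close>

lemma predictor_stability:
  assumes per: "X 0 = X J" "Y 0 = Y J" "y0 0 = y0 J" "y1 0 = y1 J"
    and "0 < \<tau>" "0 < \<omega>" "0 \<le> G"
    and w: "\<And>j. j \<in> {1..J} \<Longrightarrow> norm (dq y0 j) \<le> G" "\<And>j. j \<in> {1..J} \<Longrightarrow> norm (dq (\<lambda>j. y0 j - X j) j) \<le> 1"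
      "\<And>j. j \<in> {1..J} \<Longrightarrow> \<omega> \<le> (norm (dq X j))\<^sup>2"
    and v: "\<And>j. j \<le> J \<Longrightarrow> norm ((y1 j - y0 j) /\<^sub>R \<tau>) \<le> B"
    and res: "\<And>V. V 0 = V J \<Longrightarrow> \<bar>wip (speed2 y0) (\<lambda>j. (y1 j - y0 j) /\<^sub>R \<tau>) V + stiff y1 V\<bar> \<le> \<epsilon> * nrm0 V"
    and scheme: "\<And>V. V 0 = V J \<Longrightarrow> wip (speed2 X) (\<lambda>j. (Y j - X j) /\<^sub>R \<tau>) V + stiff Y V = 0"
  shows "(nrm1 (\<lambda>j. y1 j - Y j))\<^sup>2 \<le> (nrm1 (\<lambda>j. y0 j - X j))\<^sup>2
      + \<tau> / (2 * \<omega>) * (\<epsilon> + B * (2 * G + 1) * nrm1 (\<lambda>j. y0 j - X j))\<^sup>2"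
proof -
  let ?e = "\<lambda>j. y0 j - X j" and ?E = "\<lambda>j. y1 j - Y j"
  let ?d = "\<lambda>j. ?E j - ?e j"
  let ?A = "\<epsilon> + B * (2 * G + 1) * nrm1 ?e"
  have 0: "wip (speed2 X) (\<lambda>j. (y1 j - y0 j) /\<^sub>R \<tau> - (Y j - X j) /\<^sub>R \<tau>) ?d
     + stiff ?E ?d \<le> ?A * nrm0 ?d"
    by (rule error_residual[where y = y0 and Y = X and V = ?d and G = G and B = B and \<epsilon> = \<epsilon>
          and v = "\<lambda>j. (y1 j - y0 j) /\<^sub>R \<tau>" and v' = "\<lambda>j. (Y j - X j) /\<^sub>R \<tau>" and s = y1 and s' = Y])
      (rule w(1) w(2) v \<open>0 \<le> G\<close> res scheme | assumption | simp add: per)+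
  have "(\<lambda>j. (y1 j - y0 j) /\<^sub>R \<tau> - (Y j - X j) /\<^sub>R \<tau>) = (\<lambda>j. inverse \<tau> *\<^sub>R ?d j)"
    by (rule ext) (simp add: scaleR_diff_right)
  then have 1: "inverse \<tau> * wip (speed2 X) ?d ?d + stiff ?E ?d \<le> ?A * nrm0 ?d"
    using 0 by (simp only: wip_scale)
  have 2: "\<omega> * (nrm0 ?d)\<^sup>2 \<le> wip (speed2 X) ?d ?d" by (rule wip_lower) (rule w)
  have 3: "stiff ?E ?d = stiff ?E ?E - stiff ?e ?E"
    unfolding stiff_commute[of ?E ?d] by (rule stiff_diff)
  have 4: "(nrm1 ?d)\<^sup>2 = stiff ?E ?E - 2 * stiff ?e ?E + stiff ?e ?e"
  proof -
    have "stiff ?d ?d = stiff ?E ?d - stiff ?e ?d" by (rule stiff_diff)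
    moreover have "stiff ?e ?d = stiff ?E ?e - stiff ?e ?e"
      unfolding stiff_commute[of ?e ?d] by (rule stiff_diff)
    moreover have "stiff ?E ?e = stiff ?e ?E" by (rule stiff_commute)
    ultimately show ?thesis unfolding nrm1_sq_stiff 3 by simp
  qed
  show ?thesis unfolding nrm1_sq_stiff
    by (rule predictor_algebra[OF 1 2 3 4 zero_le_power2 \<open>0 < \<tau>\<close> \<open>0 < \<omega>\<close>])
qed

text \<open>Test function: the discrete time derivative of the error. The mean of old and new values makes the
  stiffness term an exact difference of squares.\<close>

lemma corrector_stability:
  assumes per: "X 0 = X J" "X' 0 = X' J" "y0 0 = y0 J" "y2 0 = y2 J"
    and "0 < \<tau>" "0 < \<omega>" "0 \<le> G"
    and w: "\<And>j. j \<in> {1..J} \<Longrightarrow> norm (dq y1 j) \<le> G" "\<And>j. j \<in> {1..J} \<Longrightarrow> norm (dq (\<lambda>j. y1 j - Y j) j) \<le> 1"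
      "\<And>j. j \<in> {1..J} \<Longrightarrow> \<omega> \<le> (norm (dq Y j))\<^sup>2"
    and v: "\<And>j. j \<le> J \<Longrightarrow> norm ((y2 j - y0 j) /\<^sub>R \<tau>) \<le> B"
    and res: "\<And>V. V 0 = V J \<Longrightarrow> \<bar>wip (speed2 y1) (\<lambda>j. (y2 j - y0 j) /\<^sub>R \<tau>) V
       + stiff (\<lambda>j. (1/2) *\<^sub>R (y2 j + y0 j)) V\<bar> \<le> \<epsilon> * nrm0 V"
    and scheme: "\<And>V. V 0 = V J \<Longrightarrow> wip (speed2 Y) (\<lambda>j. (X' j - X j) /\<^sub>R \<tau>) V
       + stiff (\<lambda>j. (1/2) *\<^sub>R (X' j + X j)) V = 0"
  shows "(nrm1 (\<lambda>j. y2 j - X' j))\<^sup>2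
      + \<omega> * \<tau> * (nrm0 (\<lambda>j. (y2 j - y0 j) /\<^sub>R \<tau> - (X' j - X j) /\<^sub>R \<tau>))\<^sup>2
    \<le> (nrm1 (\<lambda>j. y0 j - X j))\<^sup>2
      + \<tau> / \<omega> * (\<epsilon> + B * (2 * G + 1) * nrm1 (\<lambda>j. y1 j - Y j))\<^sup>2"
proof -
  let ?e = "\<lambda>j. y0 j - X j" and ?e' = "\<lambda>j. y2 j - X' j"
  let ?d = "\<lambda>j. (y2 j - y0 j) /\<^sub>R \<tau> - (X' j - X j) /\<^sub>R \<tau>"
  let ?A = "\<epsilon> + B * (2 * G + 1) * nrm1 (\<lambda>j. y1 j - Y j)"
  have 1: "wip (speed2 Y) ?d ?d
     + stiff (\<lambda>j. (1/2) *\<^sub>R (y2 j + y0 j) - (1/2) *\<^sub>R (X' j + X j)) ?d \<le> ?A * nrm0 ?d"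
    by (rule error_residual[where y = y1 and Y = Y and V = ?d and G = G and B = B and \<epsilon> = \<epsilon>
          and v = "\<lambda>j. (y2 j - y0 j) /\<^sub>R \<tau>" and v' = "\<lambda>j. (X' j - X j) /\<^sub>R \<tau>"
          and s = "\<lambda>j. (1/2) *\<^sub>R (y2 j + y0 j)" and s' = "\<lambda>j. (1/2) *\<^sub>R (X' j + X j)"])
      (rule w(1) w(2) v \<open>0 \<le> G\<close> res scheme | assumption | simp add: per)+
  have 2: "\<omega> * (nrm0 ?d)\<^sup>2 \<le> wip (speed2 Y) ?d ?d" by (rule wip_lower) (rule w)
  have 3: "stiff (\<lambda>j. (1/2) *\<^sub>R (y2 j + y0 j) - (1/2) *\<^sub>R (X' j + X j)) ?d
     = ((nrm1 ?e')\<^sup>2 - (nrm1 ?e)\<^sup>2) / (2 * \<tau>)"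
  proof -
    have a: "(\<lambda>j. (1/2) *\<^sub>R (y2 j + y0 j) - (1/2) *\<^sub>R (X' j + X j)) = (\<lambda>j. (1/2) *\<^sub>R (?e' j + ?e j))"
      by (rule ext) (simp add: scaleR_diff_right scaleR_add_right)
    have b: "?d = (\<lambda>j. inverse \<tau> *\<^sub>R (?e' j - ?e j))"
      by (rule ext) (simp add: scaleR_diff_right)
    have "stiff (\<lambda>j. ?e' j + ?e j) (\<lambda>j. ?e' j - ?e j) = stiff ?e' ?e' - stiff ?e ?e"
      by (rule stiff_sum_diff[of ?e' ?e])
    moreover have "stiff (\<lambda>j. (1/2) *\<^sub>R (?e' j + ?e j)) (\<lambda>j. inverse \<tau> *\<^sub>R (?e' j - ?e j))
        = 1/2 * (inverse \<tau> * stiff (\<lambda>j. ?e' j + ?e j) (\<lambda>j. ?e' j - ?e j))"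
      unfolding stiff_scale stiff_scale_right by (rule refl)
    ultimately show ?thesis
      unfolding a b nrm1_sq_stiff by (simp only:) (simp only: divide_inverse inverse_mult_distrib mult_1 mult_ac)
  qed
  show ?thesis by (rule corrector_algebra[OF 1 2 3 \<open>0 < \<tau>\<close> \<open>0 < \<omega>\<close>])
qed

end

section \<open>Finite element functions and their nodal values\<close>

lemma continuous_periodic_extension:
  fixes g :: "real \<Rightarrow> 'a::real_normed_vector"
  assumes g: "continuous_on {0..1} g" and g01: "g 0 = g 1"
  shows "continuous_on UNIV (\<lambda>r. g (frac r))"
proof -
  have unit: "continuous_on {real_of_int n..real_of_int n + 1} (\<lambda>r. g (frac r))" for n
  proof -
    have "continuous_on {real_of_int n..real_of_int n + 1} (\<lambda>r. g (r - of_int n))"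
      by (rule continuous_on_compose2[OF g]) (auto intro!: continuous_intros)
    moreover have "g (frac r) = g (r - of_int n)" if "r \<in> {real_of_int n..real_of_int n + 1}" for r
    proof (cases "r = of_int n + 1")
      case True
      then have "frac r = 0" by (metis frac_of_int of_int_1 of_int_add)
      then show ?thesis using True g01 by simp
    next
      case False
      then have "\<lfloor>r\<rfloor> = n" using that by (intro floor_unique) auto
      then show ?thesis by (simp add: frac_def)
    qed
    ultimately show ?thesis by (metis (no_types, lifting) continuous_on_eq)
  qed
  have "isCont (\<lambda>r. g (frac r)) r" for r
  proof -
    define n where "n = \<lfloor>r\<rfloor>"
    have r: "of_int n \<le> r" "r < of_int n + 1" unfolding n_def by linarith+
    have "continuous_on ({real_of_int (n - 1)..real_of_int (n - 1) + 1} \<union> {real_of_int n..real_of_int n + 1})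
       (\<lambda>r. g (frac r))"
      by (intro continuous_on_closed_Un unit closed_real_atLeastAtMost)
    then have "continuous_on {real_of_int n - 1<..<real_of_int n + 1} (\<lambda>r. g (frac r))"
      by (rule continuous_on_subset) auto
    then show ?thesis using r
      by (subst (asm) continuous_on_eq_continuous_at) auto
  qed
  then show ?thesis by (simp add: continuous_on_eq_continuous_at)
qed

lemma periodic1_frac: "periodic1 f \<Longrightarrow> f (frac r) = f r"
proof -
  assume f: "periodic1 f"
  have nat: "f (r + real n) = f r" for r n
  proof (induction n)
    case (Suc n)
    have "f (r + real (Suc n)) = f ((r + real n) + 1)" by (simp add: algebra_simps)
    then show ?case using f Suc by (simp add: periodic1_def)
  qed simp
  have "f (s + of_int k) = f s" for s k
    by (cases k rule: int_cases2) (use nat[of s] nat[of "s - real n" n for n] in auto)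
  from this[of "frac r" "\<lfloor>r\<rfloor>"] show "f (frac r) = f r" by (simp add: frac_def)
qed

lemma vfe_space_iff: "f \<in> vfe_space J p \<longleftrightarrow> (\<forall>i. (\<lambda>r. f r $ i) \<in> fe_space J p)"
  by (simp add: vfe_space_def)

locale fe_mesh =
  fixes J :: nat and p :: "nat \<Rightarrow> real"
  assumes mesh: "is_mesh J p"
begin

lemma J_ge: "3 \<le> J" and p_0 [simp]: "p 0 = 0" and p_J [simp]: "p J = 1"
  using mesh by (auto simp: is_mesh_def)

lemma p_less: "i < j \<Longrightarrow> j \<le> J \<Longrightarrow> p i < p j"
  using mesh by (auto simp: is_mesh_def strict_mono_on_def)

lemma p_le: "i \<le> j \<Longrightarrow> j \<le> J \<Longrightarrow> p i \<le> p j"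
  using p_less[of i j] by (cases "i = j") auto

lemma p_01: "j \<le> J \<Longrightarrow> 0 \<le> p j" "j \<le> J \<Longrightarrow> p j \<le> 1"
  using p_le[of 0 j] p_le[of j J] by auto

lemma elem_size_pos: "j \<in> {1..J} \<Longrightarrow> 0 < elem_size p j"
  using p_less[of "j - 1" j] by (auto simp: elem_size_def)

sublocale grid J "elem_size p"
  by unfold_locales (use J_ge elem_size_pos in auto)

lemma obtain_element:
  assumes "r \<in> {0..1}"
  obtains j where "j \<in> {1..J}" "r \<in> {p (j - 1)..p j}"
proof (cases "r = 0")
  case True
  then show ?thesis using that[of 1] J_ge p_01[of 1] by auto
next
  case False
  define j where "j = (LEAST j. r \<le> p j)"
  have 1: "r \<le> p J" using assms by simp
  then have "r \<le> p j" "j \<le> J" unfolding j_def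
    using LeastI[of "\<lambda>j. r \<le> p j" J] Least_le[of "\<lambda>j. r \<le> p j" J] by auto
  moreover have "j \<noteq> 0" using calculation False assms by (cases "j = 0") auto
  moreover have "\<not> r \<le> p (j - 1)" using \<open>j \<noteq> 0\<close> not_less_Least[of "j - 1" "\<lambda>j. r \<le> p j"]
    by (simp add: j_def[symmetric])
  ultimately show ?thesis using that[of j] by auto
qed

lemma has_integral_pieces:
  fixes F :: "real \<Rightarrow> real"
  assumes "\<And>j. j \<in> {1..J} \<Longrightarrow> (F has_integral I j) {p (j - 1)..p j}" and "n \<le> J"
  shows "(F has_integral (\<Sum>j=1..n. I j)) {0..p n}"
  using \<open>n \<le> J\<close>
proof (induction n)
  case 0
  then show ?case by (simp add: has_integral_refl)
next
  case (Suc n)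
  have "(F has_integral (\<Sum>j=1..n. I j) + I (Suc n)) {0..p (Suc n)}"
    by (rule has_integral_combine[of 0 "p n"])
      (use Suc assms(1)[of "Suc n"] p_01[of n] p_le[of n "Suc n"] in auto)
  then show ?case by simp
qed

lemma integral_piecewise_const:
  fixes F :: "real \<Rightarrow> real"
  assumes "\<And>j r. j \<in> {1..J} \<Longrightarrow> p (j - 1) < r \<Longrightarrow> r < p j \<Longrightarrow> F r = c j"
  shows "integral {0..1} F = (\<Sum>j=1..J. elem_size p j * c j)"
proof -
  have "(F has_integral (\<Sum>j=1..J. elem_size p j * c j)) {0..p J}"
  proof (rule has_integral_pieces)
    fix j assume j: "j \<in> {1..J}"
    have "((\<lambda>_. c j) has_integral elem_size p j * c j) {p (j - 1)..p j}"
      using has_integral_const_real[of "c j" "p (j - 1)" "p j"] elem_size_pos[OF j]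
      by (simp add: elem_size_def)
    then show "(F has_integral elem_size p j * c j) {p (j - 1)..p j}"
      by (rule has_integral_spike_finite[of "{p (j - 1), p j}", rotated 2]) (use assms[OF j] in auto)
  qed simp
  then show ?thesis by (simp add: integral_unique)
qed

lemma sum_elem: "(\<Sum>j=1..J. elem_size p j) = 1"
  using integral_piecewise_const[of "\<lambda>_. 1" "\<lambda>_. 1"] by simp

text \<open>A non-integrable \<open>norm (u r)\<^sup>2\<close> is covered, because its integral is 0 by convention.\<close>

lemma L2_inner_le_pieces:
  fixes u :: "real \<Rightarrow> 'a::real_inner"
  assumes c: "\<And>j r. j \<in> {1..J} \<Longrightarrow> p (j - 1) < r \<Longrightarrow> r < p j \<Longrightarrow> (norm (u r))\<^sup>2 \<le> c j"
    and c0: "\<And>j. j \<in> {1..J} \<Longrightarrow> 0 \<le> c j"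
  shows "L2_inner u u \<le> (\<Sum>j=1..J. elem_size p j * c j)"
proof (cases "(\<lambda>r. u r \<bullet> u r) integrable_on {0..1}")
  case False
  then have "L2_inner u u = 0" by (simp add: L2_inner_def not_integrable_integral)
  moreover have "0 \<le> (\<Sum>j=1..J. elem_size p j * c j)"
    by (rule sum_nonneg) (simp add: c0 elem_size_pos less_imp_le)
  ultimately show ?thesis by simp
next
  case True
  let ?F = "\<lambda>r. u r \<bullet> u r"
  have int: "?F integrable_on {p (j - 1)..p j}" if "j \<in> {1..J}" for j
    by (rule integrable_subinterval_real[OF True]) (use that p_01[of j] p_01[of "j - 1"] in auto)
  have "(?F has_integral (\<Sum>j=1..J. integral {p (j - 1)..p j} ?F)) {0..p J}"
    by (rule has_integral_pieces) (rule integrable_integral[OF int] | assumption | simp)+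
  then have "L2_inner u u = (\<Sum>j=1..J. integral {p (j - 1)..p j} ?F)"
    by (simp add: L2_inner_def integral_unique)
  also have "\<dots> \<le> (\<Sum>j=1..J. elem_size p j * c j)"
  proof (rule sum_mono)
    fix j assume j: "j \<in> {1..J}"
    have 1: "((\<lambda>_. c j) has_integral elem_size p j * c j) {p (j - 1)..p j}"
      using has_integral_const_real[of "c j" "p (j - 1)" "p j"] elem_size_pos[OF j]
      by (simp add: elem_size_def)
    let ?G = "\<lambda>r. if r \<in> {p (j - 1), p j} then 0 else ?F r"
    have 2: "(?G has_integral integral {p (j - 1)..p j} ?F) {p (j - 1)..p j}"
      by (rule has_integral_spike_finite[of "{p (j - 1), p j}" _ _ ?F])
        (use integrable_integral[OF int[OF j]] in auto)
    show "integral {p (j - 1)..p j} ?F \<le> elem_size p j * c j"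
      by (rule has_integral_le[OF 2 1])
        (use c[OF j] c0[OF j] in \<open>auto simp: power2_norm_eq_inner\<close>)
  qed
  finally show ?thesis .
qed

lemma fe_space_affine:
  assumes "f \<in> fe_space J p" "j \<in> {1..J}" "r \<in> {p (j - 1)..p j}"
  shows "f r = f (p (j - 1)) + (r - p (j - 1)) *\<^sub>R dq (\<lambda>j. f (p j)) j"
proof -
  obtain a b where ab: "\<And>r. r \<in> {p (j - 1)..p j} \<Longrightarrow> f r = a + b * r"
    using assms(1,2) unfolding fe_space_def by blast
  have h: "p j - p (j - 1) > 0" using elem_size_pos[OF assms(2)] by (simp add: elem_size_def)
  have "f (p (j - 1)) = a + b * p (j - 1)" "f (p j) = a + b * p j" "f r = a + b * r"
    using ab h assms(3) by auto
  moreover have "((a + b * p j) - (a + b * p (j - 1))) / (p j - p (j - 1)) = b"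
    using h by (simp add: field_simps)
  ultimately show ?thesis
    by (simp add: dq_def elem_size_def divide_inverse_commute algebra_simps)
qed

lemma vfe_space_affine:
  assumes "f \<in> vfe_space J p" "j \<in> {1..J}" "r \<in> {p (j - 1)..p j}"
  shows "f r = f (p (j - 1)) + (r - p (j - 1)) *\<^sub>R dq (\<lambda>j. f (p j)) j"
proof (rule vec_eq_iff[THEN iffD2, rule_format])
  fix i
  show "f r $ i = (f (p (j - 1)) + (r - p (j - 1)) *\<^sub>R dq (\<lambda>j. f (p j)) j) $ i"
    using fe_space_affine[of "\<lambda>r. f r $ i" j r] assms by (simp add: vfe_space_iff dq_def)
qed

lemma fe_space_eqI:
  assumes f: "f \<in> fe_space J p" and g: "g \<in> fe_space J p"
    and eq: "\<And>j. j \<in> {1..J} \<Longrightarrow> f (p j) = g (p j)"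
  shows "f = g"
proof
  fix r :: real
  have per: "periodic1 f" "periodic1 g" using f g by (auto simp: fe_space_def)
  have eq': "f (p j) = g (p j)" if "j \<le> J" for j
  proof (cases "j = 0")
    case True
    have "f (0 + 1) = f 0" "g (0 + 1) = g 0" using per unfolding periodic1_def by blast+
    then show ?thesis using True eq[of J] J_ge by simp
  qed (use that eq in auto)
  have "frac r \<in> {0..1}" by (simp add: less_imp_le[OF frac_lt_1])
  then obtain j where j: "j \<in> {1..J}" "frac r \<in> {p (j - 1)..p j}" by (rule obtain_element)
  have "f (frac r) = g (frac r)"
    using fe_space_affine[OF f j] fe_space_affine[OF g j] eq'[of j] eq'[of "j - 1"] j(1)
    by (auto simp: dq_def)
  then show "f r = g r" using per by (simp add: periodic1_frac)
qed

lemma vfe_space_eqI: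
  assumes "f \<in> vfe_space J p" "g \<in> vfe_space J p"
    and "\<And>j. j \<in> {1..J} \<Longrightarrow> f (p j) = g (p j)"
  shows "f = g"
proof
  fix r :: real
  show "f r = g r"
  proof (rule vec_eq_iff[THEN iffD2, rule_format])
    fix i
    have "(\<lambda>r. f r $ i) = (\<lambda>r. g r $ i)"
      by (rule fe_space_eqI) (use assms in \<open>auto simp: vfe_space_iff\<close>)
    then show "f r $ i = g r $ i" by meson
  qed
qed

lemma vfe_space_periodic: "f \<in> vfe_space J p \<Longrightarrow> f (p 0) = f (p J)"
proof (rule vec_eq_iff[THEN iffD2, rule_format])
  fix i assume "f \<in> vfe_space J p"
  then have "f (0 + 1) $ i = f 0 $ i" unfolding vfe_space_iff fe_space_def periodic1_def by blast
  then show "f (p 0) $ i = f (p J) $ i" by simp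
qed

lemma vfe_space_continuous: "f \<in> vfe_space J p \<Longrightarrow> continuous_on UNIV f"
proof -
  assume "f \<in> vfe_space J p"
  then have "continuous_on UNIV (\<lambda>r. \<chi> i. f r $ i)"
    by (intro continuous_on_vec_lambda) (auto simp: vfe_space_iff fe_space_def)
  then show ?thesis by simp
qed

text \<open>Summing clamped ramps gives continuity for free; on each element all ramps but one are constant.\<close>

definition pl01 :: "(nat \<Rightarrow> 'a::real_normed_vector) \<Rightarrow> real \<Rightarrow> 'a" where
  "pl01 U r = U 0 + (\<Sum>j=1..J. max 0 (min 1 ((r - p (j - 1)) / elem_size p j)) *\<^sub>R (U j - U (j - 1)))"

text \<open>The ramps of the elements to the left of \<open>i\<close> have value 1, those to the right 0, and the differences
  of the nodal values telescope.\<close>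

lemma pl01_on_element:
  assumes i: "i \<in> {1..J}" and r: "r \<in> {p (i - 1)..p i}"
  shows "pl01 U r = U (i - 1) + ((r - p (i - 1)) / elem_size p i) *\<^sub>R (U i - U (i - 1))"
proof -
  let ?m = "\<lambda>j. max 0 (min 1 ((r - p (j - 1)) / elem_size p j))"
  have lo: "?m j = 1" if "j \<in> {1..i - 1}" for j
  proof -
    have "p j \<le> p (i - 1)" using that i by (intro p_le) auto
    moreover have "0 < elem_size p j" using that i by (intro elem_size_pos) auto
    ultimately have "1 \<le> (r - p (j - 1)) / elem_size p j"
      using r by (simp add: field_simps elem_size_def)
    then show ?thesis by simp
  qed
  have hi: "?m j = 0" if "j \<in> {Suc i..J}" for j
  proof -
    have "p i \<le> p (j - 1)" using that i by (intro p_le) auto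
    moreover have "0 < elem_size p j" using that i by (intro elem_size_pos) auto
    ultimately have "(r - p (j - 1)) / elem_size p j \<le> 0"
      using r by (simp add: field_simps)
    then show ?thesis by simp
  qed
  have mid: "?m i = (r - p (i - 1)) / elem_size p i"
    using r elem_size_pos[OF i] by (simp add: field_simps elem_size_def min_def max_def)
  have "{1..J} = {1..i - 1} \<union> {i} \<union> {Suc i..J}" using i by auto
  then have "(\<Sum>j=1..J. ?m j *\<^sub>R (U j - U (j - 1)))
     = (\<Sum>j\<in>{1..i - 1} \<union> {i} \<union> {Suc i..J}. ?m j *\<^sub>R (U j - U (j - 1)))" by simp
  also have "\<dots> = (\<Sum>j=1..i - 1. ?m j *\<^sub>R (U j - U (j - 1))) + ?m i *\<^sub>R (U i - U (i - 1))
       + (\<Sum>j=Suc i..J. ?m j *\<^sub>R (U j - U (j - 1)))"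
    using i by (subst sum.union_disjoint | force)+
  also have "(\<Sum>j=1..i - 1. ?m j *\<^sub>R (U j - U (j - 1))) = (\<Sum>j=1..i - 1. U j - U (j - 1))"
    by (rule sum.cong) (simp_all only: lo scaleR_one)
  also have "\<dots> = U (i - 1) - U 0"
  proof (induction "i - 1")
    case (Suc n)
    have "(\<Sum>j=1..n. U j - U (j - 1)) = U n - U 0" for n by (induction n) auto
    then show ?case .
  qed simp
  also have "(\<Sum>j=Suc i..J. ?m j *\<^sub>R (U j - U (j - 1))) = 0"
    by (rule sum.neutral) (use hi in auto)
  finally show ?thesis unfolding pl01_def mid by simp
qed

definition pl :: "(nat \<Rightarrow> 'a::real_normed_vector) \<Rightarrow> real \<Rightarrow> 'a" where
  "pl U r = pl01 U (frac r)"

lemma pl01_node: "j \<le> J \<Longrightarrow> pl01 U (p j) = U j"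
proof (cases "j = 0")
  case True
  then show ?thesis using pl01_on_element[of 1 "p 0" U] J_ge p_01[of 1] by auto
next
  case False
  assume "j \<le> J"
  with False show ?thesis
    using pl01_on_element[of j "p j" U] p_le[of "j - 1" j] elem_size_pos[of j]
    by (auto simp: elem_size_def)
qed

lemma pl_eq_pl01:
  assumes "U 0 = U J" "r \<in> {0..1}"
  shows "pl U r = pl01 U r"
proof (cases "r = 1")
  case True
  then show ?thesis using pl01_node[of 0 U] pl01_node[of J U] assms by (simp add: pl_def)
next
  case False
  then have "frac r = r" using assms by (subst frac_eq) auto
  then show ?thesis by (simp add: pl_def)
qed

lemma pl_node: "U 0 = U J \<Longrightarrow> j \<le> J \<Longrightarrow> pl U (p j) = U j"
  using pl_eq_pl01[of U "p j"] pl01_node[of j U] p_01[of j] by simp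

lemma pl_in_fe_space:
  fixes U :: "nat \<Rightarrow> real"
  assumes "U 0 = U J"
  shows "pl U \<in> fe_space J p"
proof -
  have "continuous_on {0..1} (pl01 U)"
    unfolding pl01_def by (intro continuous_intros) (use elem_size_pos in force)
  moreover have "pl01 U 0 = pl01 U 1"
    using pl01_node[of 0 U] pl01_node[of J U] assms by simp
  ultimately have "continuous_on UNIV (pl U)"
    unfolding pl_def by (rule continuous_periodic_extension)
  moreover have "periodic1 (pl U)"
    by (simp add: periodic1_def pl_def frac_1_eq)
  moreover have "\<exists>a b. \<forall>r\<in>{p (j - 1)..p j}. pl U r = a + b * r" if j: "j \<in> {1..J}" for j
  proof (intro exI ballI)
    fix r assume r: "r \<in> {p (j - 1)..p j}"
    moreover have "0 \<le> p (j - 1)" "p j \<le> 1" using j by (auto intro: p_01)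
    ultimately have "r \<in> {0..1}" by auto
    then show "pl U r = (U (j - 1) - p (j - 1) / elem_size p j * (U j - U (j - 1)))
        + ((U j - U (j - 1)) / elem_size p j) * r"
      using pl_eq_pl01[OF assms] pl01_on_element[OF j r, of U]
      by (simp add: diff_divide_distrib algebra_simps)
  qed
  ultimately show ?thesis by (simp add: fe_space_def)
qed

lemma pl_in_vfe_space:
  fixes U :: "nat \<Rightarrow> real^'d"
  assumes "U 0 = U J"
  shows "pl U \<in> vfe_space J p"
proof -
  have "(\<lambda>r. pl U r $ i) = pl (\<lambda>j. U j $ i)" for i
    by (simp add: pl_def pl01_def fun_eq_iff)
  then show ?thesis using pl_in_fe_space[of "\<lambda>j. U j $ i" for i] assms
    by (simp add: vfe_space_iff)
qed

lemma vinterp_nodal: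
  fixes f :: "real \<Rightarrow> real^'d"
  assumes "f 0 = f 1"
  shows "vinterp J p f \<in> vfe_space J p" "j \<le> J \<Longrightarrow> vinterp J p f (p j) = f (p j)"
proof -
  have I: "interp J p g = pl (\<lambda>j. g (p j))" if g: "g 0 = g 1" for g
    unfolding interp_def
  proof (rule the_equality)
    show "pl (\<lambda>j. g (p j)) \<in> fe_space J p \<and> (\<forall>j\<in>{1..J}. pl (\<lambda>j. g (p j)) (p j) = g (p j))"
      using g by (simp add: pl_in_fe_space pl_node)
    then show "k = pl (\<lambda>j. g (p j))" if "k \<in> fe_space J p \<and> (\<forall>j\<in>{1..J}. k (p j) = g (p j))" for k
      by (intro fe_space_eqI) (use that in auto)
  qed
  have V: "(\<lambda>r. vinterp J p f r $ i) = pl (\<lambda>j. f (p j) $ i)" for i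
    unfolding vinterp_def using I[of "\<lambda>s. f s $ i"] assms by simp
  show "vinterp J p f \<in> vfe_space J p"
    unfolding vfe_space_iff V using assms by (simp add: pl_in_fe_space)
  show "vinterp J p f (p j) = f (p j)" if "j \<le> J"
  proof (rule vec_eq_iff[THEN iffD2, rule_format])
    fix i
    have "vinterp J p f (p j) $ i = pl (\<lambda>j. f (p j) $ i) (p j)" using V[of i] by (rule fun_cong)
    then show "vinterp J p f (p j) $ i = f (p j) $ i" using that assms by (simp add: pl_node)
  qed
qed

lemma d_rho_vfe:
  assumes "f \<in> vfe_space J p" "j \<in> {1..J}" "p (j - 1) < r" "r < p j"
  shows "(f has_vector_derivative dq (\<lambda>j. f (p j)) j) (at r)" "d_rho f r = dq (\<lambda>j. f (p j)) j"
proof -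
  have "((\<lambda>r. f (p (j - 1)) + (r - p (j - 1)) *\<^sub>R dq (\<lambda>j. f (p j)) j)
      has_vector_derivative dq (\<lambda>j. f (p j)) j) (at r)"
    by (auto intro!: derivative_eq_intros)
  then show *: "(f has_vector_derivative dq (\<lambda>j. f (p j)) j) (at r)"
  proof (rule has_vector_derivative_transform_within_open)
    show "f (p (j - 1)) + (s - p (j - 1)) *\<^sub>R dq (\<lambda>j. f (p j)) j = f s"
      if "s \<in> {p (j - 1)<..<p j}" for s
      by (rule vfe_space_affine[OF assms(1,2), symmetric]) (use that in simp)
  qed (use assms(3,4) in simp_all)
  then show "d_rho f r = dq (\<lambda>j. f (p j)) j" by (simp add: d_rho_def vector_derivative_at)
qed

lemma L2_inner_d_rho:
  assumes "f \<in> vfe_space J p" "g \<in> vfe_space J p"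
  shows "L2_inner (d_rho f) (d_rho g) = stiff (\<lambda>j. f (p j)) (\<lambda>j. g (p j))"
  unfolding L2_inner_def stiff_def
  by (rule integral_piecewise_const) (simp add: d_rho_vfe assms)

lemma L2_inner_d_rho_mean:
  assumes "f \<in> vfe_space J p" "f' \<in> vfe_space J p" "g \<in> vfe_space J p"
  shows "1/2 * L2_inner (\<lambda>r. d_rho f r + d_rho f' r) (d_rho g)
      = stiff (\<lambda>j. (1/2) *\<^sub>R (f (p j) + f' (p j))) (\<lambda>j. g (p j))"
proof -
  have "L2_inner (\<lambda>r. d_rho f r + d_rho f' r) (d_rho g)
      = stiff (\<lambda>j. f (p j) + f' (p j)) (\<lambda>j. g (p j))"
    unfolding L2_inner_def stiff_def
    by (rule integral_piecewise_const) (simp add: d_rho_vfe assms dq_add)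
  then show ?thesis by (simp add: stiff_scale)
qed

text \<open>The derivative of a finite element function is constant inside each element, so the one-sided limits at
  the nodes see the difference quotient of the element they are taken in.\<close>

lemma lumped_inner_nodal:
  assumes X: "X \<in> vfe_space J p" and u: "continuous_on UNIV u" and v: "continuous_on UNIV v"
  shows "lumped_inner J p u (\<lambda>r. (norm (d_rho X r))\<^sup>2 *\<^sub>R v r)
     = wip (speed2 (\<lambda>j. X (p j))) (\<lambda>j. u (p j)) (\<lambda>j. v (p j))"
proof -
  let ?w = "\<lambda>j. (norm (dq (\<lambda>j. X (p j)) j))\<^sup>2"
  have uv: "((\<lambda>r. ?w j * (u r \<bullet> v r)) \<longlongrightarrow> ?w j * (u s \<bullet> v s)) (at s within S)" for j s S
  proof -
    have "isCont u s" "isCont v s" using u v by (simp_all add: continuous_on_eq_continuous_at)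
    then have "isCont (\<lambda>r. ?w j * (u r \<bullet> v r)) s" by (intro continuous_intros)
    then show ?thesis
      using continuous_at_imp_continuous_at_within continuous_within by blast
  qed
  have L: "Lim (at_left (p j)) (\<lambda>r. u r \<bullet> (norm (d_rho X r))\<^sup>2 *\<^sub>R v r) = ?w j * (u (p j) \<bullet> v (p j))"
    and R: "Lim (at_right (p (j - 1))) (\<lambda>r. u r \<bullet> (norm (d_rho X r))\<^sup>2 *\<^sub>R v r)
        = ?w j * (u (p (j - 1)) \<bullet> v (p (j - 1)))" if j: "j \<in> {1..J}" for j
  proof -
    have lt: "p (j - 1) < p j" using elem_size_pos[OF j] by (simp add: elem_size_def)
    have eq: "?w j * (u r \<bullet> v r) = u r \<bullet> (norm (d_rho X r))\<^sup>2 *\<^sub>R v r" if "r \<in> {p (j - 1)<..<p j}" for r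
      using that d_rho_vfe(2)[OF X j] by simp
    show "Lim (at_left (p j)) (\<lambda>r. u r \<bullet> (norm (d_rho X r))\<^sup>2 *\<^sub>R v r) = ?w j * (u (p j) \<bullet> v (p j))"
    proof (rule tendsto_Lim)
      show "((\<lambda>r. u r \<bullet> (norm (d_rho X r))\<^sup>2 *\<^sub>R v r) \<longlongrightarrow> ?w j * (u (p j) \<bullet> v (p j))) (at_left (p j))"
        using uv by (rule Lim_transform_eventually)
          (rule eventually_mono[OF eventually_at_left_real[OF lt] eq])
    qed simp
    show "Lim (at_right (p (j - 1))) (\<lambda>r. u r \<bullet> (norm (d_rho X r))\<^sup>2 *\<^sub>R v r)
        = ?w j * (u (p (j - 1)) \<bullet> v (p (j - 1)))"
    proof (rule tendsto_Lim)
      show "((\<lambda>r. u r \<bullet> (norm (d_rho X r))\<^sup>2 *\<^sub>R v r) \<longlongrightarrow> ?w j * (u (p (j - 1)) \<bullet> v (p (j - 1))))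
          (at_right (p (j - 1)))"
        using uv by (rule Lim_transform_eventually)
          (rule eventually_mono[OF eventually_at_right_real[OF lt] eq])
    qed simp
  qed
  have "lumped_inner J p u (\<lambda>r. (norm (d_rho X r))\<^sup>2 *\<^sub>R v r) = 1/2 * (\<Sum>j=1..J. elem_size p j *
      (?w j * (u (p j) \<bullet> v (p j)) + ?w j * (u (p (j - 1)) \<bullet> v (p (j - 1)))))"
    unfolding lumped_inner_def by (rule arg_cong[where f = "\<lambda>s. 1/2 * s"], rule sum.cong) (simp_all only: L R)
  then show ?thesis unfolding wip_def by (simp add: sum_distrib_left algebra_simps add_divide_distrib)
qed

text \<open>Test functions may be replaced by their nodal values, because every periodic nodal function is
  interpolated by a finite element function.\<close>

lemma all_vfe_iff_all_nodal:
  fixes P :: "(nat \<Rightarrow> real^'d) \<Rightarrow> bool"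
  assumes cong: "\<And>V W. (\<And>j. j \<le> J \<Longrightarrow> V j = W j) \<Longrightarrow> P V = P W"
  shows "(\<forall>\<eta>\<in>vfe_space J p. P (\<lambda>j. \<eta> (p j))) \<longleftrightarrow> (\<forall>V. V 0 = V J \<longrightarrow> P V)"
proof safe
  fix V :: "nat \<Rightarrow> real^'d" assume *: "\<forall>\<eta>\<in>vfe_space J p. P (\<lambda>j. \<eta> (p j))" "V 0 = V J"
  then have "P (\<lambda>j. pl V (p j))" by (simp add: pl_in_vfe_space)
  also have "P (\<lambda>j. pl V (p j)) = P V" by (rule cong) (simp add: pl_node *)
  finally show "P V" .
next
  fix \<eta> :: "real \<Rightarrow> real^'d" assume "\<forall>V. V 0 = V J \<longrightarrow> P V" "\<eta> \<in> vfe_space J p"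
  then show "P (\<lambda>j. \<eta> (p j))" using vfe_space_periodic[of \<eta>] by simp
qed

lemma wip_cong: "(\<And>j. j \<le> J \<Longrightarrow> V j = W j) \<Longrightarrow> wip w U V = wip w U W"
  unfolding wip_def by (intro sum.cong) auto

lemma stiff_cong: "(\<And>j. j \<le> J \<Longrightarrow> V j = W j) \<Longrightarrow> stiff U V = stiff U W"
  unfolding stiff_def dq_def by (intro sum.cong) auto

lemma predictor_nodal:
  fixes X Y :: "real \<Rightarrow> real^'d"
  assumes "X \<in> vfe_space J p" "Y \<in> vfe_space J p"
  shows "(\<forall>\<eta>\<in>vfe_space J p.
       lumped_inner J p (\<lambda>r. (Y r - X r) /\<^sub>R \<tau>) (\<lambda>r. (norm (d_rho X r))\<^sup>2 *\<^sub>R \<eta> r)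
         + L2_inner (d_rho Y) (d_rho \<eta>) = 0)
     \<longleftrightarrow> (\<forall>V. V 0 = V J \<longrightarrow> wip (speed2 (\<lambda>j. X (p j))) (\<lambda>j. (Y (p j) - X (p j)) /\<^sub>R \<tau>) V
         + stiff (\<lambda>j. Y (p j)) V = 0)" (is "?L \<longleftrightarrow> ?R")
proof -
  have c: "continuous_on UNIV (\<lambda>r. (Y r - X r) /\<^sub>R \<tau>)"
    by (intro continuous_intros vfe_space_continuous[OF assms(1)] vfe_space_continuous[OF assms(2)])
  have "?L \<longleftrightarrow> (\<forall>\<eta>\<in>vfe_space J p. wip (speed2 (\<lambda>j. X (p j))) (\<lambda>j. (Y (p j) - X (p j)) /\<^sub>R \<tau>) (\<lambda>j. \<eta> (p j))
         + stiff (\<lambda>j. Y (p j)) (\<lambda>j. \<eta> (p j)) = 0)"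
    by (intro ball_cong refl)
      (simp only: lumped_inner_nodal[OF assms(1) c vfe_space_continuous] L2_inner_d_rho[OF assms(2)])
  also have "\<dots> \<longleftrightarrow> ?R"
    by (rule all_vfe_iff_all_nodal) (simp cong: wip_cong stiff_cong)
  finally show ?thesis .
qed

lemma corrector_nodal:
  fixes X X' Y :: "real \<Rightarrow> real^'d"
  assumes "X \<in> vfe_space J p" "X' \<in> vfe_space J p" "Y \<in> vfe_space J p"
  shows "(\<forall>\<eta>\<in>vfe_space J p.
       lumped_inner J p (\<lambda>r. (X' r - X r) /\<^sub>R \<tau>) (\<lambda>r. (norm (d_rho Y r))\<^sup>2 *\<^sub>R \<eta> r)
         + 1/2 * L2_inner (\<lambda>r. d_rho X' r + d_rho X r) (d_rho \<eta>) = 0)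
     \<longleftrightarrow> (\<forall>V. V 0 = V J \<longrightarrow> wip (speed2 (\<lambda>j. Y (p j))) (\<lambda>j. (X' (p j) - X (p j)) /\<^sub>R \<tau>) V
         + stiff (\<lambda>j. (1/2) *\<^sub>R (X' (p j) + X (p j))) V = 0)" (is "?L \<longleftrightarrow> ?R")
proof -
  have c: "continuous_on UNIV (\<lambda>r. (X' r - X r) /\<^sub>R \<tau>)"
    by (intro continuous_intros vfe_space_continuous[OF assms(1)] vfe_space_continuous[OF assms(2)])
  have "?L \<longleftrightarrow> (\<forall>\<eta>\<in>vfe_space J p. wip (speed2 (\<lambda>j. Y (p j))) (\<lambda>j. (X' (p j) - X (p j)) /\<^sub>R \<tau>) (\<lambda>j. \<eta> (p j))
         + stiff (\<lambda>j. (1/2) *\<^sub>R (X' (p j) + X (p j))) (\<lambda>j. \<eta> (p j)) = 0)"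
    by (intro ball_cong refl)
      (simp only: lumped_inner_nodal[OF assms(3) c vfe_space_continuous] L2_inner_d_rho_mean[OF assms(2,1)])
  also have "\<dots> \<longleftrightarrow> ?R"
    by (rule all_vfe_iff_all_nodal) (simp cong: wip_cong stiff_cong)
  finally show ?thesis .
qed

end

section \<open>Unique solvability of a stage\<close>

text \<open>Banach's fixed point theorem for the maximum norm over a finite index set. Only the coordinates in
  \<open>S\<close> are iterated and all others are set to 0.\<close>

lemma finite_contraction_fixpoint:
  fixes \<Phi> :: "(nat \<Rightarrow> 'a::banach) \<Rightarrow> nat \<Rightarrow> 'a"
  assumes fin: "finite S" and \<theta>: "0 \<le> \<theta>" "\<theta> < 1"
    and contr: "\<And>u v j m. j \<in> S \<Longrightarrow> (\<And>i. dist (u i) (v i) \<le> m) \<Longrightarrow> dist (\<Phi> u j) (\<Phi> v j) \<le> \<theta> * m"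
  shows "\<exists>u. \<forall>j\<in>S. u j = \<Phi> u j"
proof -
  define G where "G u j = (if j \<in> S then \<Phi> u j else 0)" for u :: "nat \<Rightarrow> 'a" and j
  define it where "it n = (G ^^ n) (\<lambda>_. 0)" for n
  define m where "m = (\<Sum>j\<in>S. dist (it 1 j) (it 0 j))"
  have it0: "it n j = 0" if "j \<notin> S" for n j
    using that by (cases n) (auto simp: it_def G_def)
  have it_Suc: "it (Suc n) j = \<Phi> (it n) j" if "j \<in> S" for n j
    using that by (simp add: it_def G_def)
  have step: "dist (it (Suc n) j) (it n j) \<le> \<theta> ^ n * m" for n j
  proof (induction n arbitrary: j)
    case 0
    show ?case
    proof (cases "j \<in> S")
      case True
      then show ?thesis unfolding m_def
        using fin member_le_sum[of j S "\<lambda>j. dist (it 1 j) (it 0 j)"] by simp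
    qed (simp add: it0 m_def sum_nonneg)
  next
    case (Suc n)
    show ?case
    proof (cases "j \<in> S")
      case True
      then show ?thesis using contr[OF True Suc.IH] by (simp add: it_Suc mult.assoc)
    qed (use \<theta> in \<open>simp add: it0 m_def sum_nonneg\<close>)
  qed
  have "convergent (\<lambda>n. it n j)" for j
  proof -
    have "summable (\<lambda>n. it (Suc n) j - it n j)"
    proof (rule summable_comparison_test'[where N = 0])
      show "summable (\<lambda>n. \<theta> ^ n * m)" using \<theta> by (intro summable_mult2 summable_geometric) simp
      show "norm (it (Suc n) j - it n j) \<le> \<theta> ^ n * m" for n
        using step[of n j] by (simp add: dist_norm)
    qed
    then have "convergent (\<lambda>n. (\<Sum>k<n. it (Suc k) j - it k j) + it 0 j)"
      by (intro convergent_add convergent_const) (simp add: summable_iff_convergent)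
    moreover have "(\<lambda>n. (\<Sum>k<n. it (Suc k) j - it k j) + it 0 j) = (\<lambda>n. it n j)"
      using sum_lessThan_telescope[of "\<lambda>n. it n j"] by auto
    ultimately show ?thesis by simp
  qed
  then obtain L where L: "\<And>j. (\<lambda>n. it n j) \<longlonglongrightarrow> L j" unfolding convergent_def by metis
  have L0: "L j = 0" if "j \<notin> S" for j
    using L[of j] it0[OF that] by (simp add: LIMSEQ_const_iff)
  have "L j = \<Phi> L j" if j: "j \<in> S" for j
  proof -
    define e where "e n = (\<Sum>i\<in>S. dist (it n i) (L i))" for n
    have e: "dist (it n i) (L i) \<le> e n" for n i
      using fin member_le_sum[of i S "\<lambda>i. dist (it n i) (L i)"]
      by (cases "i \<in> S") (auto simp: e_def it0 L0 sum_nonneg)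
    have "e \<longlonglongrightarrow> (\<Sum>i\<in>S. dist (L i) (L i))"
      unfolding e_def by (intro tendsto_intros L)
    then have lim: "(\<lambda>n. \<theta> * e n) \<longlonglongrightarrow> 0"
      using tendsto_mult_right_zero[of e sequentially \<theta>] by simp
    have "norm (dist (it (Suc n) j) (\<Phi> L j)) \<le> \<theta> * e n" for n
      using contr[OF j e, of n] by (simp add: it_Suc j)
    then have "(\<lambda>n. dist (it (Suc n) j) (\<Phi> L j)) \<longlonglongrightarrow> 0"
      by (intro Lim_null_comparison[OF _ lim] always_eventually allI)
    then have "(\<lambda>n. it (Suc n) j) \<longlonglongrightarrow> \<Phi> L j"
      by (rule tendsto_dist_iff[THEN iffD2])
    moreover have "(\<lambda>n. it (Suc n) j) \<longlonglongrightarrow> L j" using L[of j] by (rule LIMSEQ_Suc)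
    ultimately show ?thesis using LIMSEQ_unique by metis
  qed
  then show ?thesis by blast
qed

context grid
begin

text \<open>In finite difference form the equations of a stage read \<open>b\<^sub>j (U\<^sub>j - F\<^sub>j) + c\<^sub>j U\<^sub>j =\<close> a positive
  combination of the two neighbours with total weight \<open>c\<^sub>j\<close>. Since \<open>b\<^sub>j > 0\<close>, this is a strictly diagonally
  dominant system, so Jacobi iteration contracts in the maximum norm.\<close>

lemma linear_step_exists:
  fixes F :: "nat \<Rightarrow> 'a::{real_inner,banach}"
  assumes w: "\<And>j. j \<in> {1..J} \<Longrightarrow> 0 < w j" and \<tau>: "0 < \<tau>" and F: "F 0 = F J"
  shows "\<exists>U. U 0 = U J \<and> (\<forall>V. V 0 = V J \<longrightarrow> wip w (\<lambda>j. (U j - F j) /\<^sub>R \<tau>) V + stiff U V = 0)"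
proof -
  define prv where "prv j = (if j = 1 then J else j - 1)" for j
  define b where "b j = (h j * w j + h (nxt j) * w (nxt j)) / 2 / \<tau>" for j
  define c where "c j = 1 / h j + 1 / h (nxt j)" for j
  have b: "0 < b j" if "j \<in> {1..J}" for j
    using w[OF that] w[OF nxt_mem[OF that]] h_pos[OF that] h_pos[OF nxt_mem[OF that]] \<tau>
    by (simp add: b_def add_pos_pos)
  have c: "0 < c j" if "j \<in> {1..J}" for j
    using h_pos[OF that] h_pos[OF nxt_mem[OF that]] by (simp add: c_def add_pos_pos)
  define \<Phi> where "\<Phi> u j = (b j *\<^sub>R F j + (1 / h j) *\<^sub>R u (prv j) + (1 / h (nxt j)) *\<^sub>R u (nxt j)) /\<^sub>R (b j + c j)"
    for u j
  define \<theta> where "\<theta> = (MAX j\<in>{1..J}. c j / (b j + c j))"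
  have ne: "finite {1..J}" "{1..J} \<noteq> {}" using J_pos by auto
  have \<theta>_ge: "c j / (b j + c j) \<le> \<theta>" if "j \<in> {1..J}" for j
    unfolding \<theta>_def using that by (intro Max_ge) auto
  have "\<theta> < 1"
    unfolding \<theta>_def using ne b c by (subst Max_less_iff) (auto simp: add_pos_pos)
  have "0 \<le> \<theta>" using \<theta>_ge[of 1] b[of 1] c[of 1] J_pos
    by (meson add_nonneg_nonneg atLeastAtMost_iff divide_nonneg_nonneg le_refl less_imp_le order_trans)
  have "\<exists>u. \<forall>j\<in>{1..J}. u j = \<Phi> u j"
  proof (rule finite_contraction_fixpoint[OF ne(1) \<open>0 \<le> \<theta>\<close> \<open>\<theta> < 1\<close>])
    fix u v :: "nat \<Rightarrow> 'a" and j m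
    assume j: "j \<in> {1..J}" and m: "\<And>i. dist (u i) (v i) \<le> m"
    have m0: "0 \<le> m" using m[of 0] zero_le_dist order_trans by blast
    have h: "0 < h j" "0 < h (nxt j)" using h_pos j nxt_mem by auto
    have bc: "0 < b j + c j" using b[OF j] c[OF j] by simp
    have "\<Phi> u j - \<Phi> v j = ((1 / h j) *\<^sub>R (u (prv j) - v (prv j)) + (1 / h (nxt j)) *\<^sub>R (u (nxt j) - v (nxt j))) /\<^sub>R (b j + c j)"
      by (simp add: \<Phi>_def algebra_simps)
    then have "norm (\<Phi> u j - \<Phi> v j)
      = norm ((1 / h j) *\<^sub>R (u (prv j) - v (prv j)) + (1 / h (nxt j)) *\<^sub>R (u (nxt j) - v (nxt j))) / (b j + c j)"
      using bc by (simp add: divide_inverse_commute)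
    also have "\<dots> \<le> ((1 / h j) * m + (1 / h (nxt j)) * m) / (b j + c j)"
    proof (rule divide_right_mono)
      have "norm ((1 / h j) *\<^sub>R (u (prv j) - v (prv j))) \<le> (1 / h j) * m"
        "norm ((1 / h (nxt j)) *\<^sub>R (u (nxt j) - v (nxt j))) \<le> (1 / h (nxt j)) * m"
        using h m[unfolded dist_norm] by (simp_all add: divide_right_mono)
      then show "norm ((1 / h j) *\<^sub>R (u (prv j) - v (prv j)) + (1 / h (nxt j)) *\<^sub>R (u (nxt j) - v (nxt j)))
          \<le> (1 / h j) * m + (1 / h (nxt j)) * m" by (rule norm_triangle_mono)
    qed (use bc in simp)
    also have "\<dots> = c j / (b j + c j) * m" by (simp add: c_def algebra_simps)
    also have "\<dots> \<le> \<theta> * m" by (rule mult_right_mono[OF \<theta>_ge[OF j] m0])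
    finally show "dist (\<Phi> u j) (\<Phi> v j) \<le> \<theta> * m" by (simp add: dist_norm)
  qed
  then obtain u where u: "\<And>j. j \<in> {1..J} \<Longrightarrow> u j = \<Phi> u j" by blast
  define U where "U j = (if j = 0 then u J else u j)" for j
  have per: "U 0 = U J" by (simp add: U_def)
  have eq: "b j *\<^sub>R (U j - F j) + (dq U j - dq U (nxt j)) = 0" if j: "j \<in> {1..J}" for j
  proof -
    have Ujm: "U (j - 1) = u (prv j)" "U j = u j" "U (nxt j) = u (nxt j)" "U (nxt j - 1) = u j"
      using j nxt_mem[OF j] by (auto simp: U_def prv_def nxt_def)
    have bc: "b j + c j \<noteq> 0" using b[OF j] c[OF j] by simp
    have "(b j + c j) *\<^sub>R u j = b j *\<^sub>R F j + (1 / h j) *\<^sub>R u (prv j) + (1 / h (nxt j)) *\<^sub>R u (nxt j)"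
      by (subst u[OF j]) (simp add: \<Phi>_def bc)
    then show ?thesis
      unfolding dq_def Ujm by (simp add: c_def algebra_simps inverse_eq_divide)
  qed
  have "wip w (\<lambda>j. (U j - F j) /\<^sub>R \<tau>) V + stiff U V = 0" if V: "V 0 = V J" for V
  proof -
    have "wip w (\<lambda>j. (U j - F j) /\<^sub>R \<tau>) V
      = (\<Sum>j=1..J. (h j * w j + h (nxt j) * w (nxt j)) / 2 * (((U j - F j) /\<^sub>R \<tau>) \<bullet> V j))"
      by (rule wip_nodal[of "\<lambda>j. (U j - F j) /\<^sub>R \<tau>", OF _ V]) (simp only: per F)
    also have "\<dots> = (\<Sum>j=1..J. (b j *\<^sub>R (U j - F j)) \<bullet> V j)"
    proof (rule sum.cong[OF refl])
      fix j
      show "(h j * w j + h (nxt j) * w (nxt j)) / 2 * (((U j - F j) /\<^sub>R \<tau>) \<bullet> V j) = (b j *\<^sub>R (U j - F j)) \<bullet> V j"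
        unfolding inner_scaleR_left b_def by (simp only: divide_inverse mult_ac)
    qed
    finally have "wip w (\<lambda>j. (U j - F j) /\<^sub>R \<tau>) V + stiff U V
      = (\<Sum>j=1..J. (b j *\<^sub>R (U j - F j) + (dq U j - dq U (nxt j))) \<bullet> V j)"
      unfolding stiff_nodal[OF V] inner_add_left by (simp add: sum.distrib)
    also have "\<dots> = 0" by (rule sum.neutral) (simp add: eq)
    finally show ?thesis .
  qed
  then show ?thesis using per by blast
qed

text \<open>Testing the difference of two solutions with itself.\<close>

lemma linear_step_unique:
  fixes U U' F :: "nat \<Rightarrow> 'a::real_inner"
  assumes w: "\<And>j. j \<in> {1..J} \<Longrightarrow> 0 < w j" and \<tau>: "0 < \<tau>"
    and per: "U 0 = U J" "U' 0 = U' J"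
    and U: "\<And>V. V 0 = V J \<Longrightarrow> wip w (\<lambda>j. (U j - F j) /\<^sub>R \<tau>) V + stiff U V = 0"
    and U': "\<And>V. V 0 = V J \<Longrightarrow> wip w (\<lambda>j. (U' j - F j) /\<^sub>R \<tau>) V + stiff U' V = 0"
    and "j \<le> J"
  shows "U j = U' j"
proof -
  define D where "D = (\<lambda>j. U j - U' j)"
  have D: "D 0 = D J" using per by (simp add: D_def)
  have 1: "wip w (\<lambda>j. (U j - F j) /\<^sub>R \<tau> - (U' j - F j) /\<^sub>R \<tau>) D + stiff D D = 0"
    using U[OF D] U'[OF D] stiff_diff[of U U' D] unfolding wip_diff D_def[symmetric] by simp
  have "(\<lambda>j. (U j - F j) /\<^sub>R \<tau> - (U' j - F j) /\<^sub>R \<tau>) = (\<lambda>j. inverse \<tau> *\<^sub>R D j)"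
    by (rule ext) (simp add: D_def scaleR_diff_right)
  with 1 have "inverse \<tau> * wip w D D + (nrm1 D)\<^sup>2 = 0"
    by (simp only: wip_scale nrm1_sq_stiff)
  moreover have nn: "0 \<le> h j * w j * (D j \<bullet> D j + D (j - 1) \<bullet> D (j - 1)) / 2" if "j \<in> {1..J}" for j
    using h_pos[OF that] w[OF that] by simp
  then have "0 \<le> wip w D D" unfolding wip_def by (rule sum_nonneg)
  ultimately have "wip w D D = 0"
    using \<tau> by (metis add_nonneg_eq_0_iff inverse_nonnegative_iff_nonnegative less_imp_le
        mult_eq_0_iff mult_nonneg_nonneg nonzero_imp_inverse_nonzero order_less_irrefl zero_le_power2)
  then have z: "h j * w j * (D j \<bullet> D j + D (j - 1) \<bullet> D (j - 1)) / 2 = 0" if "j \<in> {1..J}" for j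
    using nn that unfolding wip_def by (subst (asm) sum_nonneg_eq_0_iff) auto
  have zero: "D j = 0" if j: "j \<in> {1..J}" for j
  proof -
    have "D j \<bullet> D j + D (j - 1) \<bullet> D (j - 1) = 0" using z[OF j] h_pos[OF j] w[OF j] by simp
    then have "D j \<bullet> D j = 0" by (simp add: add_nonneg_eq_0_iff)
    then show ?thesis by simp
  qed
  have "D j = 0"
  proof (cases "j = 0")
    case True
    then show ?thesis using zero[of J] D J_pos by simp
  qed (use \<open>j \<le> J\<close> zero in auto)
  then show ?thesis by (simp add: D_def)
qed

lemma sum_nodal_residual_le:
  assumes V: "V 0 = V J" and "0 \<le> \<epsilon>"
    and R: "\<And>j. j \<in> {1..J} \<Longrightarrow> norm (R j) \<le> \<epsilon> * mu j"
  shows "\<bar>\<Sum>j=1..J. R j \<bullet> V j\<bar> \<le> \<epsilon> * (sqrt (\<Sum>j=1..J. h j) * nrm0 V)"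
proof -
  have "\<bar>\<Sum>j=1..J. R j \<bullet> V j\<bar> \<le> (\<Sum>j=1..J. \<bar>R j \<bullet> V j\<bar>)" by (rule sum_abs)
  also have "\<dots> \<le> (\<Sum>j=1..J. \<epsilon> * mu j * norm (V j))"
    by (rule sum_mono) (meson Cauchy_Schwarz_ineq2 R mult_right_mono norm_ge_zero order_trans)
  also have "\<dots> = \<epsilon> * (\<Sum>j=1..J. h j / 2 * norm (V j) + h (nxt j) / 2 * norm (V j))"
    unfolding sum_distrib_left by (rule sum.cong) (simp_all add: mu_def algebra_simps add_divide_distrib)
  also have "(\<Sum>j=1..J. h j / 2 * norm (V j) + h (nxt j) / 2 * norm (V j))
      = (\<Sum>j=1..J. h j / 2 * norm (V j)) + (\<Sum>j=1..J. h j / 2 * norm (V (j - 1)))"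
    using sum_shift[OF V, of "\<lambda>j v. h j / 2 * norm v"] by (simp add: sum.distrib)
  also have "\<dots> = (\<Sum>j=1..J. h j * 1 * ((norm (V j) + norm (V (j - 1))) / 2))"
    unfolding sum.distrib[symmetric] by (rule sum.cong) (simp_all add: algebra_simps add_divide_distrib)
  also have "\<epsilon> * (\<Sum>j=1..J. h j * 1 * ((norm (V j) + norm (V (j - 1))) / 2))
     \<le> \<epsilon> * (sqrt (\<Sum>j=1..J. h j * 1\<^sup>2) * nrm0 V)"
    using \<open>0 \<le> \<epsilon>\<close> by (intro mult_left_mono sum_mean_le_nrm0) auto
  finally show ?thesis by simp
qed

end

section \<open>Divided differences of smooth functions\<close>

locale smooth_profile =
  fixes f f1 f2 f3 f4 :: "real \<Rightarrow> 'a::real_inner" and B :: real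
  assumes d1: "\<And>r. (f has_vector_derivative f1 r) (at r)"
    and d2: "\<And>r. (f1 has_vector_derivative f2 r) (at r)"
    and d3: "\<And>r. (f2 has_vector_derivative f3 r) (at r)"
    and d4: "\<And>r. (f3 has_vector_derivative f4 r) (at r)"
    and b1: "\<And>r. norm (f1 r) \<le> B" and b2: "\<And>r. norm (f2 r) \<le> B"
    and b3: "\<And>r. norm (f3 r) \<le> B" and b4: "\<And>r. norm (f4 r) \<le> B"
begin

lemma B_nonneg: "0 \<le> B"
  using b1[of 0] norm_ge_zero order_trans by blast

lemma slope_third_order:
  assumes "s \<noteq> 0"
  shows "norm ((f (r + s) - f r) /\<^sub>R s - f1 r - (s / 2) *\<^sub>R f2 r - (s\<^sup>2 / 6) *\<^sub>R f3 r) \<le> B * \<bar>s\<bar>^3"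
proof -
  have "norm (f (r + s) - f r - s *\<^sub>R f1 r - (s\<^sup>2 / 2) *\<^sub>R f2 r - (s^3 / 6) *\<^sub>R f3 r) \<le> B * \<bar>s\<bar>^4"
    using taylor4[of UNIV r "r + s" f f1 f2 f3 f4 B] d1 d2 d3 d4 b4 by simp
  also have "B * \<bar>s\<bar>^4 = B * \<bar>s\<bar>^3 * \<bar>s\<bar>" by (simp add: eval_nat_numeral)
  finally have "norm ((f (r + s) - f r - s *\<^sub>R f1 r - (s\<^sup>2 / 2) *\<^sub>R f2 r - (s^3 / 6) *\<^sub>R f3 r) /\<^sub>R s) \<le> B * \<bar>s\<bar>^3"
    using assms by (rule norm_quotient_le)
  moreover have "inverse s *\<^sub>R (f (r + s) - f r - s *\<^sub>R f1 r - (s\<^sup>2 / 2) *\<^sub>R f2 r - (s^3 / 6) *\<^sub>R f3 r)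
     = (f (r + s) - f r) /\<^sub>R s - f1 r - (s / 2) *\<^sub>R f2 r - (s\<^sup>2 / 6) *\<^sub>R f3 r"
  proof -
    have "inverse s * s = 1" "inverse s * (s\<^sup>2 / 2) = s / 2" "inverse s * (s^3 / 6) = s\<^sup>2 / 6"
      using assms by (simp_all add: field_simps eval_nat_numeral)
    then show ?thesis by (simp only: scaleR_diff_right scaleR_scaleR scaleR_one)
  qed
  ultimately show ?thesis by simp
qed

lemma slope_second_order:
  assumes "s \<noteq> 0"
  shows "norm ((f (r + s) - f r) /\<^sub>R s - f1 r - (s / 2) *\<^sub>R f2 r) \<le> B * s\<^sup>2"
proof -
  have "norm (f (r + s) - f r - s *\<^sub>R f1 r - (s\<^sup>2 / 2) *\<^sub>R f2 r) \<le> B * \<bar>s\<bar>^3"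
    using taylor3[of UNIV r "r + s" f f1 f2 f3 B] d1 d2 d3 b3 by simp
  also have "B * \<bar>s\<bar>^3 = B * s\<^sup>2 * \<bar>s\<bar>" by (simp add: eval_nat_numeral)
  finally have "norm ((f (r + s) - f r - s *\<^sub>R f1 r - (s\<^sup>2 / 2) *\<^sub>R f2 r) /\<^sub>R s) \<le> B * s\<^sup>2"
    using assms by (rule norm_quotient_le)
  moreover have "inverse s *\<^sub>R (f (r + s) - f r - s *\<^sub>R f1 r - (s\<^sup>2 / 2) *\<^sub>R f2 r)
     = (f (r + s) - f r) /\<^sub>R s - f1 r - (s / 2) *\<^sub>R f2 r"
  proof -
    have "inverse s * s = 1" "inverse s * (s\<^sup>2 / 2) = s / 2"
      using assms by (simp_all add: field_simps eval_nat_numeral)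
    then show ?thesis by (simp only: scaleR_diff_right scaleR_scaleR scaleR_one)
  qed
  ultimately show ?thesis by simp
qed

lemma backward_slope: "(f r - f (r - k)) /\<^sub>R k = (f (r + (- k)) - f r) /\<^sub>R (- k)"
  by (simp add: scaleR_diff_right)

text \<open>The one-sided slopes have errors of third order in the step, and the terms with the third derivative
  combine to \<open>(l\<^sup>2 - k\<^sup>2)/6 = (l - k)(l + k)/6\<close>, which is of order \<open>h\<^sup>3\<close> because \<open>k\<close> and \<open>l\<close> differ by \<open>O(h\<^sup>2)\<close>.\<close>

lemma second_difference:
  assumes k: "0 < k" "k \<le> h" and l: "0 < l" "l \<le> h" and kl: "\<bar>k - l\<bar> \<le> K * h\<^sup>2"
  shows "norm ((f (r + l) - f r) /\<^sub>R l - (f r - f (r - k)) /\<^sub>R k - ((k + l) / 2) *\<^sub>R f2 r)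
     \<le> 2 * (K + 1) * B * h\<^sup>2 * ((k + l) / 2)"
proof -
  let ?p = "(f (r + l) - f r) /\<^sub>R l - f1 r - (l / 2) *\<^sub>R f2 r - (l\<^sup>2 / 6) *\<^sub>R f3 r"
  let ?m = "(f r - f (r - k)) /\<^sub>R k - f1 r - (- k / 2) *\<^sub>R f2 r - (k\<^sup>2 / 6) *\<^sub>R f3 r"
  have p: "norm ?p \<le> B * l^3" using slope_third_order[of l r] l by simp
  have m: "norm ?m \<le> B * k^3" using slope_third_order[of "- k" r] k unfolding backward_slope by simp
  have eq: "(f (r + l) - f r) /\<^sub>R l - (f r - f (r - k)) /\<^sub>R k - ((k + l) / 2) *\<^sub>R f2 r
     = ?p - ?m + ((l\<^sup>2 - k\<^sup>2) / 6) *\<^sub>R f3 r"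
    by (simp add: diff_divide_distrib add_divide_distrib algebra_simps)
  have "norm (((l\<^sup>2 - k\<^sup>2) / 6) *\<^sub>R f3 r) \<le> K * B * h\<^sup>2 * (k + l)"
  proof -
    have "\<bar>l\<^sup>2 - k\<^sup>2\<bar> = \<bar>k - l\<bar> * (k + l)"
    proof -
      have "l\<^sup>2 - k\<^sup>2 = - (k - l) * (k + l)" by (simp add: power2_eq_square algebra_simps)
      then show ?thesis using k l by (simp add: abs_mult abs_minus_commute)
    qed
    also have "\<dots> \<le> K * h\<^sup>2 * (k + l)" using kl k l by (intro mult_right_mono) auto
    finally have "\<bar>l\<^sup>2 - k\<^sup>2\<bar> * norm (f3 r) \<le> K * h\<^sup>2 * (k + l) * B"
      by (intro mult_mono b3) auto
    then have "\<bar>l\<^sup>2 - k\<^sup>2\<bar> * norm (f3 r) / 6 \<le> K * h\<^sup>2 * (k + l) * B"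
      using mult_nonneg_nonneg[OF abs_ge_zero[of "l\<^sup>2 - k\<^sup>2"] norm_ge_zero[of "f3 r"]] by linarith
    then show ?thesis by (simp add: mult_ac)
  qed
  moreover have cube: "B * s^3 \<le> B * h\<^sup>2 * s" if "0 < s" "s \<le> h" for s
  proof -
    have "s\<^sup>2 \<le> h\<^sup>2" using that by (intro power_mono) auto
    then have "s\<^sup>2 * s \<le> h\<^sup>2 * s" using that by (intro mult_right_mono) auto
    then have "B * (s\<^sup>2 * s) \<le> B * (h\<^sup>2 * s)" by (rule mult_left_mono) (rule B_nonneg)
    then show ?thesis by (simp add: eval_nat_numeral mult_ac)
  qed
  moreover have "norm (?p - ?m + ((l\<^sup>2 - k\<^sup>2) / 6) *\<^sub>R f3 r)
      \<le> norm ?p + norm ?m + norm (((l\<^sup>2 - k\<^sup>2) / 6) *\<^sub>R f3 r)"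
    by (meson add_mono norm_triangle_ineq norm_triangle_ineq4 order_refl order_trans)
  ultimately have "norm (?p - ?m + ((l\<^sup>2 - k\<^sup>2) / 6) *\<^sub>R f3 r) \<le> B * h\<^sup>2 * l + B * h\<^sup>2 * k + K * B * h\<^sup>2 * (k + l)"
    using p m cube[OF k] cube[OF l] by linarith
  also have "\<dots> = 2 * (K + 1) * B * h\<^sup>2 * ((k + l) / 2)" by (simp add: field_simps)
  finally show ?thesis unfolding eq .
qed

lemma slope_sq:
  assumes "s \<noteq> 0" "\<bar>s\<bar> \<le> 1"
  shows "\<bar>(norm ((f (r + s) - f r) /\<^sub>R s))\<^sup>2 - (norm (f1 r))\<^sup>2 - s * (f1 r \<bullet> f2 r)\<bar> \<le> 5 * B\<^sup>2 * s\<^sup>2"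
proof -
  define q where "q = (f (r + s) - f r) /\<^sub>R s - f1 r - (s / 2) *\<^sub>R f2 r"
  define g where "g = (s / 2) *\<^sub>R f2 r + q"
  have q: "norm q \<le> B * s\<^sup>2" unfolding q_def by (rule slope_second_order) fact
  have s2: "s\<^sup>2 \<le> \<bar>s\<bar>" using assms(2) mult_right_mono[of "\<bar>s\<bar>" 1 "\<bar>s\<bar>"]
    by (simp add: power2_eq_square abs_mult_self_eq)
  have "norm ((s / 2) *\<^sub>R f2 r) \<le> \<bar>s\<bar> / 2 * B"
    using mult_left_mono[OF b2[of r], of "\<bar>s\<bar> / 2"] by simp
  moreover have "B * s\<^sup>2 \<le> B * \<bar>s\<bar>" using s2 B_nonneg by (rule mult_left_mono)
  moreover have "\<bar>s\<bar> / 2 * B = (B * \<bar>s\<bar>) / 2" "3/2 * B * \<bar>s\<bar> = 3/2 * (B * \<bar>s\<bar>)" by simp_all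
  ultimately have "norm g \<le> 3/2 * B * \<bar>s\<bar>"
    using norm_triangle_ineq[of "(s / 2) *\<^sub>R f2 r" q] q unfolding g_def by argo
  then have g: "(norm g)\<^sup>2 \<le> (3/2 * B * \<bar>s\<bar>)\<^sup>2" by (rule power_mono) simp
  have fq: "\<bar>f1 r \<bullet> q\<bar> \<le> B * (B * s\<^sup>2)"
    using Cauchy_Schwarz_ineq2[of "f1 r" q] mult_mono[OF b1[of r] q B_nonneg norm_ge_zero] by linarith
  have "(f (r + s) - f r) /\<^sub>R s = f1 r + g" by (simp add: g_def q_def)
  then have "(norm ((f (r + s) - f r) /\<^sub>R s))\<^sup>2 = (norm (f1 r))\<^sup>2 + 2 * (f1 r \<bullet> g) + (norm g)\<^sup>2"
    by (simp add: power2_norm_eq_inner inner_add_left inner_add_right inner_commute)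
  moreover have "f1 r \<bullet> g = s / 2 * (f1 r \<bullet> f2 r) + f1 r \<bullet> q"
    by (simp add: g_def inner_add_right)
  ultimately have "(norm ((f (r + s) - f r) /\<^sub>R s))\<^sup>2 - (norm (f1 r))\<^sup>2 - s * (f1 r \<bullet> f2 r)
     = 2 * (f1 r \<bullet> q) + (norm g)\<^sup>2" by simp
  moreover have "(3/2 * B * \<bar>s\<bar>)\<^sup>2 = 9/4 * (B\<^sup>2 * s\<^sup>2)" by (simp add: power_mult_distrib power2_eq_square)
  moreover have "B * (B * s\<^sup>2) = B\<^sup>2 * s\<^sup>2" by (simp add: power2_eq_square)
  moreover have "0 \<le> B\<^sup>2 * s\<^sup>2" by simp
  ultimately show ?thesis using fq g zero_le_power2[of "norm g"] unfolding abs_le_iff by linarith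
qed

text \<open>The same cancellation: the first order terms of the two squared slopes, weighted with the element
  lengths, combine to \<open>(l\<^sup>2 - k\<^sup>2) / 2\<close> times \<open>f\<^sub>1 \<bullet> f\<^sub>2\<close>.\<close>

lemma lumped_coefficient:
  assumes k: "0 < k" "k \<le> h" and l: "0 < l" "l \<le> h" and kl: "\<bar>k - l\<bar> \<le> K * h\<^sup>2" and "h \<le> 1"
  shows "\<bar>(k * (norm ((f r - f (r - k)) /\<^sub>R k))\<^sup>2 + l * (norm ((f (r + l) - f r) /\<^sub>R l))\<^sup>2) / 2
       - (k + l) / 2 * (norm (f1 r))\<^sup>2\<bar> \<le> (K + 5) * B\<^sup>2 * h\<^sup>2 * ((k + l) / 2)"
proof -
  define P where "P = (norm ((f (r + l) - f r) /\<^sub>R l))\<^sup>2 - (norm (f1 r))\<^sup>2 - l * (f1 r \<bullet> f2 r)"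
  define M where "M = (norm ((f r - f (r - k)) /\<^sub>R k))\<^sup>2 - (norm (f1 r))\<^sup>2 + k * (f1 r \<bullet> f2 r)"
  have h2: "5 * B\<^sup>2 * s\<^sup>2 \<le> 5 * B\<^sup>2 * h\<^sup>2" if "0 < s" "s \<le> h" for s
    using that by (intro mult_left_mono power_mono) auto
  have P: "\<bar>P\<bar> \<le> 5 * B\<^sup>2 * h\<^sup>2"
    using slope_sq[of l r] l \<open>h \<le> 1\<close> h2[OF l] unfolding P_def by linarith
  have M: "\<bar>M\<bar> \<le> 5 * B\<^sup>2 * h\<^sup>2"
    using slope_sq[of "- k" r] k \<open>h \<le> 1\<close> h2[OF k] unfolding M_def backward_slope by simp
  have kM: "\<bar>k * M\<bar> \<le> k * (5 * B\<^sup>2 * h\<^sup>2)" using M k by (simp add: abs_mult)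
  have lP: "\<bar>l * P\<bar> \<le> l * (5 * B\<^sup>2 * h\<^sup>2)" using P l by (simp add: abs_mult)
  have f12: "\<bar>f1 r \<bullet> f2 r\<bar> \<le> B\<^sup>2"
    using Cauchy_Schwarz_ineq2[of "f1 r" "f2 r"] mult_mono[OF b1[of r] b2[of r] B_nonneg norm_ge_zero]
    by (simp add: power2_eq_square)
  have "\<bar>(l\<^sup>2 - k\<^sup>2) * (f1 r \<bullet> f2 r)\<bar> = \<bar>k - l\<bar> * (k + l) * \<bar>f1 r \<bullet> f2 r\<bar>"
  proof -
    have "l\<^sup>2 - k\<^sup>2 = - (k - l) * (k + l)" by (simp add: power2_eq_square algebra_simps)
    then show ?thesis using k l by (simp add: abs_mult abs_minus_commute)
  qed
  also have "\<dots> \<le> (K * h\<^sup>2) * (k + l) * B\<^sup>2"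
    using kl f12 k l order_trans[OF abs_ge_zero kl] by (intro mult_mono) auto
  finally have D: "\<bar>(l\<^sup>2 - k\<^sup>2) * (f1 r \<bullet> f2 r)\<bar> \<le> (K * h\<^sup>2) * (k + l) * B\<^sup>2" .
  have eq1: "(k * (norm ((f r - f (r - k)) /\<^sub>R k))\<^sup>2 + l * (norm ((f (r + l) - f r) /\<^sub>R l))\<^sup>2) / 2
       - (k + l) / 2 * (norm (f1 r))\<^sup>2 = (k * M + l * P + (l\<^sup>2 - k\<^sup>2) * (f1 r \<bullet> f2 r)) / 2"
    by (simp add: P_def M_def power2_eq_square algebra_simps add_divide_distrib diff_divide_distrib)
  have eq2: "(K + 5) * B\<^sup>2 * h\<^sup>2 * ((k + l) / 2)
     = (k * (5 * B\<^sup>2 * h\<^sup>2) + l * (5 * B\<^sup>2 * h\<^sup>2) + (K * h\<^sup>2) * (k + l) * B\<^sup>2) / 2"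
    by (simp add: algebra_simps add_divide_distrib)
  have tri: "\<bar>(a + b + c) / 2\<bar> \<le> (a' + b' + c') / 2" if "\<bar>a\<bar> \<le> a'" "\<bar>b\<bar> \<le> b'" "\<bar>c\<bar> \<le> c'"
    for a b c a' b' c' :: real using that by (auto simp: abs_le_iff)
  show ?thesis unfolding eq1 eq2 by (rule tri[OF kM lP D])
qed

end

text \<open>For the correction term of the predictor, which carries a factor \<open>\<Delta>t\<^sup>2\<close>, first order accuracy is enough.\<close>

lemma slope_first_order:
  fixes f :: "real \<Rightarrow> 'a::real_normed_vector"
  assumes d: "\<And>r. (f has_vector_derivative f1 r) (at r)" "\<And>r. (f1 has_vector_derivative f2 r) (at r)"
    and b: "\<And>r. norm (f2 r) \<le> B" and "s \<noteq> 0"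
  shows "norm ((f (r + s) - f r) /\<^sub>R s - f1 r) \<le> B * \<bar>s\<bar>"
proof -
  have "norm (f (r + s) - f r - s *\<^sub>R f1 r) \<le> B * s\<^sup>2"
    using taylor2[of UNIV r "r + s" f f1 f2 B] d b by simp
  also have "B * s\<^sup>2 = B * \<bar>s\<bar> * \<bar>s\<bar>" by (simp add: power2_eq_square)
  finally have "norm ((f (r + s) - f r - s *\<^sub>R f1 r) /\<^sub>R s) \<le> B * \<bar>s\<bar>"
    using assms(4) by (rule norm_quotient_le)
  moreover have "inverse s *\<^sub>R (f (r + s) - f r - s *\<^sub>R f1 r) = (f (r + s) - f r) /\<^sub>R s - f1 r"
    using assms(4) by (simp add: scaleR_diff_right)
  ultimately show ?thesis by simp
qed

lemma slope_bound:
  fixes f :: "real \<Rightarrow> 'a::real_normed_vector"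
  assumes d: "\<And>r. (f has_vector_derivative f1 r) (at r)" and b: "\<And>r. norm (f1 r) \<le> B" and "s \<noteq> 0"
  shows "norm ((f (r + s) - f r) /\<^sub>R s) \<le> B"
proof -
  have "norm (f (r + s) - f r) \<le> B * \<bar>s\<bar>"
    using taylor1[of UNIV r "r + s" f f1 B] d b by simp
  then show ?thesis using assms(3) by (rule norm_quotient_le)
qed

section \<open>Consistency of the scheme\<close>

text \<open>What the error analysis needs to know about the exact solution: the derivatives that occur in the
  Taylor expansions, a common bound \<open>B\<close>, and the correction \<open>z\<close> of the predictor. The equation for \<open>z\<close> says that
  \<open>\<Delta>t\<^sup>2 z\<close> cancels the first order defect
  \<open>\<Delta>t (|x\<^sub>\<rho>|\<^sup>2 x\<^sub>t\<^sub>t / 4 - x\<^sub>\<rho>\<^sub>\<rho>\<^sub>t / 2)\<close> of the backward Euler step of length \<open>\<Delta>t / 2\<close>.\<close>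

locale csf_solution =
  fixes x xr xrr xrrr xrrrr xt xtt xttt xrrt xrrtt z zr zrr :: "real \<Rightarrow> real \<Rightarrow> 'a::real_inner"
    and T B c0 :: real
  assumes T_pos: "0 < T" and c0_pos: "0 < c0" and B_ge: "1 \<le> B"
    and x_r: "\<And>r t. t \<in> {0..T} \<Longrightarrow> ((\<lambda>r. x r t) has_vector_derivative xr r t) (at r)"
    and x_rr: "\<And>r t. t \<in> {0..T} \<Longrightarrow> ((\<lambda>r. xr r t) has_vector_derivative xrr r t) (at r)"
    and x_rrr: "\<And>r t. t \<in> {0..T} \<Longrightarrow> ((\<lambda>r. xrr r t) has_vector_derivative xrrr r t) (at r)"
    and x_rrrr: "\<And>r t. t \<in> {0..T} \<Longrightarrow> ((\<lambda>r. xrrr r t) has_vector_derivative xrrrr r t) (at r)"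
    and z_r: "\<And>r t. t \<in> {0..T} \<Longrightarrow> ((\<lambda>r. z r t) has_vector_derivative zr r t) (at r)"
    and z_rr: "\<And>r t. t \<in> {0..T} \<Longrightarrow> ((\<lambda>r. zr r t) has_vector_derivative zrr r t) (at r)"
    and x_t: "\<And>r t. t \<in> {0..T} \<Longrightarrow> (x r has_vector_derivative xt r t) (at t within {0..T})"
    and x_tt: "\<And>r t. t \<in> {0..T} \<Longrightarrow> (xt r has_vector_derivative xtt r t) (at t within {0..T})"
    and x_ttt: "\<And>r t. t \<in> {0..T} \<Longrightarrow> (xtt r has_vector_derivative xttt r t) (at t within {0..T})"
    and x_rrt: "\<And>r t. t \<in> {0..T} \<Longrightarrow> (xrr r has_vector_derivative xrrt r t) (at t within {0..T})"
    and x_rrtt: "\<And>r t. t \<in> {0..T} \<Longrightarrow> (xrrt r has_vector_derivative xrrtt r t) (at t within {0..T})"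
    and bounds: "\<And>r t. t \<in> {0..T} \<Longrightarrow> norm (xr r t) \<le> B \<and> norm (xrr r t) \<le> B \<and> norm (xrrr r t) \<le> B
       \<and> norm (xrrrr r t) \<le> B \<and> norm (xt r t) \<le> B \<and> norm (xttt r t) \<le> B
       \<and> norm (xrrt r t) \<le> B \<and> norm (xrrtt r t) \<le> B
       \<and> norm (z r t) \<le> B \<and> norm (zr r t) \<le> B \<and> norm (zrr r t) \<le> B"
    and x_periodic: "\<And>r t. t \<in> {0..T} \<Longrightarrow> x (r + 1) t = x r t"
    and z_periodic: "\<And>r t. t \<in> {0..T} \<Longrightarrow> z (r + 1) t = z r t"
    and pde: "\<And>r t. t \<in> {0..T} \<Longrightarrow> (norm (xr r t))\<^sup>2 *\<^sub>R xt r t = xrr r t"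
    and corr: "\<And>r t. t \<in> {0..T} \<Longrightarrow>
       (2 * (norm (xr r t))\<^sup>2) *\<^sub>R z r t = (1/2) *\<^sub>R xrrt r t - ((norm (xr r t))\<^sup>2 / 4) *\<^sub>R xtt r t"
    and xr_lower: "\<And>r t. t \<in> {0..T} \<Longrightarrow> c0 \<le> norm (xr r t)"
begin

lemma profile:
  assumes "t \<in> {0..T}"
  shows "smooth_profile (\<lambda>r. x r t) (\<lambda>r. xr r t) (\<lambda>r. xrr r t) (\<lambda>r. xrrr r t) (\<lambda>r. xrrrr r t) B"
  by unfold_locales (use assms x_r x_rr x_rrr x_rrrr bounds in blast)+

lemma sq_le_cube: "B * s \<le> B^3 * s" if "0 \<le> s"
proof -
  have "1 \<le> B\<^sup>2" using B_ge by (simp add: one_le_power)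
  then have "B * 1 \<le> B * B\<^sup>2" using B_ge by (intro mult_left_mono) auto
  then show ?thesis using that by (intro mult_right_mono) (simp_all add: eval_nat_numeral)
qed

lemma xr_sq: "t \<in> {0..T} \<Longrightarrow> (norm (xr r t))\<^sup>2 \<le> B\<^sup>2"
  using bounds by (intro power_mono) auto

lemma scaled_rate_error:
  assumes t: "t \<in> {0..T}" and q: "norm q \<le> B * s"
  shows "norm ((norm (xr r t))\<^sup>2 *\<^sub>R q) \<le> B^3 * s"
proof -
  have "0 \<le> B * s" using q norm_ge_zero order_trans by blast
  have "(norm (xr r t))\<^sup>2 * norm q \<le> B\<^sup>2 * (B * s)"
    using xr_sq[OF t] q by (intro mult_mono) auto
  then show ?thesis by (simp add: eval_nat_numeral mult_ac)
qed

text \<open>Here \<open>\<tau>\<close> is half the time step, so that the predictor is a backward Euler step of length \<open>\<tau>\<close> and the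
  correction is \<open>(2 \<tau>)\<^sup>2 z\<close>. The coefficient is taken at the old time: the first order terms in \<open>\<tau>\<close> cancel by the
  choice of \<open>z\<close>, those of order 0 by the differential equation.\<close>

lemma predictor_truncation:
  assumes t: "0 \<le> t" and \<tau>: "0 < \<tau>" and tT: "t + \<tau> \<le> T"
  shows "norm ((norm (xr r t))\<^sup>2 *\<^sub>R ((x r (t + \<tau>) + (2 * \<tau>)\<^sup>2 *\<^sub>R z r t - x r t) /\<^sub>R \<tau>) - xrr r (t + \<tau>))
      \<le> 2 * B^3 * \<tau>\<^sup>2"
proof -
  let ?n = "(norm (xr r t))\<^sup>2"
  have mem: "t \<in> {0..T}" "t + \<tau> \<in> {0..T}" using t \<tau> tT by auto
  define q1 where "q1 = (x r (t + \<tau>) - x r t - \<tau> *\<^sub>R xt r t - (\<tau>\<^sup>2 / 2) *\<^sub>R xtt r t) /\<^sub>R \<tau>"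
  define q2 where "q2 = xrr r (t + \<tau>) - xrr r t - \<tau> *\<^sub>R xrrt r t"
  have "norm (x r (t + \<tau>) - x r t - (t + \<tau> - t) *\<^sub>R xt r t - ((t + \<tau> - t)\<^sup>2 / 2) *\<^sub>R xtt r t) \<le> B * \<bar>t + \<tau> - t\<bar>^3"
    by (rule taylor3[of "{0..T}" _ _ "x r" "xt r" "xtt r" "xttt r"])
      (use mem x_t x_tt x_ttt bounds in auto)
  then have "norm (x r (t + \<tau>) - x r t - \<tau> *\<^sub>R xt r t - (\<tau>\<^sup>2 / 2) *\<^sub>R xtt r t) \<le> (B * \<tau>\<^sup>2) * \<tau>"
    using \<tau> by (simp add: eval_nat_numeral mult_ac)
  then have q1: "norm q1 \<le> B * \<tau>\<^sup>2"
    unfolding q1_def using \<tau> by (intro norm_quotient_le) simp_all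
  have "norm (xrr r (t + \<tau>) - xrr r t - (t + \<tau> - t) *\<^sub>R xrrt r t) \<le> B * \<bar>t + \<tau> - t\<bar>\<^sup>2"
    by (rule taylor2[of "{0..T}" _ _ "xrr r" "xrrt r" "xrrtt r"])
      (use mem x_rrt x_rrtt bounds in auto)
  then have "norm q2 \<le> B * \<tau>\<^sup>2" using \<tau> by (simp add: q2_def)
  then have q2: "norm q2 \<le> B^3 * \<tau>\<^sup>2" using sq_le_cube[of "\<tau>\<^sup>2"] by simp
  have v: "(x r (t + \<tau>) + (2 * \<tau>)\<^sup>2 *\<^sub>R z r t - x r t) /\<^sub>R \<tau>
      = q1 + xt r t + (\<tau> / 2) *\<^sub>R xtt r t + (4 * \<tau>) *\<^sub>R z r t"
  proof -
    have "x r (t + \<tau>) + (2 * \<tau>)\<^sup>2 *\<^sub>R z r t - x r t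
       = \<tau> *\<^sub>R q1 + \<tau> *\<^sub>R xt r t + (\<tau>\<^sup>2 / 2) *\<^sub>R xtt r t + (2 * \<tau>)\<^sup>2 *\<^sub>R z r t"
      using \<tau> by (simp add: q1_def)
    moreover have "inverse \<tau> * \<tau> = 1" "inverse \<tau> * (\<tau>\<^sup>2 / 2) = \<tau> / 2" "inverse \<tau> * (2 * \<tau>)\<^sup>2 = 4 * \<tau>"
      using \<tau> by (simp_all add: field_simps power2_eq_square)
    ultimately show ?thesis by (simp only: scaleR_add_right scaleR_scaleR scaleR_one)
  qed
  \<comment> \<open>the equation for \<open>z\<close>, multiplied by \<open>2 \<tau>\<close>\<close>
  have c: "?n *\<^sub>R ((\<tau> / 2) *\<^sub>R xtt r t + (4 * \<tau>) *\<^sub>R z r t) = \<tau> *\<^sub>R xrrt r t"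
  proof -
    have "(4 * \<tau> * ?n) *\<^sub>R z r t = (2 * \<tau>) *\<^sub>R ((2 * ?n) *\<^sub>R z r t)" by simp
    also have "\<dots> = \<tau> *\<^sub>R xrrt r t - (\<tau> * ?n / 2) *\<^sub>R xtt r t"
      unfolding corr[OF mem(1)] by (simp add: scaleR_diff_right)
    finally show ?thesis by (simp add: scaleR_add_right mult_ac)
  qed
  have "?n *\<^sub>R ((x r (t + \<tau>) + (2 * \<tau>)\<^sup>2 *\<^sub>R z r t - x r t) /\<^sub>R \<tau>) - xrr r (t + \<tau>) = ?n *\<^sub>R q1 - q2"
  proof -
    have "?n *\<^sub>R (q1 + xt r t + (\<tau> / 2) *\<^sub>R xtt r t + (4 * \<tau>) *\<^sub>R z r t)
      = ?n *\<^sub>R q1 + ?n *\<^sub>R xt r t + ?n *\<^sub>R ((\<tau> / 2) *\<^sub>R xtt r t + (4 * \<tau>) *\<^sub>R z r t)"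
      by (simp add: scaleR_add_right add.assoc)
    also have "\<dots> = ?n *\<^sub>R q1 + xrr r t + \<tau> *\<^sub>R xrrt r t"
      unfolding c pde[OF mem(1)] by simp
    finally show ?thesis unfolding v by (simp add: q2_def)
  qed
  moreover have "norm (?n *\<^sub>R q1 - q2) \<le> B^3 * \<tau>\<^sup>2 + B^3 * \<tau>\<^sup>2"
    by (rule order_trans[OF norm_triangle_ineq4]) (rule add_mono[OF scaled_rate_error[OF mem(1) q1] q2])
  ultimately show ?thesis by simp
qed

text \<open>Everything is expanded at the midpoint \<open>t + \<tau>\<close>, where the odd terms of the two expansions cancel.\<close>

lemma corrector_truncation:
  assumes t: "0 \<le> t" and \<tau>: "0 < \<tau>" and tT: "t + 2 * \<tau> \<le> T"
  shows "norm (xt r (t + \<tau>) - (x r (t + 2 * \<tau>) - x r t) /\<^sub>R (2 * \<tau>)) \<le> B * \<tau>\<^sup>2"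
    and "norm ((norm (xr r (t + \<tau>)))\<^sup>2 *\<^sub>R ((x r (t + 2 * \<tau>) - x r t) /\<^sub>R (2 * \<tau>))
       - (1/2) *\<^sub>R (xrr r (t + 2 * \<tau>) + xrr r t)) \<le> 2 * B^3 * \<tau>\<^sup>2"
proof -
  let ?m = "t + \<tau>"
  let ?n = "(norm (xr r ?m))\<^sup>2"
  have mem: "t \<in> {0..T}" "?m \<in> {0..T}" "t + 2 * \<tau> \<in> {0..T}" using t \<tau> tT by auto
  have T3: "norm (x r b - x r ?m - (b - ?m) *\<^sub>R xt r ?m - ((b - ?m)\<^sup>2 / 2) *\<^sub>R xtt r ?m) \<le> B * \<bar>b - ?m\<bar>^3"
    if "b \<in> {0..T}" for b
    by (rule taylor3[of "{0..T}" _ _ "x r" "xt r" "xtt r" "xttt r"])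
      (use that mem x_t x_tt x_ttt bounds in auto)
  have T2: "norm (xrr r b - xrr r ?m - (b - ?m) *\<^sub>R xrrt r ?m) \<le> B * \<bar>b - ?m\<bar>\<^sup>2" if "b \<in> {0..T}" for b
    by (rule taylor2[of "{0..T}" _ _ "xrr r" "xrrt r" "xrrtt r"])
      (use that mem x_rrt x_rrtt bounds in auto)
  define a1 where "a1 = x r (t + 2 * \<tau>) - x r ?m - \<tau> *\<^sub>R xt r ?m - (\<tau>\<^sup>2 / 2) *\<^sub>R xtt r ?m"
  define a2 where "a2 = x r t - x r ?m - (- \<tau>) *\<^sub>R xt r ?m - (\<tau>\<^sup>2 / 2) *\<^sub>R xtt r ?m"
  define b1 where "b1 = xrr r (t + 2 * \<tau>) - xrr r ?m - \<tau> *\<^sub>R xrrt r ?m"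
  define b2 where "b2 = xrr r t - xrr r ?m - (- \<tau>) *\<^sub>R xrrt r ?m"
  have a: "norm a1 \<le> B * \<tau>^3" "norm a2 \<le> B * \<tau>^3"
    using T3[OF mem(3)] T3[OF mem(1)] \<tau> unfolding a1_def a2_def by simp_all
  have b: "norm b1 \<le> B * \<tau>\<^sup>2" "norm b2 \<le> B * \<tau>\<^sup>2"
    using T2[OF mem(3)] T2[OF mem(1)] \<tau> unfolding b1_def b2_def by simp_all
  define q where "q = (x r (t + 2 * \<tau>) - x r t) /\<^sub>R (2 * \<tau>) - xt r ?m"
  have "x r (t + 2 * \<tau>) - x r t = a1 - a2 + (2 * \<tau>) *\<^sub>R xt r ?m"
    unfolding a1_def a2_def by (simp add: scaleR_left_distrib[of \<tau> \<tau>, symmetric] algebra_simps)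
  then have "q = (a1 - a2) /\<^sub>R (2 * \<tau>)"
    using \<tau> by (simp add: q_def scaleR_add_right)
  moreover have "norm (a1 - a2) \<le> (B * \<tau>\<^sup>2) * (2 * \<tau>)"
    using norm_triangle_ineq4[of a1 a2] a by (simp add: eval_nat_numeral mult_ac)
  ultimately have q: "norm q \<le> B * \<tau>\<^sup>2"
    using \<tau> by (simp add: pos_divide_le_eq divide_inverse_commute[symmetric])
  then show "norm (xt r ?m - (x r (t + 2 * \<tau>) - x r t) /\<^sub>R (2 * \<tau>)) \<le> B * \<tau>\<^sup>2"
    by (simp add: q_def norm_minus_commute)
  have "xrr r (t + 2 * \<tau>) + xrr r t = b1 + b2 + 2 *\<^sub>R xrr r ?m"
    by (simp add: b1_def b2_def scaleR_2)
  then have "(1/2) *\<^sub>R (xrr r (t + 2 * \<tau>) + xrr r t) = xrr r ?m + (1/2) *\<^sub>R (b1 + b2)"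
    by (simp add: scaleR_add_right)
  moreover have "(x r (t + 2 * \<tau>) - x r t) /\<^sub>R (2 * \<tau>) = xt r ?m + q" by (simp add: q_def)
  ultimately have "?n *\<^sub>R ((x r (t + 2 * \<tau>) - x r t) /\<^sub>R (2 * \<tau>)) - (1/2) *\<^sub>R (xrr r (t + 2 * \<tau>) + xrr r t)
      = ?n *\<^sub>R q - (1/2) *\<^sub>R (b1 + b2)"
    using pde[OF mem(2), of r] by (simp add: scaleR_add_right)
  moreover have "norm ((1/2) *\<^sub>R (b1 + b2)) \<le> B^3 * \<tau>\<^sup>2"
    using norm_triangle_ineq[of b1 b2] b sq_le_cube[of "\<tau>\<^sup>2"] by simp
  moreover have "norm (?n *\<^sub>R q) \<le> B^3 * \<tau>\<^sup>2" by (rule scaled_rate_error[OF mem(2) q])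
  ultimately show "norm (?n *\<^sub>R ((x r (t + 2 * \<tau>) - x r t) /\<^sub>R (2 * \<tau>))
       - (1/2) *\<^sub>R (xrr r (t + 2 * \<tau>) + xrr r t)) \<le> 2 * B^3 * \<tau>\<^sup>2"
    using norm_triangle_ineq4[of "?n *\<^sub>R q" "(1/2) *\<^sub>R (b1 + b2)"] by simp
qed

lemma increment_bound:
  assumes "s \<in> {0..T}" "t \<in> {0..T}"
  shows "norm (x r t - x r s) \<le> B * \<bar>t - s\<bar>" "norm (xrr r t - xrr r s) \<le> B * \<bar>t - s\<bar>"
  by (rule taylor1[of "{0..T}" _ _ "x r" "xt r"], use assms x_t bounds in auto)
    (rule taylor1[of "{0..T}" _ _ "xrr r" "xrrt r"], use assms x_rrt bounds in auto)

end

locale csf_mesh = csf_solution x xr xrr xrrr xrrrr xt xtt xttt xrrt xrrtt z zr zrr T B c0 + fe_mesh J p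
  for x xr xrr xrrr xrrrr xt xtt xttt xrrt xrrtt z zr zrr :: "real \<Rightarrow> real \<Rightarrow> 'a::real_inner"
    and T B c0 :: real and J p +
  fixes K :: real
  assumes regular: "regular_mesh K J p" and size_le: "mesh_size J p \<le> 1"
begin

abbreviation xh :: "real \<Rightarrow> nat \<Rightarrow> 'a" where "xh t \<equiv> \<lambda>j. x (p j) t"

abbreviation zh :: "real \<Rightarrow> nat \<Rightarrow> 'a" where "zh t \<equiv> \<lambda>j. z (p j) t"

abbreviation hmax :: real where "hmax \<equiv> mesh_size J p"

lemma elem_le: "j \<in> {1..J} \<Longrightarrow> elem_size p j \<le> hmax"
  unfolding mesh_size_def by (intro Max_ge) auto

lemma hmax_pos: "0 < hmax"
  using elem_le[of 1] elem_size_pos[of 1] J_ge by simp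

lemma hmax_le: "j \<in> {1..J} \<Longrightarrow> hmax \<le> K * elem_size p j"
  using regular unfolding regular_mesh_def by blast

lemma K_ge: "1 \<le> K"
proof -
  have "1 * elem_size p 1 \<le> K * elem_size p 1" using hmax_le[of 1] elem_le[of 1] J_ge by simp
  then show ?thesis using elem_size_pos[of 1] J_ge by (simp only: mult_le_cancel_right) auto
qed

lemma nxt_diff:
  assumes "j \<in> {1..J}"
  shows "\<bar>elem_size p j - elem_size p (nxt j)\<bar> \<le> K * hmax\<^sup>2"
proof -
  have "\<bar>elem_size p (nxt j) - elem_size p (if nxt j = 1 then J else nxt j - 1)\<bar> \<le> K * hmax\<^sup>2"
    using regular nxt_mem[OF assms] unfolding regular_mesh_def by blast
  moreover have "(if nxt j = 1 then J else nxt j - 1) = j" using assms by (auto simp: nxt_def)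
  ultimately show ?thesis by (simp add: abs_minus_commute)
qed

lemma dq_left:
  "j \<in> {1..J} \<Longrightarrow> dq (\<lambda>j. g (p j)) j = (g (p j) - g (p j - elem_size p j)) /\<^sub>R elem_size p j"
  by (simp add: dq_def elem_size_def)

text \<open>Periodicity moves the first element to the right of the node \<open>p J = 1\<close>.\<close>

lemma dq_right:
  assumes "j \<in> {1..J}" and per: "\<And>r. g (r + 1) = g r"
  shows "dq (\<lambda>j. g (p j)) (nxt j) = (g (p j + elem_size p (nxt j)) - g (p j)) /\<^sub>R elem_size p (nxt j)"
proof (cases "j = J")
  case True
  have "g (1 + p 1) = g (p 1)" "g 1 = g 0" using per[of "p 1"] per[of 0] by (simp_all add: add.commute)
  then show ?thesis using True by (simp add: dq_def nxt_def elem_size_def)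
next
  case False
  then show ?thesis by (simp add: dq_def nxt_def elem_size_def)
qed

text \<open>A residual of size \<open>\<epsilon>\<close> relative to the lumped mass at each node is of size \<open>\<epsilon>\<close> in the dual norm of the lumped
  \<open>L\<^sup>2\<close> norm, since the masses sum up to 1.\<close>

lemma nodal_residual_le:
  assumes "V 0 = V J" "v 0 = v J" "0 \<le> \<epsilon>"
    and R: "\<And>j. j \<in> {1..J} \<Longrightarrow> norm (((elem_size p j * w j + elem_size p (nxt j) * w (nxt j)) / 2) *\<^sub>R v j
       + (dq s j - dq s (nxt j))) \<le> \<epsilon> * mu j"
  shows "\<bar>wip w v V + stiff s V\<bar> \<le> \<epsilon> * nrm0 V"
proof -
  have "wip w v V + stiff s V = (\<Sum>j=1..J. (((elem_size p j * w j + elem_size p (nxt j) * w (nxt j)) / 2) *\<^sub>R v j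
       + (dq s j - dq s (nxt j))) \<bullet> V j)"
    unfolding wip_nodal[OF assms(2,1)] stiff_nodal[OF assms(1)] by (simp add: sum.distrib inner_add_left)
  then show ?thesis
    using sum_nodal_residual_le[OF assms(1,3) R] unfolding sum_elem by simp
qed

text \<open>The contributions to the nodal residuals add up to at most \<open>3 (K + 5) B\<^sup>3 + 2 (K + 1) B\<close>, which for
  \<open>B \<ge> 1\<close> is at most \<open>(5 K + 17) B\<^sup>3\<close>.\<close>

definition Cres :: real where "Cres = 17 * (K + 1) * B^3"

lemma second_difference_node:
  assumes "t \<in> {0..T}" "j \<in> {1..J}"
  shows "norm (dq (xh t) (nxt j) - dq (xh t) j - mu j *\<^sub>R xrr (p j) t)
    \<le> 2 * (K + 1) * B * hmax\<^sup>2 * mu j"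
  unfolding mu_def dq_left[OF assms(2), of "\<lambda>r. x r t"] dq_right[OF assms(2), of "\<lambda>r. x r t", OF x_periodic[OF assms(1)]]
  using assms nxt_mem[OF assms(2)]
  by (intro smooth_profile.second_difference[OF profile] elem_le elem_size_pos nxt_diff)

lemma coefficient_node:
  assumes "t \<in> {0..T}" "j \<in> {1..J}"
  shows "\<bar>(elem_size p j * (norm (dq (xh t) j))\<^sup>2
     + elem_size p (nxt j) * (norm (dq (xh t) (nxt j)))\<^sup>2) / 2 - mu j * (norm (xr (p j) t))\<^sup>2\<bar>
    \<le> (K + 5) * B\<^sup>2 * hmax\<^sup>2 * mu j"
  unfolding mu_def dq_left[OF assms(2), of "\<lambda>r. x r t"] dq_right[OF assms(2), of "\<lambda>r. x r t", OF x_periodic[OF assms(1)]]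
  using assms nxt_mem[OF assms(2)] size_le
  by (intro smooth_profile.lumped_coefficient[OF profile] elem_le elem_size_pos nxt_diff)

lemma dq_x_bound: "t \<in> {0..T} \<Longrightarrow> j \<in> {1..J} \<Longrightarrow> norm (dq (xh t) j) \<le> B"
  and dq_z_bound: "t \<in> {0..T} \<Longrightarrow> j \<in> {1..J} \<Longrightarrow> norm (dq (zh t) j) \<le> B"
proof -
  assume t: "t \<in> {0..T}" and j: "j \<in> {1..J}"
  have ne: "- elem_size p j \<noteq> 0" using elem_size_pos[OF j] by simp
  have eq: "dq (\<lambda>j. g (p j)) j = (g (p j + - elem_size p j) - g (p j)) /\<^sub>R (- elem_size p j)" for g :: "real \<Rightarrow> 'a"
    unfolding dq_left[OF j] by (simp add: scaleR_diff_right)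
  show "norm (dq (xh t) j) \<le> B"
    unfolding eq[of "\<lambda>r. x r t"]
    by (rule slope_bound[of "\<lambda>r. x r t" "\<lambda>r. xr r t"]) (use x_r[OF t] bounds[OF t] ne in auto)
  show "norm (dq (zh t) j) \<le> B"
    unfolding eq[of "\<lambda>r. z r t"]
    by (rule slope_bound[of "\<lambda>r. z r t" "\<lambda>r. zr r t"]) (use z_r[OF t] bounds[OF t] ne in auto)
qed

lemma second_difference_z:
  assumes t: "t \<in> {0..T}" and j: "j \<in> {1..J}"
  shows "norm (dq (zh t) (nxt j) - dq (zh t) j) \<le> 2 * B * mu j"
proof -
  let ?k = "elem_size p j" and ?l = "elem_size p (nxt j)"
  have k: "0 < ?k" and l: "0 < ?l" using elem_size_pos j nxt_mem by auto
  have slope: "norm ((z (p j + s) t - z (p j) t) /\<^sub>R s - zr (p j) t) \<le> B * \<bar>s\<bar>" if "s \<noteq> 0" for s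
    by (rule slope_first_order[of "\<lambda>r. z r t" "\<lambda>r. zr r t" "\<lambda>r. zrr r t"])
      (use z_r[OF t] z_rr[OF t] bounds[OF t] that in auto)
  have left: "dq (zh t) j = (z (p j + - ?k) t - z (p j) t) /\<^sub>R (- ?k)"
    unfolding dq_left[OF j, of "\<lambda>r. z r t"] by (simp add: scaleR_diff_right)
  have "norm (dq (zh t) (nxt j) - zr (p j) t) \<le> B * ?l"
    unfolding dq_right[OF j, of "\<lambda>r. z r t", OF z_periodic[OF t]] using slope[of ?l] l by simp
  moreover have "norm (dq (zh t) j - zr (p j) t) \<le> B * ?k"
    unfolding left using slope[of "- ?k"] k by simp
  ultimately have "norm (dq (zh t) (nxt j) - dq (zh t) j) \<le> B * ?l + B * ?k"
    using norm_triangle_ineq4[of "dq (zh t) (nxt j) - zr (p j) t" "dq (zh t) j - zr (p j) t"]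
    by simp
  then show ?thesis by (simp add: mu_def algebra_simps)
qed

lemma mu_nonneg: "j \<in> {1..J} \<Longrightarrow> 0 \<le> mu j" using mu_pos by (simp add: less_imp_le)

lemma Cres_bounds:
  "3 * (K + 5) * B^3 + 2 * (K + 1) * B \<le> Cres" "4 * B^3 \<le> Cres" "5 * B^3 \<le> Cres" "0 \<le> Cres"
proof -
  have B3: "B \<le> B^3" "0 < B^3" using sq_le_cube[of 1] B_ge by auto
  have "2 * (K + 1) * B \<le> 2 * (K + 1) * B^3" using B3 K_ge by (intro mult_left_mono) auto
  moreover have "0 \<le> K * B^3" using K_ge B3 by simp
  ultimately show "3 * (K + 5) * B^3 + 2 * (K + 1) * B \<le> Cres" "4 * B^3 \<le> Cres" "5 * B^3 \<le> Cres" "0 \<le> Cres"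
    using B3 unfolding Cres_def by (simp_all add: algebra_simps)
qed

text \<open>The function that the intermediate solution approximates to second order in time.\<close>

definition ymid :: "real \<Rightarrow> real \<Rightarrow> nat \<Rightarrow> 'a" where
  "ymid t \<tau> j = x (p j) (t + \<tau>) + (2 * \<tau>)\<^sup>2 *\<^sub>R z (p j) t"

lemma periodic_node: "t \<in> {0..T} \<Longrightarrow> x (p 0) t = x (p J) t" "t \<in> {0..T} \<Longrightarrow> z (p 0) t = z (p J) t"
  using x_periodic[of t 0] z_periodic[of t 0] by simp_all

lemma dq_ymid: "dq (ymid t \<tau>) j = dq (xh (t + \<tau>)) j + (2 * \<tau>)\<^sup>2 *\<^sub>R dq (zh t) j"
  unfolding ymid_def dq_add dq_scale by (rule refl)

lemma predictor_rate_bound: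
  assumes t: "0 \<le> t" and \<tau>: "0 < \<tau>" "2 * \<tau> \<le> 1" and tT: "t + \<tau> \<le> T"
  shows "norm ((ymid t \<tau> j - x (p j) t) /\<^sub>R \<tau>) \<le> 3 * B"
proof -
  have mem: "t \<in> {0..T}" "t + \<tau> \<in> {0..T}" using t \<tau> tT by auto
  have "norm (ymid t \<tau> j - x (p j) t) \<le> norm (x (p j) (t + \<tau>) - x (p j) t) + norm ((2 * \<tau>)\<^sup>2 *\<^sub>R z (p j) t)"
  proof -
    have "ymid t \<tau> j - x (p j) t = (x (p j) (t + \<tau>) - x (p j) t) + (2 * \<tau>)\<^sup>2 *\<^sub>R z (p j) t"
      by (simp add: ymid_def)
    then show ?thesis by (simp only: norm_triangle_ineq)
  qed
  moreover have "norm (x (p j) (t + \<tau>) - x (p j) t) \<le> B * \<tau>"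
    using increment_bound(1)[OF mem, of "p j"] \<tau> by simp
  moreover have "norm ((2 * \<tau>)\<^sup>2 *\<^sub>R z (p j) t) \<le> (2 * \<tau>) * B"
  proof -
    have "(2 * \<tau>)\<^sup>2 \<le> 2 * \<tau>" using \<tau> mult_left_mono[of "2 * \<tau>" 1 "2 * \<tau>"] by (simp add: power2_eq_square)
    then have "(2 * \<tau>)\<^sup>2 * norm (z (p j) t) \<le> (2 * \<tau>) * B"
      using bounds[OF mem(1), of "p j"] \<tau> by (intro mult_mono) auto
    then show ?thesis by simp
  qed
  ultimately have "norm (ymid t \<tau> j - x (p j) t) \<le> (3 * B) * \<tau>" by (simp add: algebra_simps)
  then show ?thesis using \<tau> by (simp add: pos_divide_le_eq divide_inverse_commute[symmetric])
qed

text \<open>Per node, the residual is the error of the coefficient (\<open>r1\<close>), the truncation error in time (\<open>r2\<close>), the error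
  of the second difference (\<open>r3\<close>) and the second difference of the correction (\<open>r4\<close>), all relative to the lumped
  mass.\<close>

lemma predictor_residual:
  assumes t: "0 \<le> t" and \<tau>: "0 < \<tau>" "2 * \<tau> \<le> 1" and tT: "t + \<tau> \<le> T" and V: "V 0 = V J"
  shows "\<bar>wip (speed2 (xh t)) (\<lambda>j. (ymid t \<tau> j - x (p j) t) /\<^sub>R \<tau>) V
     + stiff (ymid t \<tau>) V\<bar> \<le> Cres * (hmax\<^sup>2 + (2 * \<tau>)\<^sup>2) * nrm0 V"
proof (rule nodal_residual_le[OF V])
  have mem: "t \<in> {0..T}" "t + \<tau> \<in> {0..T}" using t \<tau> tT by auto
  show "(ymid t \<tau> 0 - x (p 0) t) /\<^sub>R \<tau> = (ymid t \<tau> J - x (p J) t) /\<^sub>R \<tau>"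
    unfolding ymid_def periodic_node[OF mem(1)] periodic_node[OF mem(2)] by (rule refl)
  show "0 \<le> Cres * (hmax\<^sup>2 + (2 * \<tau>)\<^sup>2)" using Cres_bounds by simp
  fix j assume j: "j \<in> {1..J}"
  let ?v = "(ymid t \<tau> j - x (p j) t) /\<^sub>R \<tau>" and ?n = "(norm (xr (p j) t))\<^sup>2"
  define m where "m = (elem_size p j * (norm (dq (xh t) j))\<^sup>2
     + elem_size p (nxt j) * (norm (dq (xh t) (nxt j)))\<^sup>2) / 2"
  define r1 where "r1 = (m - mu j * ?n) *\<^sub>R ?v"
  define r2 where "r2 = mu j *\<^sub>R (?n *\<^sub>R ?v - xrr (p j) (t + \<tau>))"
  define r3 where "r3 = dq (xh (t + \<tau>)) (nxt j) - dq (xh (t + \<tau>)) j - mu j *\<^sub>R xrr (p j) (t + \<tau>)"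
  define r4 where "r4 = (2 * \<tau>)\<^sup>2 *\<^sub>R (dq (zh t) (nxt j) - dq (zh t) j)"
  have mu: "0 \<le> mu j" by (rule mu_nonneg[OF j])
  have "norm r1 = \<bar>m - mu j * ?n\<bar> * norm ?v" unfolding r1_def by (rule norm_scaleR)
  also have "\<dots> \<le> ((K + 5) * B\<^sup>2 * hmax\<^sup>2 * mu j) * (3 * B)"
    unfolding m_def
    by (intro mult_mono coefficient_node[OF mem(1) j] predictor_rate_bound[OF t \<tau> tT])
      (use mu K_ge in auto)
  also have "\<dots> = 3 * (K + 5) * B^3 * (hmax\<^sup>2 * mu j)" by (simp add: eval_nat_numeral)
  finally have r1: "norm r1 \<le> 3 * (K + 5) * B^3 * (hmax\<^sup>2 * mu j)" .
  have "norm r2 = \<bar>mu j\<bar> * norm (?n *\<^sub>R ?v - xrr (p j) (t + \<tau>))" unfolding r2_def by (rule norm_scaleR)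
  also have "\<dots> \<le> mu j * (2 * B^3 * \<tau>\<^sup>2)"
    using mult_left_mono[OF predictor_truncation[OF t \<tau>(1) tT, of "p j"] mu] mu unfolding ymid_def
    by (simp only: abs_of_nonneg)
  also have "\<dots> = 1/2 * B^3 * ((2 * \<tau>)\<^sup>2 * mu j)" by (simp add: power_mult_distrib)
  finally have r2: "norm r2 \<le> 1/2 * B^3 * ((2 * \<tau>)\<^sup>2 * mu j)" .
  have r3: "norm r3 \<le> 2 * (K + 1) * B * (hmax\<^sup>2 * mu j)"
    using second_difference_node[OF mem(2) j] by (simp add: r3_def mult.assoc)
  have "norm r4 \<le> (2 * \<tau>)\<^sup>2 * (2 * B * mu j)"
    using mult_left_mono[OF second_difference_z[OF mem(1) j], of "(2 * \<tau>)\<^sup>2"]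
    by (simp add: r4_def del: power_mult_distrib)
  also have "\<dots> = 2 * (B * ((2 * \<tau>)\<^sup>2 * mu j))" by (simp only: mult_ac)
  finally have "norm r4 \<le> 2 * (B * ((2 * \<tau>)\<^sup>2 * mu j))" .
  moreover have "0 \<le> (2 * \<tau>)\<^sup>2 * mu j" using mu by simp
  ultimately have r4: "norm r4 \<le> 2 * B^3 * ((2 * \<tau>)\<^sup>2 * mu j)"
    using sq_le_cube[of "(2 * \<tau>)\<^sup>2 * mu j"] by simp
  have nn: "0 \<le> hmax\<^sup>2 * mu j" "0 \<le> (2 * \<tau>)\<^sup>2 * mu j" using mu by auto
  have "m *\<^sub>R ?v + (dq (ymid t \<tau>) j - dq (ymid t \<tau>) (nxt j)) = r1 + r2 - (r3 + r4)"
  proof -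
    have "m *\<^sub>R v + ((a + c *\<^sub>R a') - (b + c *\<^sub>R b'))
      = (m - u * n) *\<^sub>R v + u *\<^sub>R (n *\<^sub>R v - X) - ((b - a - u *\<^sub>R X) + c *\<^sub>R (b' - a'))"
      for v a a' b b' X :: 'a and m u n c :: real
      by (simp add: scaleR_diff_left scaleR_diff_right)
    then show ?thesis unfolding r1_def r2_def r3_def r4_def dq_ymid .
  qed
  also have "norm \<dots> \<le> (norm r1 + norm r2) + (norm r3 + norm r4)"
    using norm_triangle_ineq4[of "r1 + r2" "r3 + r4"] norm_triangle_ineq[of r1 r2] norm_triangle_ineq[of r3 r4] by linarith
  also have "\<dots> \<le> (3 * (K + 5) * B^3 + 2 * (K + 1) * B) * (hmax\<^sup>2 * mu j) + (5/2 * B^3) * ((2 * \<tau>)\<^sup>2 * mu j)"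
  proof -
    have "n1 + n2 + (n3 + n4) \<le> (a + b) * H + (5/2 * c) * S"
      if "n1 \<le> a * H" "n2 \<le> 1/2 * c * S" "n3 \<le> b * H" "n4 \<le> 2 * c * S"
      for n1 n2 n3 n4 a b c H S :: real using that by (simp add: ring_distribs)
    then show ?thesis using r1 r2 r3 r4 .
  qed
  also have "\<dots> \<le> Cres * (hmax\<^sup>2 * mu j) + Cres * ((2 * \<tau>)\<^sup>2 * mu j)"
    using Cres_bounds B_ge nn by (intro add_mono mult_right_mono) auto
  also have "\<dots> = Cres * (hmax\<^sup>2 + (2 * \<tau>)\<^sup>2) * mu j" by (simp add: ring_distribs)
  finally show "norm (((elem_size p j * (norm (dq (xh t) j))\<^sup>2
      + elem_size p (nxt j) * (norm (dq (xh t) (nxt j)))\<^sup>2) / 2) *\<^sub>R ?v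
      + (dq (ymid t \<tau>) j - dq (ymid t \<tau>) (nxt j))) \<le> Cres * (hmax\<^sup>2 + (2 * \<tau>)\<^sup>2) * mu j"
    unfolding m_def .
qed

lemma dq_ymid_sq:
  assumes t: "0 \<le> t" and \<tau>: "0 < \<tau>" "2 * \<tau> \<le> 1" and tT: "t + \<tau> \<le> T" and j: "j \<in> {1..J}"
  shows "\<bar>(norm (dq (ymid t \<tau>) j))\<^sup>2 - (norm (dq (xh (t + \<tau>)) j))\<^sup>2\<bar> \<le> 3 * B\<^sup>2 * (2 * \<tau>)\<^sup>2"
    and "norm (dq (ymid t \<tau>) j) \<le> 2 * B"
    and "norm (dq (ymid t \<tau>) j - dq (xh (t + \<tau>)) j) \<le> B * (2 * \<tau>)\<^sup>2"
proof -
  have mem: "t \<in> {0..T}" "t + \<tau> \<in> {0..T}" using t \<tau> tT by auto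
  let ?a = "dq (xh (t + \<tau>)) j" and ?y = "dq (ymid t \<tau>) j"
  have le1: "(2 * \<tau>)\<^sup>2 \<le> 1" using \<tau> power_mono[of "2 * \<tau>" 1 2] by simp
  show d: "norm (?y - ?a) \<le> B * (2 * \<tau>)\<^sup>2"
    unfolding dq_ymid using mult_left_mono[OF dq_z_bound[OF mem(1) j], of "(2 * \<tau>)\<^sup>2"]
    by (simp add: mult.commute)
  have "B * (2 * \<tau>)\<^sup>2 \<le> B * 1" using le1 B_ge by (intro mult_left_mono) auto
  then have y: "norm ?y \<le> 2 * B"
    using d dq_x_bound[OF mem(2) j] norm_triangle_sub[of ?y ?a] by simp
  show "norm ?y \<le> 2 * B" by (rule y)
  have "\<bar>norm ?y - norm ?a\<bar> * (norm ?y + norm ?a) \<le> (B * (2 * \<tau>)\<^sup>2) * (3 * B)"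
    using order_trans[OF norm_triangle_ineq3 d] y dq_x_bound[OF mem(2) j] B_ge
    by (intro mult_mono) auto
  moreover have "\<bar>(norm ?y)\<^sup>2 - (norm ?a)\<^sup>2\<bar> = \<bar>norm ?y - norm ?a\<bar> * (norm ?y + norm ?a)"
  proof -
    have "(norm ?y)\<^sup>2 - (norm ?a)\<^sup>2 = (norm ?y - norm ?a) * (norm ?y + norm ?a)"
      by (simp add: power2_eq_square algebra_simps)
    then show ?thesis by (simp add: abs_mult)
  qed
  ultimately show "\<bar>(norm ?y)\<^sup>2 - (norm ?a)\<^sup>2\<bar> \<le> 3 * B\<^sup>2 * (2 * \<tau>)\<^sup>2"
    by (simp add: power2_eq_square mult_ac)
qed

lemma corrector_rate_bound:
  assumes t: "0 \<le> t" and \<tau>: "0 < \<tau>" and tT: "t + 2 * \<tau> \<le> T"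
  shows "norm ((x r (t + 2 * \<tau>) - x r t) /\<^sub>R (2 * \<tau>)) \<le> B"
proof -
  have 1: "norm (x r (t + 2 * \<tau>) - x r t) \<le> B * (2 * \<tau>)"
    using increment_bound(1)[of t "t + 2 * \<tau>" r] t \<tau> tT by simp
  show ?thesis by (rule norm_quotient_le) (use 1 \<tau> in simp_all)
qed

text \<open>As for the predictor, with one more term \<open>r0\<close>: the coefficient is evaluated at the corrected intermediate
  function instead of the exact one.\<close>

lemma corrector_residual:
  assumes t: "0 \<le> t" and \<tau>: "0 < \<tau>" "2 * \<tau> \<le> 1" and tT: "t + 2 * \<tau> \<le> T" and V: "V 0 = V J"
  shows "\<bar>wip (speed2 (ymid t \<tau>)) (\<lambda>j. (x (p j) (t + 2 * \<tau>) - x (p j) t) /\<^sub>R (2 * \<tau>)) V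
     + stiff (\<lambda>j. (1/2) *\<^sub>R (x (p j) (t + 2 * \<tau>) + x (p j) t)) V\<bar> \<le> Cres * (hmax\<^sup>2 + (2 * \<tau>)\<^sup>2) * nrm0 V"
proof (rule nodal_residual_le[OF V])
  have mem: "t \<in> {0..T}" "t + \<tau> \<in> {0..T}" "t + 2 * \<tau> \<in> {0..T}" using t \<tau> tT by auto
  have tT': "t + \<tau> \<le> T" using \<tau> tT by simp
  show "(x (p 0) (t + 2 * \<tau>) - x (p 0) t) /\<^sub>R (2 * \<tau>) = (x (p J) (t + 2 * \<tau>) - x (p J) t) /\<^sub>R (2 * \<tau>)"
    unfolding periodic_node[OF mem(1)] periodic_node[OF mem(3)] by (rule refl)
  show "0 \<le> Cres * (hmax\<^sup>2 + (2 * \<tau>)\<^sup>2)" using Cres_bounds by simp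
  fix j assume j: "j \<in> {1..J}"
  let ?v = "(x (p j) (t + 2 * \<tau>) - x (p j) t) /\<^sub>R (2 * \<tau>)" and ?n = "(norm (xr (p j) (t + \<tau>)))\<^sup>2"
  let ?k = "elem_size p j" and ?l = "elem_size p (nxt j)"
  let ?D = "\<lambda>s j. dq (xh s) j"
  define m' where "m' = (?k * (norm (dq (ymid t \<tau>) j))\<^sup>2 + ?l * (norm (dq (ymid t \<tau>) (nxt j)))\<^sup>2) / 2"
  define m where "m = (?k * (norm (?D (t + \<tau>) j))\<^sup>2 + ?l * (norm (?D (t + \<tau>) (nxt j)))\<^sup>2) / 2"
  define r0 where "r0 = (m' - m) *\<^sub>R ?v"
  define r1 where "r1 = (m - mu j * ?n) *\<^sub>R ?v"
  define r2 where "r2 = mu j *\<^sub>R (?n *\<^sub>R ?v - (1/2) *\<^sub>R (xrr (p j) (t + 2 * \<tau>) + xrr (p j) t))"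
  define r3 where "r3 = (1/2) *\<^sub>R (?D (t + 2 * \<tau>) (nxt j) - ?D (t + 2 * \<tau>) j - mu j *\<^sub>R xrr (p j) (t + 2 * \<tau>))"
  define r4 where "r4 = (1/2) *\<^sub>R (?D t (nxt j) - ?D t j - mu j *\<^sub>R xrr (p j) t)"
  have mu: "0 \<le> mu j" by (rule mu_nonneg[OF j])
  have kl: "0 < ?k" "0 < ?l" using elem_size_pos j nxt_mem by auto
  have "\<bar>m' - m\<bar> \<le> 3 * B\<^sup>2 * (2 * \<tau>)\<^sup>2 * mu j"
  proof -
    define a where "a = (norm (dq (ymid t \<tau>) j))\<^sup>2 - (norm (?D (t + \<tau>) j))\<^sup>2"
    define b where "b = (norm (dq (ymid t \<tau>) (nxt j)))\<^sup>2 - (norm (?D (t + \<tau>) (nxt j)))\<^sup>2"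
    have ab: "\<bar>a\<bar> \<le> 3 * B\<^sup>2 * (2 * \<tau>)\<^sup>2" "\<bar>b\<bar> \<le> 3 * B\<^sup>2 * (2 * \<tau>)\<^sup>2"
      unfolding a_def b_def using dq_ymid_sq(1)[OF t \<tau> tT'] j nxt_mem[OF j] by blast+
    have eq: "m' - m = (?k * a + ?l * b) / 2"
      unfolding m'_def m_def a_def b_def by (simp add: algebra_simps add_divide_distrib diff_divide_distrib)
    have "\<bar>?k * a + ?l * b\<bar> \<le> ?k * (3 * B\<^sup>2 * (2 * \<tau>)\<^sup>2) + ?l * (3 * B\<^sup>2 * (2 * \<tau>)\<^sup>2)"
      using ab kl by (intro order_trans[OF abs_triangle_ineq] add_mono) (simp_all add: abs_mult)
    then have "\<bar>?k * a + ?l * b\<bar> / 2 \<le> (?k * (3 * B\<^sup>2 * (2 * \<tau>)\<^sup>2) + ?l * (3 * B\<^sup>2 * (2 * \<tau>)\<^sup>2)) / 2"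
      by (rule divide_right_mono) simp
    also have "\<dots> = 3 * B\<^sup>2 * (2 * \<tau>)\<^sup>2 * mu j"
    proof -
      have "(k * c + l * c) / 2 = c * ((k + l) / 2)" for k l c :: real by (simp add: algebra_simps)
      then show ?thesis unfolding mu_def .
    qed
    finally show ?thesis unfolding eq by simp
  qed
  note m'm = this
  have "norm r0 = \<bar>m' - m\<bar> * norm ?v" unfolding r0_def by (rule norm_scaleR)
  also have "\<dots> \<le> (3 * B\<^sup>2 * (2 * \<tau>)\<^sup>2 * mu j) * B"
    by (intro mult_mono m'm corrector_rate_bound[OF t \<tau>(1) tT]) (use mu in auto)
  also have "\<dots> = 3 * B^3 * ((2 * \<tau>)\<^sup>2 * mu j)" by (simp add: eval_nat_numeral)
  finally have r0: "norm r0 \<le> 3 * B^3 * ((2 * \<tau>)\<^sup>2 * mu j)" .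
  have "norm r1 = \<bar>m - mu j * ?n\<bar> * norm ?v" unfolding r1_def by (rule norm_scaleR)
  also have "\<dots> \<le> ((K + 5) * B\<^sup>2 * hmax\<^sup>2 * mu j) * B"
    unfolding m_def
    by (intro mult_mono coefficient_node[OF mem(2) j] corrector_rate_bound[OF t \<tau>(1) tT])
      (use mu K_ge in auto)
  also have "\<dots> = (K + 5) * B^3 * (hmax\<^sup>2 * mu j)" by (simp add: eval_nat_numeral)
  finally have r1: "norm r1 \<le> (K + 5) * B^3 * (hmax\<^sup>2 * mu j)" .
  have "norm r2 = \<bar>mu j\<bar> * norm (?n *\<^sub>R ?v - (1/2) *\<^sub>R (xrr (p j) (t + 2 * \<tau>) + xrr (p j) t))"
    unfolding r2_def by (rule norm_scaleR)
  also have "\<dots> \<le> mu j * (2 * B^3 * \<tau>\<^sup>2)"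
    using mult_left_mono[OF corrector_truncation(2)[OF t \<tau>(1) tT, of "p j"] mu] mu
    by (simp only: abs_of_nonneg)
  also have "\<dots> = 1/2 * B^3 * ((2 * \<tau>)\<^sup>2 * mu j)" by (simp add: power_mult_distrib)
  finally have r2: "norm r2 \<le> 1/2 * B^3 * ((2 * \<tau>)\<^sup>2 * mu j)" .
  have half: "norm ((1/2) *\<^sub>R w) \<le> (K + 1) * B * (hmax\<^sup>2 * mu j)"
    if "norm w \<le> 2 * (K + 1) * B * hmax\<^sup>2 * mu j" for w :: 'a
    using that by (simp add: algebra_simps)
  have r3: "norm r3 \<le> (K + 1) * B * (hmax\<^sup>2 * mu j)"
    unfolding r3_def by (rule half[OF second_difference_node[OF mem(3) j]])
  have r4: "norm r4 \<le> (K + 1) * B * (hmax\<^sup>2 * mu j)"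
    unfolding r4_def by (rule half[OF second_difference_node[OF mem(1) j]])
  have nn: "0 \<le> hmax\<^sup>2 * mu j" "0 \<le> (2 * \<tau>)\<^sup>2 * mu j" using mu by auto
  let ?s = "\<lambda>j. (1/2) *\<^sub>R (x (p j) (t + 2 * \<tau>) + x (p j) t)"
  have ds: "dq ?s j = (1/2) *\<^sub>R (?D (t + 2 * \<tau>) j + ?D t j)" for j
    unfolding dq_scale dq_add by (rule refl)
  have "m' *\<^sub>R ?v + (dq ?s j - dq ?s (nxt j)) = r0 + (r1 + r2) - (r3 + r4)"
  proof -
    have "m' *\<^sub>R v + ((1/2) *\<^sub>R (a + b) - (1/2) *\<^sub>R (a' + b'))
      = (m' - m) *\<^sub>R v + ((m - u * n) *\<^sub>R v + u *\<^sub>R (n *\<^sub>R v - (1/2) *\<^sub>R (X + Y)))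
        - ((1/2) *\<^sub>R (a' - a - u *\<^sub>R X) + (1/2) *\<^sub>R (b' - b - u *\<^sub>R Y))"
      for v a a' b b' X Y :: 'a and m' m u n :: real
      by (simp add: scaleR_diff_left scaleR_diff_right scaleR_add_right)
    then show ?thesis unfolding r0_def r1_def r2_def r3_def r4_def ds .
  qed
  also have "norm \<dots> \<le> norm r0 + (norm r1 + norm r2) + (norm r3 + norm r4)"
    using norm_triangle_ineq4[of "r0 + (r1 + r2)" "r3 + r4"] norm_triangle_ineq[of r0 "r1 + r2"]
      norm_triangle_ineq[of r1 r2] norm_triangle_ineq[of r3 r4] by linarith
  also have "\<dots> \<le> ((K + 5) * B^3 + 2 * (K + 1) * B) * (hmax\<^sup>2 * mu j) + (7/2 * B^3) * ((2 * \<tau>)\<^sup>2 * mu j)"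
  proof -
    have "n0 + (n1 + n2) + (n3 + n4) \<le> (a + 2 * b * d) * H + (7/2 * c) * S"
      if "n0 \<le> 3 * c * S" "n1 \<le> a * H" "n2 \<le> 1/2 * c * S" "n3 \<le> b * d * H" "n4 \<le> b * d * H"
      for n0 n1 n2 n3 n4 a b c d H S :: real using that by (simp add: ring_distribs)
    then show ?thesis using r0 r1 r2 r3 r4 .
  qed
  also have "\<dots> \<le> Cres * (hmax\<^sup>2 * mu j) + Cres * ((2 * \<tau>)\<^sup>2 * mu j)"
  proof (intro add_mono mult_right_mono nn)
    have "(K + 5) * B^3 \<le> 3 * (K + 5) * B^3" using K_ge B_ge by (intro mult_right_mono) auto
    then show "(K + 5) * B^3 + 2 * (K + 1) * B \<le> Cres" using Cres_bounds(1) by linarith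
    have "0 \<le> B^3" using B_ge by simp
    then show "7/2 * B^3 \<le> Cres" using Cres_bounds(2) by linarith
  qed
  also have "\<dots> = Cres * (hmax\<^sup>2 + (2 * \<tau>)\<^sup>2) * mu j" by (simp add: ring_distribs)
  finally show "norm (((?k * (norm (dq (ymid t \<tau>) j))\<^sup>2 + ?l * (norm (dq (ymid t \<tau>) (nxt j)))\<^sup>2) / 2) *\<^sub>R ?v
      + (dq ?s j - dq ?s (nxt j))) \<le> Cres * (hmax\<^sup>2 + (2 * \<tau>)\<^sup>2) * mu j"
    unfolding m'_def .
qed

end

section \<open>The nodal error estimate\<close>

context csf_solution
begin

text \<open>\<open>beta\<close> is the factor in front of the seminorm in \<open>error_residual\<close> for rates bounded by \<open>3 B\<close> and difference
  quotients bounded by \<open>2 B\<close>, and \<open>omega\<close> is the lower bound for the discrete coefficients. \<open>growth\<close> is the rate in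
  the Gronwall argument, and \<open>amp\<close> the resulting bound for the errors of both stages relative to the residual.\<close>

definition beta :: real where "beta = 3 * B * (2 * (2 * B) + 1)"

definition omega :: real where "omega = (c0 / 4)\<^sup>2"

definition growth :: real where
  "growth = (2 / omega) * (1 + beta\<^sup>2) * (1 + beta\<^sup>2 / (2 * omega))"

definition amp :: real where
  "amp = sqrt ((1 + (1 + beta\<^sup>2) / (2 * omega)) * exp (growth * T))"

lemma omega_pos: "0 < omega" using c0_pos by (simp add: omega_def)

lemma growth_nonneg: "0 \<le> growth"
  unfolding growth_def using omega_pos by (intro mult_nonneg_nonneg add_nonneg_nonneg divide_nonneg_nonneg) auto

lemma amp_sq: "amp\<^sup>2 = (1 + (1 + beta\<^sup>2) / (2 * omega)) * exp (growth * T)"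
  unfolding amp_def using omega_pos by simp

lemma amp_nonneg: "0 \<le> amp" unfolding amp_def using omega_pos by simp

end

lemma sq_sum_le:
  fixes a b :: real
  shows "(a + b)\<^sup>2 \<le> 2 * a\<^sup>2 + 2 * b\<^sup>2"
  using zero_le_power2[of "a - b"] by (simp add: power2_eq_square algebra_simps)

context grid
begin

definition predicts :: "real \<Rightarrow> (nat \<Rightarrow> 'a::real_inner) \<Rightarrow> (nat \<Rightarrow> 'a) \<Rightarrow> bool" where
  "predicts \<tau> X Y \<longleftrightarrow> (\<forall>V. V 0 = V J \<longrightarrow>
     wip (speed2 X) (\<lambda>j. (Y j - X j) /\<^sub>R \<tau>) V + stiff Y V = 0)"

definition corrects :: "real \<Rightarrow> (nat \<Rightarrow> 'a::real_inner) \<Rightarrow> (nat \<Rightarrow> 'a) \<Rightarrow> (nat \<Rightarrow> 'a) \<Rightarrow> bool" where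
  "corrects \<tau> X Y X' \<longleftrightarrow> (\<forall>V. V 0 = V J \<longrightarrow>
     wip (speed2 Y) (\<lambda>j. (X' j - X j) /\<^sub>R (2 * \<tau>)) V
       + stiff (\<lambda>j. (1/2) *\<^sub>R (X' j + X j)) V = 0)"

lemma predicts_exists:
  fixes X :: "nat \<Rightarrow> 'a::{real_inner,banach}"
  assumes "\<And>j. j \<in> {1..J} \<Longrightarrow> 0 < (norm (dq X j))\<^sup>2" "0 < \<tau>" "X 0 = X J"
  shows "\<exists>Y. Y 0 = Y J \<and> predicts \<tau> X Y"
  unfolding predicts_def by (rule linear_step_exists[OF assms])

lemma predicts_unique:
  assumes "\<And>j. j \<in> {1..J} \<Longrightarrow> 0 < (norm (dq X j))\<^sup>2" "0 < \<tau>" "Y 0 = Y J" "Y' 0 = Y' J"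
    and "predicts \<tau> X Y" "predicts \<tau> X Y'" "j \<le> J"
  shows "Y j = Y' j"
  by (rule linear_step_unique[where w = "\<lambda>j. (norm (dq X j))\<^sup>2" and F = X, OF assms(1-4) _ _ assms(7)])
    (use assms(5,6) in \<open>simp_all add: predicts_def\<close>)

text \<open>For the unknown \<open>X' + X\<close> the corrector is an equation of the same type as the predictor, with half the
  time step and right-hand side \<open>2 X\<close>.\<close>

lemma corrects_iff:
  "corrects \<tau> X Y X' \<longleftrightarrow> (\<forall>V. V 0 = V J \<longrightarrow>
     wip (speed2 Y) (\<lambda>j. ((X' j + X j) - 2 *\<^sub>R X j) /\<^sub>R \<tau>) V
       + stiff (\<lambda>j. X' j + X j) V = 0)"
proof -
  have "(\<lambda>j. ((X' j + X j) - 2 *\<^sub>R X j) /\<^sub>R \<tau>) = (\<lambda>j. 2 *\<^sub>R ((X' j - X j) /\<^sub>R (2 * \<tau>)))"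
    by (rule ext) (simp add: scaleR_2)
  then have 1: "wip w (\<lambda>j. ((X' j + X j) - 2 *\<^sub>R X j) /\<^sub>R \<tau>) V
      = 2 * wip w (\<lambda>j. (X' j - X j) /\<^sub>R (2 * \<tau>)) V" for w V
    by (simp only: wip_scale[of w 2 "\<lambda>j. (X' j - X j) /\<^sub>R (2 * \<tau>)" V])
  have 2: "a + 1/2 * b = 0 \<longleftrightarrow> 2 * a + b = 0" for a b :: real by auto
  show ?thesis unfolding corrects_def stiff_scale 1 2 by (rule refl)
qed

lemma corrects_exists:
  fixes X :: "nat \<Rightarrow> 'a::{real_inner,banach}"
  assumes "\<And>j. j \<in> {1..J} \<Longrightarrow> 0 < (norm (dq Y j))\<^sup>2" "0 < \<tau>" "X 0 = X J"
  shows "\<exists>X'. X' 0 = X' J \<and> corrects \<tau> X Y X'"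
proof -
  have F: "(\<lambda>j. 2 *\<^sub>R X j) 0 = (\<lambda>j. 2 *\<^sub>R X j) J" using assms(3) by simp
  obtain S where S: "S 0 = S J"
    and eq: "\<And>V. V 0 = V J \<Longrightarrow> wip (speed2 Y) (\<lambda>j. (S j - 2 *\<^sub>R X j) /\<^sub>R \<tau>) V + stiff S V = 0"
    using linear_step_exists[where w = "\<lambda>j. (norm (dq Y j))\<^sup>2", OF assms(1,2) F] by blast
  have "corrects \<tau> X Y (\<lambda>j. S j - X j)"
    unfolding corrects_iff by (simp add: eq)
  then show ?thesis using S assms(3) by (intro exI[of _ "\<lambda>j. S j - X j"]) simp
qed

lemma corrects_unique:
  assumes w: "\<And>j. j \<in> {1..J} \<Longrightarrow> 0 < (norm (dq Y j))\<^sup>2" "0 < \<tau>" and per: "X 0 = X J" "X' 0 = X' J" "X'' 0 = X'' J"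
    and "corrects \<tau> X Y X'" "corrects \<tau> X Y X''" "j \<le> J"
  shows "X' j = X'' j"
proof -
  have "X' j + X j = X'' j + X j"
    by (rule linear_step_unique[where w = "\<lambda>j. (norm (dq Y j))\<^sup>2" and F = "\<lambda>j. 2 *\<^sub>R X j"
          and U = "\<lambda>j. X' j + X j" and U' = "\<lambda>j. X'' j + X j", OF w _ _ _ _ \<open>j \<le> J\<close>])
      (use per assms(6,7)[unfolded corrects_iff] in simp_all)
  then show ?thesis by simp
qed

lemma nrm0_sq_sum_le:
  fixes U :: "nat \<Rightarrow> nat \<Rightarrow> 'a::real_inner"
  shows "(nrm0 (\<lambda>j. \<Sum>k<m. U k j))\<^sup>2 \<le> real m * (\<Sum>k<m. (nrm0 (U k))\<^sup>2)"
proof -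
  have sq: "(norm (\<Sum>k<m. U k j))\<^sup>2 \<le> real m * (\<Sum>k<m. (norm (U k j))\<^sup>2)" for j
  proof -
    have "(norm (\<Sum>k<m. U k j))\<^sup>2 \<le> (\<Sum>k<m. norm (U k j))\<^sup>2"
      by (intro power_mono norm_sum) auto
    also have "\<dots> \<le> (\<Sum>k<m. (norm (U k j))\<^sup>2) * real (card {..<m})"
      by (rule sum_squared_le_sum_of_squares)
    finally show ?thesis by (simp add: mult.commute)
  qed
  have "(nrm0 (\<lambda>j. \<Sum>k<m. U k j))\<^sup>2
     \<le> (\<Sum>j=1..J. h j * (real m * (\<Sum>k<m. (norm (U k j))\<^sup>2) + real m * (\<Sum>k<m. (norm (U k (j - 1)))\<^sup>2)) / 2)"
    unfolding nrm0_sq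
    by (intro sum_mono divide_right_mono mult_left_mono add_mono sq less_imp_le[OF h_pos]) auto
  also have "\<dots> = real m * (\<Sum>j=1..J. \<Sum>k<m. h j * ((norm (U k j))\<^sup>2 + (norm (U k (j - 1)))\<^sup>2) / 2)"
    by (simp add: sum_distrib_left sum_divide_distrib sum.distrib algebra_simps add_divide_distrib)
  also have "\<dots> = real m * (\<Sum>k<m. (nrm0 (U k))\<^sup>2)"
    unfolding nrm0_sq by (subst sum.swap) simp
  finally show ?thesis .
qed

end

text \<open>The smallness conditions keep the difference quotients of the discrete solutions away from 0; they are
  where the restriction of the time step enters.\<close>

locale csf_scheme = csf_mesh x xr xrr xrrr xrrrr xt xtt xttt xrrt xrrtt z zr zrr T B c0 J p K
  for x xr xrr xrrr xrrrr xt xtt xttt xrrt xrrtt z zr zrr :: "real \<Rightarrow> real \<Rightarrow> 'a::real_inner"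
    and T B c0 :: real and J p and K :: real +
  fixes M :: nat and \<tau> :: real
  assumes M: "2 * \<tau> * real M = T" and \<tau>_pos: "0 < \<tau>" and \<tau>_le: "2 * \<tau> \<le> 1"
    and small_h: "B * hmax \<le> c0 / 4" and small_\<tau>: "B * (2 * \<tau>)\<^sup>2 \<le> c0 / 4"
    and small: "amp * (Cres * (hmax\<^sup>2 + (2 * \<tau>)\<^sup>2)) * sqrt K \<le> min 1 (c0 / 4) * sqrt hmax"
begin

definition eps :: real where "eps = Cres * (hmax\<^sup>2 + (2 * \<tau>)\<^sup>2)"

definition tm :: "nat \<Rightarrow> real" where "tm m = real m * (2 * \<tau>)"

lemma eps_nonneg: "0 \<le> eps" unfolding eps_def using Cres_bounds(4) by simp

lemma tm_mem: "m \<le> M \<Longrightarrow> tm m \<in> {0..T}" and tm_Suc: "tm (Suc m) = tm m + 2 * \<tau>"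
  and tm_mid: "m < M \<Longrightarrow> tm m + \<tau> \<le> T" and tm_end: "m < M \<Longrightarrow> tm m + 2 * \<tau> \<le> T" and tm_nonneg: "0 \<le> tm m"
proof -
  have le: "tm m \<le> T" if "m \<le> M" for m
    using M \<tau>_pos that unfolding tm_def by (metis mult.commute mult_left_mono of_nat_le_iff
        less_imp_le mult_pos_pos zero_less_numeral)
  show nn: "0 \<le> tm m" using \<tau>_pos by (simp add: tm_def)
  show "m \<le> M \<Longrightarrow> tm m \<in> {0..T}" using le nn by simp
  show s: "tm (Suc m) = tm m + 2 * \<tau>" by (simp add: tm_def algebra_simps)
  show e: "m < M \<Longrightarrow> tm m + 2 * \<tau> \<le> T" using le[of "Suc m"] s by simp
  then show "m < M \<Longrightarrow> tm m + \<tau> \<le> T" using \<tau>_pos by simp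
qed

text \<open>The inverse inequality loses \<open>h\<^sup>-\<^sup>1\<^sup>/\<^sup>2\<close>, which the last smallness condition compensates.\<close>

lemma dq_small:
  assumes "nrm1 e \<le> amp * eps" "j \<in> {1..J}"
  shows "norm (dq e j) \<le> min 1 (c0 / 4)"
proof -
  have h: "0 < elem_size p j" "0 < hmax" using elem_size_pos[OF assms(2)] hmax_pos by auto
  have sq: "sqrt hmax \<le> sqrt K * sqrt (elem_size p j)"
    using hmax_le[OF assms(2)] by (simp add: real_sqrt_mult[symmetric])
  have a: "0 \<le> amp * eps" using amp_nonneg eps_nonneg by simp
  have "(amp * eps) * sqrt hmax \<le> (amp * eps) * (sqrt K * sqrt (elem_size p j))"
    by (rule mult_left_mono[OF sq a])
  also have "\<dots> = (amp * eps * sqrt K) * sqrt (elem_size p j)" by simp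
  also have "\<dots> \<le> (min 1 (c0 / 4) * sqrt hmax) * sqrt (elem_size p j)"
    using small h unfolding eps_def by (intro mult_right_mono) auto
  finally have "(amp * eps) * sqrt hmax \<le> (min 1 (c0 / 4) * sqrt (elem_size p j)) * sqrt hmax"
    by (simp only: mult_ac)
  then have "amp * eps \<le> min 1 (c0 / 4) * sqrt (elem_size p j)"
    using h by (simp only: mult_le_cancel_right) auto
  then have "nrm1 e \<le> min 1 (c0 / 4) * sqrt (elem_size p j)" using assms(1) by simp
  then have "nrm1 e / sqrt (elem_size p j) \<le> min 1 (c0 / 4)"
    by (intro iffD2[OF pos_divide_le_eq]) (use h in auto)
  then show ?thesis by (rule order_trans[OF dq_le_nrm1[OF assms(2), of e]])
qed

lemma dq_x_lower:
  assumes t: "t \<in> {0..T}" and j: "j \<in> {1..J}"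
  shows "c0 - c0 / 4 \<le> norm (dq (xh t) j)"
proof -
  have k: "0 < elem_size p j" "elem_size p j \<le> hmax" using elem_size_pos[OF j] elem_le[OF j] by auto
  have eq: "dq (xh t) j = (x (p j + - elem_size p j) t - x (p j) t) /\<^sub>R (- elem_size p j)"
    unfolding dq_left[OF j, of "\<lambda>r. x r t"] by (simp add: scaleR_diff_right)
  have "norm (dq (xh t) j - xr (p j) t) \<le> B * \<bar>- elem_size p j\<bar>"
    unfolding eq by (rule slope_first_order[of "\<lambda>r. x r t" "\<lambda>r. xr r t" "\<lambda>r. xrr r t"])
      (use x_r[OF t] x_rr[OF t] bounds[OF t] k in auto)
  also have "\<dots> \<le> B * hmax" using k B_ge by simp
  finally show ?thesis
    using small_h xr_lower[OF t, of "p j"] norm_triangle_ineq2[of "xr (p j) t" "dq (xh t) j"]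
    by (simp add: norm_minus_commute)
qed

lemma dq_ymid_lower:
  assumes "m < M" and j: "j \<in> {1..J}"
  shows "c0 / 2 \<le> norm (dq (ymid (tm m) \<tau>) j)"
proof -
  have mem: "tm m + \<tau> \<in> {0..T}" using tm_mid[OF assms(1)] tm_nonneg[of m] \<tau>_pos by simp
  let ?a = "dq (xh (tm m + \<tau>)) j" and ?y = "dq (ymid (tm m) \<tau>) j"
  have "norm (?y - ?a) \<le> c0 / 4"
    using dq_ymid_sq(3)[OF tm_nonneg \<tau>_pos \<tau>_le tm_mid[OF assms(1)] j] small_\<tau> by linarith
  moreover have "c0 - c0 / 4 \<le> norm ?a" by (rule dq_x_lower[OF mem j])
  moreover have "norm ?a - norm ?y \<le> norm (?y - ?a)"
    using norm_triangle_ineq2[of ?a ?y] by (simp add: norm_minus_commute)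
  ultimately show ?thesis by argo
qed

lemma weight_lower:
  assumes "nrm1 (\<lambda>j. y j - Y j) \<le> amp * eps" "j \<in> {1..J}" "c0 / 2 \<le> norm (dq y j)"
  shows "omega \<le> (norm (dq Y j))\<^sup>2"
proof -
  have "norm (dq y j - dq Y j) \<le> c0 / 4"
    using dq_small[OF assms(1,2)] unfolding dq_diff by simp
  then have "c0 / 4 \<le> norm (dq Y j)"
    using assms(3) norm_triangle_ineq2[of "dq y j" "dq Y j"] by argo
  then show ?thesis unfolding omega_def using c0_pos by (intro power_mono) auto
qed

definition err :: "(nat \<Rightarrow> nat \<Rightarrow> 'a) \<Rightarrow> nat \<Rightarrow> nat \<Rightarrow> 'a" where
  "err X m = (\<lambda>j. x (p j) (tm m) - X m j)"

definition rate :: "(nat \<Rightarrow> nat \<Rightarrow> 'a) \<Rightarrow> nat \<Rightarrow> nat \<Rightarrow> 'a" where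
  "rate X m = (\<lambda>j. (x (p j) (tm m + 2 * \<tau>) - x (p j) (tm m)) /\<^sub>R (2 * \<tau>) - (X (Suc m) j - X m j) /\<^sub>R (2 * \<tau>))"

text \<open>The induction hypothesis of the continuation argument.\<close>

definition controlled :: "(nat \<Rightarrow> nat \<Rightarrow> 'a) \<Rightarrow> nat \<Rightarrow> bool" where
  "controlled X m \<longleftrightarrow> (nrm1 (err X m))\<^sup>2 \<le> exp (growth * T) * eps\<^sup>2"

lemma controlled_nrm1:
  assumes "controlled X m"
  shows "nrm1 (err X m) \<le> amp * eps"
proof (rule power2_le_imp_le)
  have "1 * exp (growth * T) \<le> (1 + (1 + beta\<^sup>2) / (2 * omega)) * exp (growth * T)"
    using omega_pos by (intro mult_right_mono) auto
  then have "exp (growth * T) * eps\<^sup>2 \<le> amp\<^sup>2 * eps\<^sup>2"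
    unfolding amp_sq by (intro mult_right_mono) auto
  then show "(nrm1 (err X m))\<^sup>2 \<le> (amp * eps)\<^sup>2"
    using assms unfolding controlled_def power_mult_distrib by linarith
  show "0 \<le> amp * eps" using amp_nonneg eps_nonneg by simp
qed

lemma controlled_weight:
  assumes "controlled X m" "m \<le> M" "j \<in> {1..J}"
  shows "omega \<le> (norm (dq (X m) j))\<^sup>2"
proof (rule weight_lower)
  show "nrm1 (\<lambda>j. x (p j) (tm m) - X m j) \<le> amp * eps"
    using controlled_nrm1[OF assms(1)] by (simp add: err_def)
  show "c0 / 2 \<le> norm (dq (xh (tm m)) j)"
    using dq_x_lower[OF tm_mem[OF assms(2)] assms(3)] c0_pos by argo
qed (rule assms)

lemma predictor_error:
  assumes c: "controlled X m" and m: "m < M" and per: "X m 0 = X m J" "Y 0 = Y J"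
    and Y: "predicts \<tau> (X m) Y"
  shows "(nrm1 (\<lambda>j. ymid (tm m) \<tau> j - Y j))\<^sup>2
       \<le> (nrm1 (err X m))\<^sup>2 + (1 / (2 * omega)) * (eps\<^sup>2 + beta\<^sup>2 * (nrm1 (err X m))\<^sup>2)"
proof -
  have tm: "tm m \<in> {0..T}" using tm_mem m by simp
  let ?e = "nrm1 (\<lambda>j. x (p j) (tm m) - X m j)"
  have small1: "norm (dq (\<lambda>j. x (p j) (tm m) - X m j) j) \<le> 1" if "j \<in> {1..J}" for j
    using dq_small[OF controlled_nrm1[OF c] that] by (simp add: err_def)
  have G: "norm (dq (xh (tm m)) j) \<le> 2 * B" if "j \<in> {1..J}" for j
    using dq_x_bound[OF tm that] B_ge by simp
  have pery: "ymid (tm m) \<tau> 0 = ymid (tm m) \<tau> J"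
    unfolding ymid_def using periodic_node[OF tm] periodic_node(1)[of "tm m + \<tau>"] tm_mid[OF m] tm_nonneg[of m] \<tau>_pos
    by simp
  have "(nrm1 (\<lambda>j. ymid (tm m) \<tau> j - Y j))\<^sup>2 \<le> ?e\<^sup>2
      + \<tau> / (2 * omega) * (eps + (3 * B) * (2 * (2 * B) + 1) * ?e)\<^sup>2"
  proof (rule predictor_stability)
    show "X m 0 = X m J" "Y 0 = Y J" by (fact per)+
    show "x (p 0) (tm m) = x (p J) (tm m)" by (rule periodic_node(1)[OF tm])
    show "ymid (tm m) \<tau> 0 = ymid (tm m) \<tau> J" by (fact pery)
    show "0 < \<tau>" "0 < omega" "0 \<le> 2 * B" using \<tau>_pos omega_pos B_ge by auto
    show "omega \<le> (norm (dq (X m) j))\<^sup>2" if "j \<in> {1..J}" for j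
      by (rule controlled_weight[OF c _ that]) (use m in simp)
    show "norm ((ymid (tm m) \<tau> j - x (p j) (tm m)) /\<^sub>R \<tau>) \<le> 3 * B" for j
      by (rule predictor_rate_bound[OF tm_nonneg \<tau>_pos \<tau>_le tm_mid[OF m]])
    show "\<bar>wip (speed2 (xh (tm m))) (\<lambda>j. (ymid (tm m) \<tau> j - x (p j) (tm m)) /\<^sub>R \<tau>) V
       + stiff (ymid (tm m) \<tau>) V\<bar> \<le> eps * nrm0 V" if "V 0 = V J" for V
      unfolding eps_def by (rule predictor_residual[OF tm_nonneg \<tau>_pos \<tau>_le tm_mid[OF m] that])
    show "wip (speed2 (X m)) (\<lambda>j. (Y j - X m j) /\<^sub>R \<tau>) V + stiff Y V = 0" if "V 0 = V J" for V
      using Y that unfolding predicts_def by blast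
  qed (fact small1 G)+
  also have "\<dots> = ?e\<^sup>2 + \<tau> / (2 * omega) * (eps + beta * ?e)\<^sup>2" by (simp only: beta_def)
  also have "\<dots> \<le> ?e\<^sup>2 + (1/2) / (2 * omega) * (2 * eps\<^sup>2 + 2 * (beta * ?e)\<^sup>2)"
    using \<tau>_le omega_pos by (intro add_left_mono mult_mono divide_right_mono sq_sum_le) auto
  also have "\<dots> = ?e\<^sup>2 + (1 / (2 * omega)) * (eps\<^sup>2 + beta\<^sup>2 * ?e\<^sup>2)"
  proof -
    have "(1/2) / (2 * w) * (2 * a + 2 * b) = (1 / (2 * w)) * (a + b)" for a b w :: real
      by (cases "w = 0") (simp_all add: field_simps)
    then show ?thesis unfolding power_mult_distrib by simp
  qed
  finally show ?thesis unfolding err_def .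
qed

lemma predictor_controlled:
  assumes c: "controlled X m" and m: "m < M" and per: "X m 0 = X m J" "Y 0 = Y J"
    and Y: "predicts \<tau> (X m) Y"
  shows "nrm1 (\<lambda>j. ymid (tm m) \<tau> j - Y j) \<le> amp * eps"
    and "\<And>j. j \<in> {1..J} \<Longrightarrow> omega \<le> (norm (dq Y j))\<^sup>2"
proof -
  let ?e = "(nrm1 (err X m))\<^sup>2" and ?X = "exp (growth * T)"
  have X1: "1 \<le> ?X" using growth_nonneg T_pos by simp
  have "eps\<^sup>2 + beta\<^sup>2 * ?e \<le> ?X * eps\<^sup>2 + beta\<^sup>2 * (?X * eps\<^sup>2)"
    using c X1 mult_right_mono[OF X1, of "eps\<^sup>2"] unfolding controlled_def
    by (intro add_mono mult_left_mono) auto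
  then have "(1 / (2 * omega)) * (eps\<^sup>2 + beta\<^sup>2 * ?e) \<le> (1 / (2 * omega)) * (?X * eps\<^sup>2 + beta\<^sup>2 * (?X * eps\<^sup>2))"
    using omega_pos by (intro mult_left_mono) auto
  then have "(nrm1 (\<lambda>j. ymid (tm m) \<tau> j - Y j))\<^sup>2
      \<le> ?X * eps\<^sup>2 + (1 / (2 * omega)) * (?X * eps\<^sup>2 + beta\<^sup>2 * (?X * eps\<^sup>2))"
    using predictor_error[OF assms] c unfolding controlled_def by linarith
  also have "\<dots> = (amp * eps)\<^sup>2"
    unfolding power_mult_distrib amp_sq by (simp add: ring_distribs add_divide_distrib)
  finally show *: "nrm1 (\<lambda>j. ymid (tm m) \<tau> j - Y j) \<le> amp * eps"
    by (rule power2_le_imp_le) (use amp_nonneg eps_nonneg in simp)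
  show "omega \<le> (norm (dq Y j))\<^sup>2" if "j \<in> {1..J}" for j
    by (rule weight_lower[OF * that dq_ymid_lower[OF m that]])
qed

lemma corrector_error:
  assumes c: "controlled X m" and m: "m < M" and per: "X m 0 = X m J" "Y 0 = Y J" "X (Suc m) 0 = X (Suc m) J"
    and Y: "predicts \<tau> (X m) Y" and X': "corrects \<tau> (X m) Y (X (Suc m))"
  shows "(nrm1 (err X (Suc m)))\<^sup>2 + omega * (2 * \<tau>) * (nrm0 (rate X m))\<^sup>2
       \<le> (nrm1 (err X m))\<^sup>2 + (2 * \<tau>) * growth * (eps\<^sup>2 + (nrm1 (err X m))\<^sup>2)"
proof -
  have tm: "tm m \<in> {0..T}" "tm m + 2 * \<tau> \<in> {0..T}"
    using tm_mem[of m] tm_mem[of "Suc m"] m unfolding tm_Suc by auto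
  let ?E = "nrm1 (\<lambda>j. ymid (tm m) \<tau> j - Y j)" and ?e = "(nrm1 (err X m))\<^sup>2"
  have "(nrm1 (\<lambda>j. x (p j) (tm m + 2 * \<tau>) - X (Suc m) j))\<^sup>2
      + omega * (2 * \<tau>) * (nrm0 (\<lambda>j. (x (p j) (tm m + 2 * \<tau>) - x (p j) (tm m)) /\<^sub>R (2 * \<tau>) - (X (Suc m) j - X m j) /\<^sub>R (2 * \<tau>)))\<^sup>2
    \<le> (nrm1 (\<lambda>j. x (p j) (tm m) - X m j))\<^sup>2
      + (2 * \<tau>) / omega * (eps + (3 * B) * (2 * (2 * B) + 1) * ?E)\<^sup>2"
  proof (rule corrector_stability)
    show "X m 0 = X m J" "X (Suc m) 0 = X (Suc m) J" by (fact per)+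
    show "x (p 0) (tm m) = x (p J) (tm m)" by (rule periodic_node(1)[OF tm(1)])
    show "x (p 0) (tm m + 2 * \<tau>) = x (p J) (tm m + 2 * \<tau>)" by (rule periodic_node(1)[OF tm(2)])
    show "0 < 2 * \<tau>" "0 < omega" "0 \<le> 2 * B" using \<tau>_pos omega_pos B_ge by auto
    show "norm (dq (ymid (tm m) \<tau>) j) \<le> 2 * B" if "j \<in> {1..J}" for j
      by (rule dq_ymid_sq(2)[OF tm_nonneg \<tau>_pos \<tau>_le tm_mid[OF m] that])
    show "norm (dq (\<lambda>j. ymid (tm m) \<tau> j - Y j) j) \<le> 1" if "j \<in> {1..J}" for j
      using dq_small[OF predictor_controlled(1)[OF c m per(1,2) Y] that] by simp
    show "omega \<le> (norm (dq Y j))\<^sup>2" if "j \<in> {1..J}" for j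
      by (rule predictor_controlled(2)[OF c m per(1,2) Y that])
    show "norm ((x (p j) (tm m + 2 * \<tau>) - x (p j) (tm m)) /\<^sub>R (2 * \<tau>)) \<le> 3 * B" for j
      by (rule order_trans[OF corrector_rate_bound[OF tm_nonneg \<tau>_pos tm_end[OF m]]]) (use B_ge in simp)
    show "\<bar>wip (speed2 (ymid (tm m) \<tau>)) (\<lambda>j. (x (p j) (tm m + 2 * \<tau>) - x (p j) (tm m)) /\<^sub>R (2 * \<tau>)) V
       + stiff (\<lambda>j. (1/2) *\<^sub>R (x (p j) (tm m + 2 * \<tau>) + x (p j) (tm m))) V\<bar> \<le> eps * nrm0 V" if "V 0 = V J" for V
      unfolding eps_def by (rule corrector_residual[OF tm_nonneg \<tau>_pos \<tau>_le tm_end[OF m] that])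
    show "wip (speed2 Y) (\<lambda>j. (X (Suc m) j - X m j) /\<^sub>R (2 * \<tau>)) V
       + stiff (\<lambda>j. (1/2) *\<^sub>R (X (Suc m) j + X m j)) V = 0" if "V 0 = V J" for V
      using X' that unfolding corrects_def by blast
  qed
  then have "(nrm1 (err X (Suc m)))\<^sup>2 + omega * (2 * \<tau>) * (nrm0 (rate X m))\<^sup>2
    \<le> ?e + (2 * \<tau>) / omega * (eps + beta * ?E)\<^sup>2"
    unfolding err_def rate_def tm_Suc beta_def .
  also have "\<dots> \<le> ?e + (2 * \<tau>) / omega * (2 * eps\<^sup>2 + 2 * (beta * ?E)\<^sup>2)"
    using \<tau>_pos omega_pos by (intro add_left_mono mult_left_mono sq_sum_le) auto
  also have "\<dots> \<le> ?e + (2 * \<tau>) / omega * (2 * (1 + beta\<^sup>2) * (1 + beta\<^sup>2 / (2 * omega)) * (eps\<^sup>2 + ?e))"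
  proof (intro add_left_mono mult_left_mono)
    have E: "?E\<^sup>2 \<le> ?e + (1 / (2 * omega)) * (eps\<^sup>2 + beta\<^sup>2 * ?e)"
      by (rule predictor_error[OF c m per(1,2) Y])
    \<comment> \<open>insert the bound for the predictor error into that of the corrector\<close>
    have alg: "2 * a + 2 * (b * F) \<le> 2 * (1 + b) * (1 + b / (2 * w)) * (a + e)"
      if "F \<le> e + (1 / (2 * w)) * (a + b * e)" "0 \<le> a" "0 \<le> b" "0 \<le> e" "0 < w" for a b e w F :: real
    proof -
      have "b * F \<le> b * (e + (1 / (2 * w)) * (a + b * e))" using that by (intro mult_left_mono) auto
      moreover have "(1 + b) * (1 + b / (2 * w)) * (a + e) - (a + b * (e + (1 / (2 * w)) * (a + b * e)))
        = e + a * b + (1 / (2 * w)) * (b * e + b * b * a)"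
        using that(5) by (simp add: field_simps)
      moreover have "0 \<le> e + a * b + (1 / (2 * w)) * (b * e + b * b * a)" using that by simp
      ultimately show ?thesis by argo
    qed
    show "2 * eps\<^sup>2 + 2 * (beta * ?E)\<^sup>2 \<le> 2 * (1 + beta\<^sup>2) * (1 + beta\<^sup>2 / (2 * omega)) * (eps\<^sup>2 + ?e)"
      unfolding power_mult_distrib by (rule alg[OF E]) (use omega_pos in simp_all)
  qed (use \<tau>_pos omega_pos in simp)
  also have "\<dots> = ?e + (2 * \<tau>) * growth * (eps\<^sup>2 + ?e)"
    by (simp add: growth_def)
  finally show ?thesis .
qed

definition nodal_run :: "nat \<Rightarrow> (nat \<Rightarrow> nat \<Rightarrow> 'a) \<Rightarrow> (nat \<Rightarrow> nat \<Rightarrow> 'a) \<Rightarrow> bool" where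
  "nodal_run n X Y \<longleftrightarrow> (\<forall>j\<le>J. X 0 j = x (p j) 0) \<and> (\<forall>m\<le>n. X m 0 = X m J) \<and>
     (\<forall>m<n. Y m 0 = Y m J \<and> predicts \<tau> (X m) (Y m) \<and> corrects \<tau> (X m) (Y m) (X (Suc m)))"

definition energy :: "(nat \<Rightarrow> nat \<Rightarrow> 'a) \<Rightarrow> nat \<Rightarrow> real" where
  "energy X m = (nrm1 (err X m))\<^sup>2 + omega * (\<Sum>k<m. (2 * \<tau>) * (nrm0 (rate X k))\<^sup>2)"

lemma err_0: "nodal_run n X Y \<Longrightarrow> j \<le> J \<Longrightarrow> err X 0 j = 0"
  by (simp add: nodal_run_def err_def tm_def)

text \<open>The Gronwall argument and the continuation argument in one induction: the bound for the energy at time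
  level \<open>n\<close> implies that the stability estimates apply to the next step.\<close>

lemma energy_growth:
  assumes "nodal_run n X Y" "n \<le> M"
  shows "energy X n + eps\<^sup>2 \<le> exp (growth * tm n) * eps\<^sup>2 \<and> controlled X n"
  using assms
proof (induction n)
  case 0
  have "dq (err X 0) j = 0" if "j \<in> {1..J}" for j
  proof -
    have "j \<le> J" "j - 1 \<le> J" using that by auto
    then show ?thesis using err_0[OF "0.prems"(1)] by (simp add: dq_def)
  qed
  then have "(nrm1 (err X 0))\<^sup>2 = 0" unfolding nrm1_sq by simp
  then show ?case by (simp add: energy_def controlled_def tm_def)
next
  case (Suc n)
  have run: "nodal_run n X Y" using Suc.prems(1) by (auto simp: nodal_run_def)
  then have IH: "energy X n + eps\<^sup>2 \<le> exp (growth * tm n) * eps\<^sup>2" "controlled X n"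
    using Suc.IH Suc.prems(2) by auto
  have S: "0 \<le> omega * (\<Sum>k<n. (2 * \<tau>) * (nrm0 (rate X k))\<^sup>2)"
    using omega_pos \<tau>_pos by (intro mult_nonneg_nonneg sum_nonneg) auto
  have step: "(nrm1 (err X (Suc n)))\<^sup>2 + omega * (2 * \<tau>) * (nrm0 (rate X n))\<^sup>2
       \<le> (nrm1 (err X n))\<^sup>2 + (2 * \<tau>) * growth * (eps\<^sup>2 + (nrm1 (err X n))\<^sup>2)"
    using Suc.prems by (intro corrector_error[where Y = "Y n"] IH) (auto simp: nodal_run_def)
  have "(2 * \<tau>) * growth * (eps\<^sup>2 + (nrm1 (err X n))\<^sup>2) \<le> (2 * \<tau>) * growth * (energy X n + eps\<^sup>2)"
    using S \<tau>_pos growth_nonneg by (intro mult_left_mono) (auto simp: energy_def)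
  moreover have "energy X (Suc n) = (nrm1 (err X (Suc n)))\<^sup>2 + omega * (2 * \<tau>) * (nrm0 (rate X n))\<^sup>2
      + omega * (\<Sum>k<n. (2 * \<tau>) * (nrm0 (rate X k))\<^sup>2)"
    by (simp add: energy_def ring_distribs)
  moreover have "energy X n = (nrm1 (err X n))\<^sup>2 + omega * (\<Sum>k<n. (2 * \<tau>) * (nrm0 (rate X k))\<^sup>2)"
    by (rule energy_def)
  ultimately have "energy X (Suc n) + eps\<^sup>2 \<le> (energy X n + eps\<^sup>2) + (2 * \<tau>) * growth * (energy X n + eps\<^sup>2)"
    using step by argo
  also have "\<dots> = (1 + growth * (2 * \<tau>)) * (energy X n + eps\<^sup>2)" by (simp add: algebra_simps)
  also have "\<dots> \<le> exp (growth * (2 * \<tau>)) * (exp (growth * tm n) * eps\<^sup>2)"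
    using exp_ge_add_one_self[of "growth * (2 * \<tau>)"] IH(1) S
    by (intro mult_mono) (auto simp: energy_def)
  also have "\<dots> = exp (growth * tm (Suc n)) * eps\<^sup>2"
    by (simp add: tm_Suc exp_add ring_distribs)
  finally have 1: "energy X (Suc n) + eps\<^sup>2 \<le> exp (growth * tm (Suc n)) * eps\<^sup>2" .
  have "0 \<le> omega * (\<Sum>k<Suc n. (2 * \<tau>) * (nrm0 (rate X k))\<^sup>2)"
    using omega_pos \<tau>_pos by (intro mult_nonneg_nonneg sum_nonneg) auto
  then have "(nrm1 (err X (Suc n)))\<^sup>2 \<le> exp (growth * tm (Suc n)) * eps\<^sup>2"
    using 1 zero_le_power2[of eps] unfolding energy_def by linarith
  also have "\<dots> \<le> exp (growth * T) * eps\<^sup>2"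
    using tm_mem[OF Suc.prems(2)] growth_nonneg by (intro mult_right_mono) (auto intro: mult_left_mono)
  finally show ?case using 1 by (simp add: controlled_def)
qed

lemma nodal_error_bounds:
  assumes run: "nodal_run n X Y" and n: "n \<le> M"
  shows "(nrm1 (err X n))\<^sup>2 \<le> exp (growth * T) * eps\<^sup>2"
    and "(\<Sum>k<n. (2 * \<tau>) * (nrm0 (rate X k))\<^sup>2) \<le> exp (growth * T) / omega * eps\<^sup>2"
    and "(nrm0 (err X n))\<^sup>2 \<le> T * (exp (growth * T) / omega * eps\<^sup>2)"
proof -
  have e: "energy X n + eps\<^sup>2 \<le> exp (growth * tm n) * eps\<^sup>2" "controlled X n"
    using energy_growth[OF run n] by auto
  show "(nrm1 (err X n))\<^sup>2 \<le> exp (growth * T) * eps\<^sup>2" using e(2) by (simp add: controlled_def)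
  have "exp (growth * tm n) * eps\<^sup>2 \<le> exp (growth * T) * eps\<^sup>2"
    using tm_mem[OF n] growth_nonneg by (intro mult_right_mono) (auto intro: mult_left_mono)
  then have "omega * (\<Sum>k<n. (2 * \<tau>) * (nrm0 (rate X k))\<^sup>2) \<le> exp (growth * T) * eps\<^sup>2"
    using e(1) zero_le_power2[of eps] zero_le_power2[of "nrm1 (err X n)"] unfolding energy_def by linarith
  then show *: "(\<Sum>k<n. (2 * \<tau>) * (nrm0 (rate X k))\<^sup>2) \<le> exp (growth * T) / omega * eps\<^sup>2"
    using omega_pos by (simp add: pos_le_divide_eq mult.commute)
  have "err X n j = (\<Sum>k<n. (2 * \<tau>) *\<^sub>R rate X k j)" if "j \<le> J" for j
  proof -
    have "(2 * \<tau>) *\<^sub>R rate X k j = err X (Suc k) j - err X k j" for k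
      using \<tau>_pos by (simp add: rate_def err_def tm_Suc scaleR_diff_right)
    then have "(\<Sum>k<n. (2 * \<tau>) *\<^sub>R rate X k j) = err X n j - err X 0 j"
      using sum_lessThan_telescope[of "\<lambda>k. err X k j" n] by simp
    then show ?thesis using err_0[OF run that] by simp
  qed
  then have "(nrm0 (err X n))\<^sup>2 = (nrm0 (\<lambda>j. \<Sum>k<n. (2 * \<tau>) *\<^sub>R rate X k j))\<^sup>2"
    unfolding nrm0_sq by (intro sum.cong) auto
  also have "\<dots> \<le> real n * (\<Sum>k<n. (nrm0 (\<lambda>j. (2 * \<tau>) *\<^sub>R rate X k j))\<^sup>2)"
    by (rule nrm0_sq_sum_le)
  also have "\<dots> = real n * (\<Sum>k<n. (2 * \<tau>)\<^sup>2 * (nrm0 (rate X k))\<^sup>2)"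
    unfolding nrm0_sq by (simp add: power_mult_distrib sum_distrib_left algebra_simps)
  also have "\<dots> = tm n * (\<Sum>k<n. (2 * \<tau>) * (nrm0 (rate X k))\<^sup>2)"
    by (simp add: tm_def sum_distrib_left power2_eq_square algebra_simps)
  also have "\<dots> \<le> T * (exp (growth * T) / omega * eps\<^sup>2)"
    using tm_mem[OF n] * \<tau>_pos by (intro mult_mono sum_nonneg) auto
  finally show "(nrm0 (err X n))\<^sup>2 \<le> T * (exp (growth * T) / omega * eps\<^sup>2)" .
qed

text \<open>All coefficients met by a run are positive, so that the next stage is uniquely solvable.\<close>

lemma run_weights:
  assumes run: "nodal_run n X Y" and n: "n < M" and j: "j \<in> {1..J}"
  shows "0 < (norm (dq (X n) j))\<^sup>2"
    and "Y' 0 = Y' J \<Longrightarrow> predicts \<tau> (X n) Y' \<Longrightarrow> 0 < (norm (dq Y' j))\<^sup>2"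
proof -
  have c: "controlled X n" using energy_growth[OF run] n by simp
  have per: "X n 0 = X n J" using run by (simp add: nodal_run_def)
  show "0 < (norm (dq (X n) j))\<^sup>2"
    using controlled_weight[OF c _ j] n omega_pos by linarith
  show "0 < (norm (dq Y' j))\<^sup>2" if "Y' 0 = Y' J" "predicts \<tau> (X n) Y'"
    using predictor_controlled(2)[OF c n per that j] omega_pos by linarith
qed

end

section \<open>From nodal values to functions\<close>

lemma sq_sum3_le:
  fixes a b c :: real
  shows "(a + b + c)\<^sup>2 \<le> 3 * a\<^sup>2 + 3 * b\<^sup>2 + 3 * c\<^sup>2"
  using zero_le_power2[of "a - b"] zero_le_power2[of "a - c"] zero_le_power2[of "b - c"]
  by (simp add: power2_eq_square algebra_simps)

context fe_mesh
begin

text \<open>The error splits into the interpolation error, estimated by comparing chord and tangent at the left end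
  node, and the affine interpolant of the nodal errors, which is a convex combination of its end values.\<close>

lemma fe_error_on_element:
  fixes f :: "real \<Rightarrow> real^'d"
  assumes d: "\<And>r. (f has_vector_derivative f1 r) (at r)" "\<And>r. (f1 has_vector_derivative f2 r) (at r)"
    and b: "\<And>r. norm (f2 r) \<le> B" and F: "F \<in> vfe_space J p"
    and j: "j \<in> {1..J}" and H: "elem_size p j \<le> H" and r: "p (j - 1) < r" "r < p j"
  shows "norm (f r - F r) \<le> 2 * B * H\<^sup>2 + (norm (f (p (j - 1)) - F (p (j - 1))) + norm (f (p j) - F (p j)))"
    and "norm (f1 r - dq (\<lambda>j. F (p j)) j) \<le> 2 * B * H + norm (dq (\<lambda>j. f (p j) - F (p j)) j)"
proof -
  define a where "a = p (j - 1)"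
  define k where "k = elem_size p j"
  define s where "s = r - a"
  define D where "D = dq (\<lambda>j. f (p j)) j"
  have B0: "0 \<le> B" using b[of 0] norm_ge_zero order_trans by blast
  have k: "0 < k" "k \<le> H" using elem_size_pos[OF j] H by (simp_all add: k_def)
  have s: "0 < s" "s < k" using r by (simp_all add: s_def k_def a_def elem_size_def)
  have pj: "p j = a + k" by (simp add: a_def k_def elem_size_def)
  have D: "D = (f (a + k) - f a) /\<^sub>R k"
    unfolding D_def dq_def k_def[symmetric] a_def[symmetric] pj by (rule refl)
  have slope: "norm (D - f1 a) \<le> B * k"
    unfolding D using slope_first_order[of f f1 f2 B k a, OF d b] k by simp
  have T2: "norm (f r - f a - s *\<^sub>R f1 a) \<le> B * s\<^sup>2"
    using taylor2[of UNIV a r f f1 f2 B] d b by (simp add: s_def)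
  have T1: "norm (s *\<^sub>R (f1 a - D)) \<le> s * (B * k)"
    using slope s by (simp add: norm_minus_commute mult_left_mono)
  have split: "f r - f a - s *\<^sub>R D = (f r - f a - s *\<^sub>R f1 a) + s *\<^sub>R (f1 a - D)"
    by (simp add: scaleR_diff_right)
  have "norm (f r - f a - s *\<^sub>R D) \<le> B * s\<^sup>2 + s * (B * k)"
    unfolding split by (rule order_trans[OF norm_triangle_ineq add_mono[OF T2 T1]])
  also have "\<dots> \<le> B * H\<^sup>2 + B * H\<^sup>2"
  proof (rule add_mono)
    show "B * s\<^sup>2 \<le> B * H\<^sup>2" using s k B0 by (intro mult_left_mono power_mono) auto
    have "s * k \<le> H * H" using s k by (intro mult_mono) auto
    then have "B * (s * k) \<le> B * (H * H)" using B0 by (rule mult_left_mono)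
    then show "s * (B * k) \<le> B * H\<^sup>2" by (simp add: power2_eq_square mult_ac)
  qed
  finally have R: "norm (f r - f a - s *\<^sub>R D) \<le> 2 * B * H\<^sup>2" by simp
  define e0 where "e0 = f a - F a"
  define e1 where "e1 = f (p j) - F (p j)"
  have Fr: "F r = F a + s *\<^sub>R dq (\<lambda>j. F (p j)) j"
    unfolding a_def s_def by (rule vfe_space_affine[OF F j]) (use r in simp)
  have de: "D - dq (\<lambda>j. F (p j)) j = (e1 - e0) /\<^sub>R k"
    unfolding D_def dq_diff[symmetric] unfolding dq_def e0_def e1_def k_def a_def by (rule refl)
  have "f r - F r = (f r - f a - s *\<^sub>R D) + (e0 + s *\<^sub>R (D - dq (\<lambda>j. F (p j)) j))"
    by (simp add: Fr e0_def scaleR_diff_right)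
  also have "e0 + s *\<^sub>R (D - dq (\<lambda>j. F (p j)) j) = (1 - s / k) *\<^sub>R e0 + (s / k) *\<^sub>R e1"
    unfolding de by (simp add: divide_inverse algebra_simps)
  finally have "norm (f r - F r) \<le> norm (f r - f a - s *\<^sub>R D) + (norm ((1 - s / k) *\<^sub>R e0) + norm ((s / k) *\<^sub>R e1))"
    by (simp only: order_trans[OF norm_triangle_ineq add_left_mono[OF norm_triangle_ineq]])
  moreover have "norm ((1 - s / k) *\<^sub>R e0) \<le> norm e0" "norm ((s / k) *\<^sub>R e1) \<le> norm e1"
  proof -
    have shrink: "norm (c *\<^sub>R v) \<le> norm v" if "0 \<le> c" "c \<le> 1" for c and v :: "real^'d"
      using that mult_right_mono[of c 1 "norm v"] by simp
    have "0 \<le> s / k" "s / k \<le> 1" using s k by simp_all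
    then show "norm ((1 - s / k) *\<^sub>R e0) \<le> norm e0" "norm ((s / k) *\<^sub>R e1) \<le> norm e1"
      by (intro shrink; linarith)+
  qed
  ultimately show "norm (f r - F r) \<le> 2 * B * H\<^sup>2 + (norm (f (p (j - 1)) - F (p (j - 1))) + norm (f (p j) - F (p j)))"
    using R unfolding e0_def e1_def a_def by linarith
  have "norm (f1 r - f1 a) \<le> B * s"
    using taylor1[of UNIV a r f1 f2 B] d b s by (simp add: s_def)
  also have "\<dots> \<le> B * H" using s k B0 by (intro mult_left_mono) auto
  finally have 1: "norm (f1 r - f1 a) \<le> B * H" .
  have 2: "norm (f1 a - D) \<le> B * H"
    using slope mult_left_mono[OF k(2) B0] by (simp add: norm_minus_commute)
  have 3: "D - dq (\<lambda>j. F (p j)) j = dq (\<lambda>j. f (p j) - F (p j)) j" by (simp add: D_def dq_diff)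
  have "f1 r - dq (\<lambda>j. F (p j)) j = (f1 r - f1 a) + (f1 a - D) + (D - dq (\<lambda>j. F (p j)) j)" by simp
  then have "norm (f1 r - dq (\<lambda>j. F (p j)) j) \<le> norm (f1 r - f1 a) + norm (f1 a - D) + norm (D - dq (\<lambda>j. F (p j)) j)"
    by (simp only: order_trans[OF norm_triangle_ineq add_right_mono[OF norm_triangle_ineq]])
  then show "norm (f1 r - dq (\<lambda>j. F (p j)) j) \<le> 2 * B * H + norm (dq (\<lambda>j. f (p j) - F (p j)) j)"
    using 1 2 unfolding 3 by simp
qed

lemma vfe_space_difference_quotient:
  assumes "f \<in> vfe_space J p" "g \<in> vfe_space J p"
  shows "(\<lambda>r. (f r - g r) /\<^sub>R s) \<in> vfe_space J p"
  unfolding vfe_space_iff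
proof
  fix i
  have f: "(\<lambda>r. f r $ i) \<in> fe_space J p" and g: "(\<lambda>r. g r $ i) \<in> fe_space J p"
    using assms by (auto simp: vfe_space_iff)
  have "\<exists>a b. \<forall>r\<in>{p (j - 1)..p j}. inverse s * (f r $ i - g r $ i) = a + b * r" if j: "j \<in> {1..J}" for j
  proof -
    obtain a b where ab: "\<And>r. r \<in> {p (j - 1)..p j} \<Longrightarrow> f r $ i = a + b * r"
      using f j unfolding fe_space_def by blast
    obtain a' b' where ab': "\<And>r. r \<in> {p (j - 1)..p j} \<Longrightarrow> g r $ i = a' + b' * r"
      using g j unfolding fe_space_def by blast
    show ?thesis
      by (rule exI[of _ "inverse s * (a - a')"], rule exI[of _ "inverse s * (b - b')"])
        (simp add: ab ab' algebra_simps)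
  qed
  moreover have "continuous_on UNIV (\<lambda>r. inverse s * (f r $ i - g r $ i))"
    using f g unfolding fe_space_def
    by (intro continuous_on_mult continuous_on_const continuous_on_diff) auto
  moreover have "periodic1 (\<lambda>r. inverse s * (f r $ i - g r $ i))"
    using f g by (simp add: fe_space_def periodic1_def)
  ultimately show "(\<lambda>r. ((f r - g r) /\<^sub>R s) $ i) \<in> fe_space J p"
    by (simp add: fe_space_def)
qed

text \<open>The function \<open>g\<close> near \<open>f\<close> allows for an additional error in time.\<close>

lemma L2_error_le:
  fixes f g :: "real \<Rightarrow> real^'d"
  assumes d: "\<And>r. (f has_vector_derivative f1 r) (at r)" "\<And>r. (f1 has_vector_derivative f2 r) (at r)"
    and b: "\<And>r. norm (f2 r) \<le> B" and F: "F \<in> vfe_space J p"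
    and H: "\<And>j. j \<in> {1..J} \<Longrightarrow> elem_size p j \<le> H" and g: "\<And>r. norm (g r - f r) \<le> \<delta>"
  shows "L2_inner (\<lambda>r. g r - F r) (\<lambda>r. g r - F r)
    \<le> 3 * \<delta>\<^sup>2 + 12 * B\<^sup>2 * H^4 + 12 * (nrm0 (\<lambda>j. f (p j) - F (p j)))\<^sup>2"
proof -
  define e where "e = (\<lambda>j. f (p j) - F (p j))"
  define C where "C = 3 * \<delta>\<^sup>2 + 12 * B\<^sup>2 * H^4"
  have "L2_inner (\<lambda>r. g r - F r) (\<lambda>r. g r - F r)
    \<le> (\<Sum>j=1..J. elem_size p j * (C + 6 * ((norm (e j))\<^sup>2 + (norm (e (j - 1)))\<^sup>2)))"
  proof (rule L2_inner_le_pieces)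
    fix j r assume j: "j \<in> {1..J}" and r: "p (j - 1) < r" "r < p j"
    let ?n = "norm (e (j - 1)) + norm (e j)"
    have "norm (g r - F r) \<le> norm (g r - f r) + norm (f r - F r)"
      using norm_triangle_ineq[of "g r - f r" "f r - F r"] by simp
    also have "\<dots> \<le> \<delta> + 2 * B * H\<^sup>2 + ?n"
      using fe_error_on_element(1)[OF d b F j H[OF j] r] g[of r] by (simp add: e_def)
    finally have "(norm (g r - F r))\<^sup>2 \<le> (\<delta> + 2 * B * H\<^sup>2 + ?n)\<^sup>2" by (rule power_mono) simp
    also have "\<dots> \<le> 3 * \<delta>\<^sup>2 + 3 * (2 * B * H\<^sup>2)\<^sup>2 + 3 * ?n\<^sup>2" by (rule sq_sum3_le)
    also have "\<dots> \<le> 3 * \<delta>\<^sup>2 + 3 * (2 * B * H\<^sup>2)\<^sup>2 + 3 * (2 * (norm (e (j - 1)))\<^sup>2 + 2 * (norm (e j))\<^sup>2)"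
      using sq_sum_le[of "norm (e (j - 1))" "norm (e j)"] by simp
    also have "\<dots> = C + 6 * ((norm (e j))\<^sup>2 + (norm (e (j - 1)))\<^sup>2)"
      by (simp add: C_def power_mult_distrib)
    finally show "(norm (g r - F r))\<^sup>2 \<le> C + 6 * ((norm (e j))\<^sup>2 + (norm (e (j - 1)))\<^sup>2)" .
  next
    fix j
    have "0 \<le> C" by (simp add: C_def)
    then show "0 \<le> C + 6 * ((norm (e j))\<^sup>2 + (norm (e (j - 1)))\<^sup>2)" by simp
  qed
  also have "\<dots> = C * (\<Sum>j=1..J. elem_size p j) + 12 * (nrm0 e)\<^sup>2"
    unfolding nrm0_sq sum_distrib_left sum.distrib[symmetric] by (rule sum.cong) (simp_all add: algebra_simps)
  finally show ?thesis unfolding sum_elem C_def e_def by simp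
qed

lemma H1_error_le:
  fixes f :: "real \<Rightarrow> real^'d"
  assumes d: "\<And>r. (f has_vector_derivative f1 r) (at r)" "\<And>r. (f1 has_vector_derivative f2 r) (at r)"
    and b: "\<And>r. norm (f2 r) \<le> B" and F: "F \<in> vfe_space J p"
    and H: "\<And>j. j \<in> {1..J} \<Longrightarrow> elem_size p j \<le> H"
  shows "L2_inner (d_rho (\<lambda>r. f r - F r)) (d_rho (\<lambda>r. f r - F r))
    \<le> 8 * B\<^sup>2 * H\<^sup>2 + 2 * (nrm1 (\<lambda>j. f (p j) - F (p j)))\<^sup>2"
proof -
  define e where "e = (\<lambda>j. f (p j) - F (p j))"
  define C where "C = 8 * B\<^sup>2 * H\<^sup>2"
  have "L2_inner (d_rho (\<lambda>r. f r - F r)) (d_rho (\<lambda>r. f r - F r))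
    \<le> (\<Sum>j=1..J. elem_size p j * (C + 2 * (norm (dq e j))\<^sup>2))"
  proof (rule L2_inner_le_pieces)
    fix j r assume j: "j \<in> {1..J}" and r: "p (j - 1) < r" "r < p j"
    have "((\<lambda>r. f r - F r) has_vector_derivative f1 r - dq (\<lambda>j. F (p j)) j) (at r)"
      by (intro has_vector_derivative_diff d d_rho_vfe(1)[OF F j r])
    then have "d_rho (\<lambda>r. f r - F r) r = f1 r - dq (\<lambda>j. F (p j)) j"
      by (simp add: d_rho_def vector_derivative_at)
    then have "norm (d_rho (\<lambda>r. f r - F r) r) \<le> 2 * B * H + norm (dq e j)"
      using fe_error_on_element(2)[OF d b F j H[OF j] r] by (simp add: e_def)
    then have "(norm (d_rho (\<lambda>r. f r - F r) r))\<^sup>2 \<le> (2 * B * H + norm (dq e j))\<^sup>2"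
      by (rule power_mono) simp
    also have "\<dots> \<le> 2 * (2 * B * H)\<^sup>2 + 2 * (norm (dq e j))\<^sup>2" by (rule sq_sum_le)
    also have "\<dots> = C + 2 * (norm (dq e j))\<^sup>2" by (simp add: C_def power_mult_distrib)
    finally show "(norm (d_rho (\<lambda>r. f r - F r) r))\<^sup>2 \<le> C + 2 * (norm (dq e j))\<^sup>2" .
  qed (simp add: C_def)
  also have "\<dots> = C * (\<Sum>j=1..J. elem_size p j) + 2 * (nrm1 e)\<^sup>2"
    unfolding nrm1_sq sum_distrib_left sum.distrib[symmetric] by (rule sum.cong) (simp_all add: algebra_simps)
  finally show ?thesis unfolding sum_elem C_def e_def by simp
qed

end

locale csf_fem = csf_scheme x xr xrr xrrr xrrrr xt xtt xttt xrrt xrrtt z zr zrr T B c0 J p K M \<tau>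
  for x xr xrr xrrr xrrrr xt xtt xttt xrrt xrrtt z zr zrr :: "real \<Rightarrow> real \<Rightarrow> real^'d"
    and T B c0 :: real and J p and K :: real and M \<tau> +
  fixes x0 :: "real \<Rightarrow> real^'d"
  assumes x0: "\<And>r. x r 0 = x0 r"
begin

abbreviation nodes :: "(real \<Rightarrow> real^'d) \<Rightarrow> nat \<Rightarrow> real^'d" where
  "nodes f \<equiv> \<lambda>j. f (p j)"

text \<open>A run of the scheme for the first \<open>n\<close> steps, without conditions on the values outside the time
  levels involved. This makes induction on \<open>n\<close> possible.\<close>

definition fe_run :: "nat \<Rightarrow> (nat \<Rightarrow> real \<Rightarrow> real^'d) \<Rightarrow> (nat \<Rightarrow> real \<Rightarrow> real^'d) \<Rightarrow> bool" where
  "fe_run n X Y \<longleftrightarrow> X 0 = vinterp J p x0 \<and> (\<forall>m\<le>n. X m \<in> vfe_space J p) \<and>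
     (\<forall>m<n. Y m \<in> vfe_space J p \<and> predicts \<tau> (nodes (X m)) (nodes (Y m))
        \<and> corrects \<tau> (nodes (X m)) (nodes (Y m)) (nodes (X (Suc m))))"

lemma T_mem: "0 \<in> {0..T}" using T_pos by simp

lemma x0_per: "x0 0 = x0 1"
  using x_periodic[OF T_mem, of 0] by (simp add: x0)

lemma fe_run_nodal:
  assumes "fe_run n X Y"
  shows "nodal_run n (\<lambda>m. nodes (X m)) (\<lambda>m. nodes (Y m))"
proof -
  have "X 0 (p j) = x (p j) 0" if "j \<le> J" for j
    using assms vinterp_nodal(2)[where f = x0, OF x0_per that] by (simp add: fe_run_def x0)
  moreover have "X m (p 0) = X m (p J)" if "m \<le> n" for m
    by (rule vfe_space_periodic) (use assms that in \<open>simp add: fe_run_def\<close>)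
  moreover have "Y m (p 0) = Y m (p J)" if "m < n" for m
    by (rule vfe_space_periodic) (use assms that in \<open>simp add: fe_run_def\<close>)
  ultimately show ?thesis
    using assms unfolding fe_run_def nodal_run_def by blast
qed

lemma scheme_solution_iff:
  "scheme_solution J p M (2 * \<tau>) x0 X Y \<longleftrightarrow>
     X \<in> extensional {0..M} \<and> Y \<in> extensional {0..<M} \<and> fe_run M X Y"
proof -
  define E1 where "E1 m \<longleftrightarrow> (\<forall>\<eta>\<in>vfe_space J p.
           lumped_inner J p (\<lambda>r. (Y m r - X m r) /\<^sub>R (1/2 * (2 * \<tau>)))
                            (\<lambda>r. (norm (d_rho (X m) r))\<^sup>2 *\<^sub>R \<eta> r)
           + L2_inner (d_rho (Y m)) (d_rho \<eta>) = 0)" for m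
  define E2 where "E2 m \<longleftrightarrow> (\<forall>\<eta>\<in>vfe_space J p.
           lumped_inner J p (\<lambda>r. (X (Suc m) r - X m r) /\<^sub>R (2 * \<tau>))
                            (\<lambda>r. (norm (d_rho (Y m) r))\<^sup>2 *\<^sub>R \<eta> r)
           + 1/2 * L2_inner (\<lambda>r. d_rho (X (Suc m)) r + d_rho (X m) r) (d_rho \<eta>) = 0)" for m
  have half: "1/2 * (2 * \<tau>) = \<tau>" by simp
  have e1: "E1 m \<longleftrightarrow> predicts \<tau> (nodes (X m)) (nodes (Y m))"
    if "X m \<in> vfe_space J p" "Y m \<in> vfe_space J p" for m
    unfolding E1_def half predicts_def by (rule predictor_nodal[OF that])
  have e2: "E2 m \<longleftrightarrow> corrects \<tau> (nodes (X m)) (nodes (Y m)) (nodes (X (Suc m)))"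
    if "X m \<in> vfe_space J p" "X (Suc m) \<in> vfe_space J p" "Y m \<in> vfe_space J p" for m
    unfolding E2_def corrects_def by (rule corrector_nodal[OF that])
  have "scheme_solution J p M (2 * \<tau>) x0 X Y \<longleftrightarrow> X \<in> {0..M} \<rightarrow>\<^sub>E vfe_space J p \<and>
     Y \<in> {0..<M} \<rightarrow>\<^sub>E vfe_space J p \<and> X 0 = vinterp J p x0 \<and> (\<forall>m<M. E1 m \<and> E2 m)"
    unfolding scheme_solution_def E1_def E2_def by (rule refl)
  then show ?thesis
    unfolding fe_run_def PiE_def Pi_def by (auto simp: e1 e2)
qed

lemma fe_run_exists:
  assumes "n \<le> M"
  shows "\<exists>X Y. fe_run n X Y"
  using assms
proof (induction n)
  case 0
  have "fe_run 0 (\<lambda>_. vinterp J p x0) Y" for Y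
    unfolding fe_run_def using vinterp_nodal(1)[where f = x0, OF x0_per] by simp
  then show ?case by blast
next
  case (Suc n)
  then obtain X Y where XY: "fe_run n X Y" by auto
  have run: "nodal_run n (\<lambda>m. nodes (X m)) (\<lambda>m. nodes (Y m))" by (rule fe_run_nodal[OF XY])
  have n: "n < M" using Suc.prems by simp
  have Xn: "X n \<in> vfe_space J p" using XY by (simp add: fe_run_def)
  have per: "nodes (X n) 0 = nodes (X n) J" using vfe_space_periodic[OF Xn] by simp
  obtain V where V: "V 0 = V J" "predicts \<tau> (nodes (X n)) V"
    using predicts_exists[OF run_weights(1)[OF run n] \<tau>_pos per] by blast
  obtain W where W: "W 0 = W J" "corrects \<tau> (nodes (X n)) V W"
    using corrects_exists[OF run_weights(2)[OF run n _ V] \<tau>_pos per] by blast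
  have "predicts \<tau> (nodes (X n)) (nodes (pl V))"
    "corrects \<tau> (nodes (X n)) (nodes (pl V)) (nodes (pl W))"
  proof -
    have pv: "pl V (p j) = V j" "pl W (p j) = W j" if "j \<le> J" for j
      using that V(1) W(1) by (simp_all add: pl_node)
    have dqv: "dq (nodes (pl V)) j = dq V j" if "j \<in> {1..J}" for j
      using that pv(1)[of j] pv(1)[of "j - 1"] by (auto simp: dq_def)
    have wip_eq: "wip w U Z = wip w' U' Z"
      if "\<And>j. j \<in> {1..J} \<Longrightarrow> w j = w' j" "\<And>j. j \<le> J \<Longrightarrow> U j = U' j" for w w' U U' and Z :: "nat \<Rightarrow> real^'d"
      unfolding wip_def by (rule sum.cong) (use that in auto)
    have stiff_eq: "stiff U Z = stiff U' Z"
      if "\<And>j. j \<le> J \<Longrightarrow> U j = U' j" for U U' and Z :: "nat \<Rightarrow> real^'d"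
      unfolding stiff_def dq_def[of U] dq_def[of U'] by (rule sum.cong) (use that in auto)
    show "predicts \<tau> (nodes (X n)) (nodes (pl V))"
      unfolding predicts_def
    proof (intro allI impI)
      fix Z :: "nat \<Rightarrow> real^'d" assume Z: "Z 0 = Z J"
      have "wip (speed2 (nodes (X n))) (\<lambda>j. (pl V (p j) - X n (p j)) /\<^sub>R \<tau>) Z
         = wip (speed2 (nodes (X n))) (\<lambda>j. (V j - X n (p j)) /\<^sub>R \<tau>) Z"
        by (rule wip_eq) (simp_all add: pv)
      moreover have "stiff (nodes (pl V)) Z = stiff V Z" by (rule stiff_eq) (simp add: pv)
      ultimately show "wip (speed2 (nodes (X n))) (\<lambda>j. (pl V (p j) - X n (p j)) /\<^sub>R \<tau>) Z
          + stiff (nodes (pl V)) Z = 0"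
        using V(2) Z unfolding predicts_def by simp
    qed
    show "corrects \<tau> (nodes (X n)) (nodes (pl V)) (nodes (pl W))"
      unfolding corrects_def
    proof (intro allI impI)
      fix Z :: "nat \<Rightarrow> real^'d" assume Z: "Z 0 = Z J"
      have "wip (speed2 (nodes (pl V))) (\<lambda>j. (pl W (p j) - X n (p j)) /\<^sub>R (2 * \<tau>)) Z
         = wip (speed2 V) (\<lambda>j. (W j - X n (p j)) /\<^sub>R (2 * \<tau>)) Z"
        by (rule wip_eq) (simp_all add: pv dqv)
      moreover have "stiff (\<lambda>j. (1/2) *\<^sub>R (pl W (p j) + X n (p j))) Z = stiff (\<lambda>j. (1/2) *\<^sub>R (W j + X n (p j))) Z"
        by (rule stiff_eq) (simp add: pv)
      ultimately show "wip (speed2 (nodes (pl V))) (\<lambda>j. (pl W (p j) - X n (p j)) /\<^sub>R (2 * \<tau>)) Z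
          + stiff (\<lambda>j. (1/2) *\<^sub>R (pl W (p j) + X n (p j))) Z = 0"
        using W(2) Z unfolding corrects_def by simp
    qed
  qed
  then have "fe_run (Suc n) (X(Suc n := pl W)) (Y(n := pl V))"
    using XY pl_in_vfe_space[OF V(1)] pl_in_vfe_space[OF W(1)]
    unfolding fe_run_def by (auto simp: less_Suc_eq le_Suc_eq)
  then show ?case by blast
qed

lemma fe_run_unique:
  assumes "fe_run n X Y" "fe_run n X' Y'" "n \<le> M"
  shows "(\<forall>m\<le>n. X m = X' m) \<and> (\<forall>m<n. Y m = Y' m)"
  using assms
proof (induction n)
  case 0
  then show ?case by (simp add: fe_run_def)
next
  case (Suc n)
  have XY: "fe_run n X Y" "fe_run n X' Y'" using Suc.prems by (auto simp: fe_run_def)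
  then have IH: "\<forall>m\<le>n. X m = X' m" "\<forall>m<n. Y m = Y' m" using Suc by auto
  have run: "nodal_run n (\<lambda>m. nodes (X m)) (\<lambda>m. nodes (Y m))" by (rule fe_run_nodal[OF XY(1)])
  have n: "n < M" using Suc.prems by simp
  have mem: "X n \<in> vfe_space J p" "Y n \<in> vfe_space J p" "Y' n \<in> vfe_space J p"
    "X (Suc n) \<in> vfe_space J p" "X' (Suc n) \<in> vfe_space J p"
    and eqs: "predicts \<tau> (nodes (X n)) (nodes (Y n))" "predicts \<tau> (nodes (X n)) (nodes (Y' n))"
    "corrects \<tau> (nodes (X n)) (nodes (Y n)) (nodes (X (Suc n)))"
    "corrects \<tau> (nodes (X n)) (nodes (Y' n)) (nodes (X' (Suc n)))"
    using Suc.prems IH by (simp_all add: fe_run_def)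
  have per: "nodes f 0 = nodes f J" if "f \<in> vfe_space J p" for f :: "real \<Rightarrow> real^'d"
    using vfe_space_periodic[OF that] by simp
  have Y: "Y n = Y' n"
  proof (rule vfe_space_eqI[OF mem(2,3)])
    fix j assume "j \<in> {1..J}"
    then have jJ: "j \<le> J" by simp
    show "Y n (p j) = Y' n (p j)"
      by (rule predicts_unique[OF run_weights(1)[OF run n] \<tau>_pos per[OF mem(2)] per[OF mem(3)] eqs(1,2) jJ])
  qed
  have "X (Suc n) = X' (Suc n)"
  proof (rule vfe_space_eqI[OF mem(4,5)])
    fix j assume "j \<in> {1..J}"
    then have jJ: "j \<le> J" by simp
    show "X (Suc n) (p j) = X' (Suc n) (p j)"
      by (rule corrects_unique[OF run_weights(2)[OF run n _ per[OF mem(2)] eqs(1)] \<tau>_pos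
            per[OF mem(1)] per[OF mem(4)] per[OF mem(5)] eqs(3) eqs(4)[folded Y] jJ])
  qed
  then show ?case using IH Y by (auto simp: le_Suc_eq less_Suc_eq)
qed

lemma scheme_exists_unique: "\<exists>!XY. case XY of (X, Y) \<Rightarrow> scheme_solution J p M (2 * \<tau>) x0 X Y"
proof -
  obtain X Y where XY: "fe_run M X Y" using fe_run_exists[of M] by blast
  define X1 where "X1 = restrict X {0..M}"
  define Y1 where "Y1 = restrict Y {0..<M}"
  have "fe_run M X1 Y1"
    using XY unfolding fe_run_def X1_def Y1_def by simp
  then have sol: "scheme_solution J p M (2 * \<tau>) x0 X1 Y1"
    unfolding scheme_solution_iff by (simp add: X1_def Y1_def)
  have uniq: "X2 = X1 \<and> Y2 = Y1" if "scheme_solution J p M (2 * \<tau>) x0 X2 Y2" for X2 Y2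
  proof -
    have r: "fe_run M X2 Y2" "fe_run M X1 Y1"
      and ext: "X2 \<in> extensional {0..M}" "Y2 \<in> extensional {0..<M}"
        "X1 \<in> extensional {0..M}" "Y1 \<in> extensional {0..<M}"
      using that sol unfolding scheme_solution_iff by blast+
    have *: "\<forall>m\<le>M. X2 m = X1 m" "\<forall>m<M. Y2 m = Y1 m"
      using fe_run_unique[OF r order_refl] by blast+
    have "X2 = X1" by (rule extensionalityI[OF ext(1,3)]) (simp add: *(1))
    moreover have "Y2 = Y1" by (rule extensionalityI[OF ext(2,4)]) (simp add: *(2))
    ultimately show ?thesis ..
  qed
  show ?thesis
  proof (rule ex1I[of _ "(X1, Y1)"])
    show "case (X1, Y1) of (X, Y) \<Rightarrow> scheme_solution J p M (2 * \<tau>) x0 X Y"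
      unfolding prod.case by (rule sol)
    fix XY assume *: "case XY of (X, Y) \<Rightarrow> scheme_solution J p M (2 * \<tau>) x0 X Y"
    obtain X2 Y2 where XY: "XY = (X2, Y2)" by (rule prod.exhaust)
    have "scheme_solution J p M (2 * \<tau>) x0 X2 Y2" using * unfolding XY prod.case .
    then show "XY = (X1, Y1)" unfolding XY using uniq by blast
  qed
qed

lemma L2_norm_sq: "L2_inner u u \<le> C \<Longrightarrow> L2_norm u \<le> sqrt C"
  by (simp add: L2_norm_def)

lemma L2_error:
  assumes run: "fe_run M X Y" and m: "m \<le> M"
  shows "L2_norm (\<lambda>r. x r (tm m) - X m r)
    \<le> sqrt (12 * B\<^sup>2 + 12 * (T * (exp (growth * T) / omega * Cres\<^sup>2))) * (hmax\<^sup>2 + (2 * \<tau>)\<^sup>2)"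
proof -
  let ?q = "hmax\<^sup>2 + (2 * \<tau>)\<^sup>2"
  have run': "nodal_run m (\<lambda>m. nodes (X m)) (\<lambda>m. nodes (Y m))"
    by (rule fe_run_nodal) (use run m in \<open>simp add: fe_run_def\<close>)
  have Xm: "X m \<in> vfe_space J p" using run m by (simp add: fe_run_def)
  have "L2_inner (\<lambda>r. x r (tm m) - X m r) (\<lambda>r. x r (tm m) - X m r)
     \<le> 3 * 0\<^sup>2 + 12 * B\<^sup>2 * hmax^4 + 12 * (nrm0 (\<lambda>j. x (p j) (tm m) - X m (p j)))\<^sup>2"
    by (rule L2_error_le[where f = "\<lambda>r. x r (tm m)"])
      (use x_r[OF tm_mem[OF m]] x_rr[OF tm_mem[OF m]] bounds[OF tm_mem[OF m]] Xm elem_le in auto)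
  also have "\<dots> \<le> 12 * B\<^sup>2 * ?q\<^sup>2 + 12 * (T * (exp (growth * T) / omega * eps\<^sup>2))"
  proof -
    have "hmax^4 = (hmax\<^sup>2)\<^sup>2" by simp
    also have "\<dots> \<le> ?q\<^sup>2" by (intro power_mono) auto
    finally have "12 * B\<^sup>2 * hmax^4 \<le> 12 * B\<^sup>2 * ?q\<^sup>2" by (intro mult_left_mono) auto
    moreover have "(nrm0 (\<lambda>j. x (p j) (tm m) - X m (p j)))\<^sup>2 \<le> T * (exp (growth * T) / omega * eps\<^sup>2)"
      using nodal_error_bounds(3)[OF run' m] by (simp add: err_def)
    ultimately show ?thesis by simp
  qed
  also have "\<dots> = (12 * B\<^sup>2 + 12 * (T * (exp (growth * T) / omega * Cres\<^sup>2))) * ?q\<^sup>2"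
  proof -
    have "12 * b * Q + 12 * (T * (G * (C * Q))) = (12 * b + 12 * (T * (G * C))) * Q" for b G C Q :: real
      by (simp add: algebra_simps)
    then show ?thesis unfolding eps_def power_mult_distrib[of Cres] .
  qed
  finally show ?thesis
    by (rule order_trans[OF L2_norm_sq]) (simp add: real_sqrt_mult)
qed

lemma H1_error:
  assumes run: "fe_run M X Y" and m: "m \<le> M"
  shows "hmax * H1_seminorm (\<lambda>r. x r (tm m) - X m r)
    \<le> sqrt (8 * B\<^sup>2 + 2 * (exp (growth * T) * Cres\<^sup>2)) * (hmax\<^sup>2 + (2 * \<tau>)\<^sup>2)"
proof -
  let ?q = "hmax\<^sup>2 + (2 * \<tau>)\<^sup>2"
  have run': "nodal_run m (\<lambda>m. nodes (X m)) (\<lambda>m. nodes (Y m))"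
    by (rule fe_run_nodal) (use run m in \<open>simp add: fe_run_def\<close>)
  have Xm: "X m \<in> vfe_space J p" using run m by (simp add: fe_run_def)
  let ?u = "d_rho (\<lambda>r. x r (tm m) - X m r)"
  have "L2_inner ?u ?u \<le> 8 * B\<^sup>2 * hmax\<^sup>2 + 2 * (nrm1 (\<lambda>j. x (p j) (tm m) - X m (p j)))\<^sup>2"
    by (rule H1_error_le[where f = "\<lambda>r. x r (tm m)"])
      (use x_r[OF tm_mem[OF m]] x_rr[OF tm_mem[OF m]] bounds[OF tm_mem[OF m]] Xm elem_le in auto)
  also have "\<dots> \<le> 8 * B\<^sup>2 * hmax\<^sup>2 + 2 * (exp (growth * T) * eps\<^sup>2)"
    using nodal_error_bounds(1)[OF run' m] by (simp add: err_def)
  finally have "H1_seminorm (\<lambda>r. x r (tm m) - X m r) \<le> sqrt (8 * B\<^sup>2 * hmax\<^sup>2 + 2 * (exp (growth * T) * eps\<^sup>2))"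
    unfolding H1_seminorm_def by (rule L2_norm_sq)
  then have "hmax * H1_seminorm (\<lambda>r. x r (tm m) - X m r)
      \<le> hmax * sqrt (8 * B\<^sup>2 * hmax\<^sup>2 + 2 * (exp (growth * T) * eps\<^sup>2))"
    using hmax_pos by (intro mult_left_mono) auto
  also have "\<dots> = sqrt (hmax\<^sup>2 * (8 * B\<^sup>2 * hmax\<^sup>2 + 2 * (exp (growth * T) * eps\<^sup>2)))"
    using hmax_pos by (simp add: real_sqrt_mult)
  also have "\<dots> \<le> sqrt ((8 * B\<^sup>2 + 2 * (exp (growth * T) * Cres\<^sup>2)) * ?q\<^sup>2)"
  proof (rule real_sqrt_le_mono)
    have "hmax\<^sup>2 \<le> 1" using size_le hmax_pos by (simp add: power_le_one)
    then have "hmax\<^sup>2 * (2 * (exp (growth * T) * eps\<^sup>2)) \<le> 1 * (2 * (exp (growth * T) * eps\<^sup>2))"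
      by (intro mult_right_mono) auto
    moreover have "(hmax\<^sup>2)\<^sup>2 \<le> ?q\<^sup>2" by (intro power_mono) auto
    then have "8 * B\<^sup>2 * (hmax\<^sup>2)\<^sup>2 \<le> 8 * B\<^sup>2 * ?q\<^sup>2" by (intro mult_left_mono) auto
    moreover have "hmax\<^sup>2 * (8 * B\<^sup>2 * hmax\<^sup>2 + 2 * (exp (growth * T) * eps\<^sup>2))
       = 8 * B\<^sup>2 * (hmax\<^sup>2)\<^sup>2 + hmax\<^sup>2 * (2 * (exp (growth * T) * eps\<^sup>2))"
      by (simp add: power2_eq_square algebra_simps)
    moreover have "(8 * B\<^sup>2 + 2 * (exp (growth * T) * Cres\<^sup>2)) * ?q\<^sup>2 = 8 * B\<^sup>2 * ?q\<^sup>2 + 1 * (2 * (exp (growth * T) * eps\<^sup>2))"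
    proof -
      have "(8 * b + 2 * (G * C)) * Q = 8 * b * Q + 1 * (2 * (G * (C * Q)))" for b G C Q :: real
        by (simp add: algebra_simps)
      then show ?thesis unfolding eps_def power_mult_distrib[of Cres] .
    qed
    ultimately show "hmax\<^sup>2 * (8 * B\<^sup>2 * hmax\<^sup>2 + 2 * (exp (growth * T) * eps\<^sup>2))
      \<le> (8 * B\<^sup>2 + 2 * (exp (growth * T) * Cres\<^sup>2)) * ?q\<^sup>2" by linarith
  qed
  also have "\<dots> = sqrt (8 * B\<^sup>2 + 2 * (exp (growth * T) * Cres\<^sup>2)) * ?q" by (simp add: real_sqrt_mult)
  finally show ?thesis .
qed

lemma rate_error:
  assumes run: "fe_run M X Y"
  shows "(\<Sum>m<M. (2 * \<tau>) * (L2_norm (\<lambda>r. xt r (tm m + \<tau>) - (X (Suc m) r - X m r) /\<^sub>R (2 * \<tau>)))\<^sup>2)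
    \<le> (15 * B\<^sup>2 * T + 24 * (exp (growth * T) / omega * Cres\<^sup>2)) * (hmax^4 + (2 * \<tau>)^4)"
proof -
  let ?R = "\<lambda>m. nrm0 (rate (\<lambda>m. nodes (X m)) m)"
  have le: "(L2_norm (\<lambda>r. xt r (tm m + \<tau>) - (X (Suc m) r - X m r) /\<^sub>R (2 * \<tau>)))\<^sup>2
      \<le> 15 * B\<^sup>2 * (hmax^4 + (2 * \<tau>)^4) + 12 * (?R m)\<^sup>2" if m: "m < M" for m
  proof -
    have mem: "tm m \<in> {0..T}" "tm m + 2 * \<tau> \<in> {0..T}"
      using tm_mem[of m] tm_mem[of "Suc m"] m unfolding tm_Suc by auto
    define f where "f r = (x r (tm m + 2 * \<tau>) - x r (tm m)) /\<^sub>R (2 * \<tau>)" for r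
    define F where "F r = (X (Suc m) r - X m r) /\<^sub>R (2 * \<tau>)" for r
    have Xm: "X m \<in> vfe_space J p" "X (Suc m) \<in> vfe_space J p" using run m by (simp_all add: fe_run_def)
    have F: "F \<in> vfe_space J p"
      unfolding F_def by (rule vfe_space_difference_quotient[OF Xm(2,1)])
    let ?u = "\<lambda>r. xt r (tm m + \<tau>) - F r"
    have 1: "L2_inner ?u ?u \<le> 3 * (B * \<tau>\<^sup>2)\<^sup>2 + 12 * B\<^sup>2 * hmax^4 + 12 * (nrm0 (\<lambda>j. f (p j) - F (p j)))\<^sup>2"
    proof (rule L2_error_le[where f = f and ?f1.0 = "\<lambda>r. (xr r (tm m + 2 * \<tau>) - xr r (tm m)) /\<^sub>R (2 * \<tau>)"
          and ?f2.0 = "\<lambda>r. (xrr r (tm m + 2 * \<tau>) - xrr r (tm m)) /\<^sub>R (2 * \<tau>)"])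
      show "(f has_vector_derivative (xr r (tm m + 2 * \<tau>) - xr r (tm m)) /\<^sub>R (2 * \<tau>)) (at r)" for r
        unfolding f_def
        by (intro has_vector_derivative_diff x_r mem bounded_linear.has_vector_derivative[OF bounded_linear_scaleR_right])
      show "((\<lambda>r. (xr r (tm m + 2 * \<tau>) - xr r (tm m)) /\<^sub>R (2 * \<tau>)) has_vector_derivative
          (xrr r (tm m + 2 * \<tau>) - xrr r (tm m)) /\<^sub>R (2 * \<tau>)) (at r)" for r
        by (intro has_vector_derivative_diff x_rr mem bounded_linear.has_vector_derivative[OF bounded_linear_scaleR_right])
      show "norm ((xrr r (tm m + 2 * \<tau>) - xrr r (tm m)) /\<^sub>R (2 * \<tau>)) \<le> B" for r
      proof (rule norm_quotient_le)
        show "norm (xrr r (tm m + 2 * \<tau>) - xrr r (tm m)) \<le> B * \<bar>2 * \<tau>\<bar>"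
          using increment_bound(2)[OF mem, of r] \<tau>_pos by simp
      qed (use \<tau>_pos in simp)
      show "norm (xt r (tm m + \<tau>) - f r) \<le> B * \<tau>\<^sup>2" for r
        unfolding f_def by (rule corrector_truncation(1)[OF tm_nonneg \<tau>_pos tm_end[OF m]])
    qed (fact F elem_le)+
    have "0 \<le> L2_inner ?u ?u"
      unfolding L2_inner_def by (cases "(\<lambda>r. ?u r \<bullet> ?u r) integrable_on {0..1}")
        (auto intro: integral_nonneg simp: not_integrable_integral)
    then have 2: "(L2_norm ?u)\<^sup>2 = L2_inner ?u ?u" by (simp add: L2_norm_def)
    have 3: "3 * (B * \<tau>\<^sup>2)\<^sup>2 \<le> 15 * B\<^sup>2 * (2 * \<tau>)^4"
    proof -
      have "(B * \<tau>\<^sup>2)\<^sup>2 = B\<^sup>2 * \<tau>^4" by (simp add: power_mult_distrib)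
      moreover have "(2 * \<tau>)^4 = 16 * \<tau>^4" by (simp add: power_mult_distrib)
      moreover have "0 \<le> B\<^sup>2 * \<tau>^4" by simp
      ultimately show ?thesis by simp
    qed
    have 4: "(\<lambda>j. f (p j) - F (p j)) = rate (\<lambda>m. nodes (X m)) m"
      by (simp add: f_def F_def rate_def fun_eq_iff)
    have 5: "0 \<le> B\<^sup>2 * hmax^4" by simp
    have "n \<le> 15 * b * (H + S) + 12 * R"
      if "l \<le> A + 12 * b * H + 12 * R" "n = l" "A \<le> 15 * b * S" "0 \<le> b * H" for n l A b H S R :: real
      using that by (simp add: ring_distribs)
    then show ?thesis using 1 2 3 5 unfolding 4 unfolding F_def .
  qed
  have run': "nodal_run M (\<lambda>m. nodes (X m)) (\<lambda>m. nodes (Y m))" by (rule fe_run_nodal[OF run])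
  have "(\<Sum>m<M. (2 * \<tau>) * (L2_norm (\<lambda>r. xt r (tm m + \<tau>) - (X (Suc m) r - X m r) /\<^sub>R (2 * \<tau>)))\<^sup>2)
     \<le> (\<Sum>m<M. (2 * \<tau>) * (15 * B\<^sup>2 * (hmax^4 + (2 * \<tau>)^4) + 12 * (?R m)\<^sup>2))"
    using \<tau>_pos by (intro sum_mono mult_left_mono le) auto
  also have "\<dots> = T * (15 * B\<^sup>2 * (hmax^4 + (2 * \<tau>)^4)) + 12 * (\<Sum>m<M. (2 * \<tau>) * (?R m)\<^sup>2)"
    unfolding M[symmetric] by (simp add: sum.distrib ring_distribs sum_distrib_left mult_ac)
  also have "\<dots> \<le> T * (15 * B\<^sup>2 * (hmax^4 + (2 * \<tau>)^4)) + 12 * (exp (growth * T) / omega * eps\<^sup>2)"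
    using nodal_error_bounds(2)[OF run' order_refl] by simp
  also have "\<dots> \<le> T * (15 * B\<^sup>2 * (hmax^4 + (2 * \<tau>)^4))
      + 12 * (exp (growth * T) / omega * (Cres\<^sup>2 * (2 * (hmax^4 + (2 * \<tau>)^4))))"
  proof -
    have "(hmax\<^sup>2 + (2 * \<tau>)\<^sup>2)\<^sup>2 \<le> 2 * (hmax\<^sup>2)\<^sup>2 + 2 * ((2 * \<tau>)\<^sup>2)\<^sup>2" by (rule sq_sum_le)
    also have "\<dots> = 2 * (hmax^4 + (2 * \<tau>)^4)" by simp
    finally have "eps\<^sup>2 \<le> Cres\<^sup>2 * (2 * (hmax^4 + (2 * \<tau>)^4))"
      unfolding eps_def power_mult_distrib[of Cres] by (intro mult_left_mono) simp_all
    then show ?thesis using omega_pos by (intro add_left_mono mult_left_mono) auto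
  qed
  also have "\<dots> = (15 * B\<^sup>2 * T + 24 * (exp (growth * T) / omega * Cres\<^sup>2)) * (hmax^4 + (2 * \<tau>)^4)"
  proof -
    have "T * (15 * b * Q) + 12 * (G * (C * (2 * Q))) = (15 * b * T + 24 * (G * C)) * Q" for b G C Q :: real
      by (simp add: algebra_simps)
    then show ?thesis .
  qed
  finally show ?thesis .
qed

end

section \<open>Smooth solutions of the differential equation\<close>

lemma iterated_pd_derivatives:
  assumes "smooth_spacetime S u" "v \<in> iterated_pds S u" "t \<in> S"
  shows "((\<lambda>s. v s t) has_vector_derivative pd_rho v r t) (at r)"
    and "(v r has_vector_derivative pd_t S v r t) (at t within S)"
proof -
  have "(\<lambda>s. v s t) differentiable (at r)" "(\<lambda>s. v r s) differentiable (at t within S)"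
    using assms unfolding smooth_spacetime_def by blast+
  then show "((\<lambda>s. v s t) has_vector_derivative pd_rho v r t) (at r)"
    and "(v r has_vector_derivative pd_t S v r t) (at t within S)"
    unfolding pd_rho_def pd_t_def by (simp_all add: vector_derivative_works)
qed

lemma has_vector_derivative_shift_iff:
  fixes f :: "real \<Rightarrow> 'a::real_normed_vector"
  assumes per: "\<And>s. f (s + 1) = f s"
  shows "(f has_vector_derivative D) (at (r + 1)) \<longleftrightarrow> (f has_vector_derivative D) (at r)"
proof
  have shift: "((\<lambda>s. g (s + c)) has_vector_derivative D) (at r)"
    if "(g has_vector_derivative D) (at (r + c))" for g :: "real \<Rightarrow> 'a" and c r
  proof -
    have "((g \<circ> (\<lambda>s. s + c)) has_vector_derivative 1 *\<^sub>R D) (at r)"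
      by (rule vector_diff_chain_at) (use that in \<open>auto intro!: derivative_eq_intros\<close>)
    then show ?thesis by (simp add: o_def)
  qed
  show "(f has_vector_derivative D) (at r)" if "(f has_vector_derivative D) (at (r + 1))"
    using shift[OF that] by (simp add: per)
  show "(f has_vector_derivative D) (at (r + 1))" if "(f has_vector_derivative D) (at r)"
  proof -
    have "f (s + - 1) = f s" for s using per[of "s - 1"] by simp
    then show ?thesis using shift[of f "r + 1" "-1"] that by simp
  qed
qed

text \<open>Both partial derivatives are defined by choice, so it suffices that a function and its shift have the
  same derivatives.\<close>

lemma iterated_pd_periodic:
  assumes "v \<in> iterated_pds S u" "\<And>r t. t \<in> S \<Longrightarrow> u (r + 1) t = u r t" "t \<in> S"
  shows "v (r + 1) t = v r t"
  using assms(1,3)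
proof (induction arbitrary: r t)
  case base
  then show ?case using assms(2) by blast
next
  case (rho v)
  then show ?case
    using has_vector_derivative_shift_iff[of "\<lambda>s. v s t"]
    by (simp add: pd_rho_def vector_derivative_def)
next
  case (time v)
  have "(v (r + 1) has_vector_derivative D) (at t within S) \<longleftrightarrow> (v r has_vector_derivative D) (at t within S)" for D
    by (rule iffI; erule has_vector_derivative_transform[rotated 2]) (use time in auto)
  then show ?case by (simp add: pd_t_def vector_derivative_def)
qed

lemma continuous_periodic_bounded:
  fixes g :: "real \<Rightarrow> real \<Rightarrow> 'a::real_normed_vector"
  assumes "continuous_on (UNIV \<times> {0..T}) (\<lambda>w. g (fst w) (snd w))"
    and per: "\<And>r t. t \<in> {0..T} \<Longrightarrow> g (r + 1) t = g r t"
  shows "\<exists>B. \<forall>r. \<forall>t\<in>{0..T}. norm (g r t) \<le> B"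
proof -
  have "compact ((\<lambda>w. g (fst w) (snd w)) ` ({0..1} \<times> {0..T}))"
    by (intro compact_continuous_image compact_Times compact_Icc continuous_on_subset[OF assms(1)]) auto
  then obtain B where B: "\<And>y. y \<in> (\<lambda>w. g (fst w) (snd w)) ` ({0..1} \<times> {0..T}) \<Longrightarrow> norm y \<le> B"
    using compact_imp_bounded bounded_iff by metis
  have "norm (g r t) \<le> B" if t: "t \<in> {0..T}" for r t
  proof -
    have "g (frac r) t = g r t"
      using periodic1_frac[of "\<lambda>r. g r t" r] per[OF t] by (simp add: periodic1_def)
    moreover have "frac r \<in> {0..1}" by (simp add: less_imp_le[OF frac_lt_1])
    moreover have "g (frac r) t \<in> (\<lambda>w. g (fst w) (snd w)) ` ({0..1} \<times> {0..T})"
      by (rule image_eqI[of _ _ "(frac r, t)"]) (use calculation t in auto)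
    ultimately show ?thesis using B by metis
  qed
  then show ?thesis by blast
qed

lemma common_bound:
  fixes G :: "(real \<Rightarrow> real \<Rightarrow> 'a::real_normed_vector) set"
  assumes "finite G"
    and "\<And>g. g \<in> G \<Longrightarrow> \<exists>B. \<forall>r. \<forall>t\<in>I. norm (g r t) \<le> B"
  shows "\<exists>B\<ge>1. \<forall>g\<in>G. \<forall>r. \<forall>t\<in>I. norm (g r t) \<le> B"
  using assms
proof (induction rule: finite_induct)
  case empty
  then show ?case by (intro exI[of _ 1]) simp
next
  case (insert g G)
  then obtain B where B: "B \<ge> 1" "\<forall>g\<in>G. \<forall>r. \<forall>t\<in>I. norm (g r t) \<le> B" by auto
  obtain C where C: "\<forall>r. \<forall>t\<in>I. norm (g r t) \<le> C" using insert.prems by blast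
  show ?case
  proof (rule exI[of _ "max B C"], intro conjI ballI allI)
    show "1 \<le> max B C" using B by simp
    fix f r t assume f: "f \<in> insert g G" and t: "t \<in> I"
    show "norm (f r t) \<le> max B C"
    proof (cases "f = g")
      case True
      then show ?thesis using C t by (simp add: le_max_iff_disj)
    next
      case False
      then show ?thesis using B(2) f t by (simp add: le_max_iff_disj)
    qed
  qed
qed

lemma DERIV_inner:
  fixes a b :: "real \<Rightarrow> 'a::real_inner"
  assumes "(a has_vector_derivative a') (at r)" "(b has_vector_derivative b') (at r)"
  shows "((\<lambda>r. a r \<bullet> b r) has_real_derivative (a r \<bullet> b' + a' \<bullet> b r)) (at r)"
proof -
  have "((\<lambda>r. a r \<bullet> b r) has_derivative (\<lambda>h. a r \<bullet> (h *\<^sub>R b') + (h *\<^sub>R a') \<bullet> b r)) (at r)"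
    using assms unfolding has_vector_derivative_def by (rule has_derivative_inner)
  then show ?thesis
    unfolding has_field_derivative_def by (rule has_derivative_eq_rhs) (simp add: fun_eq_iff algebra_simps)
qed

text \<open>The correction of the predictor at a fixed time, with \<open>a = x\<^sub>\<rho>\<close>, \<open>b = x\<^sub>\<rho>\<^sub>\<rho>\<^sub>t\<close> and \<open>c = x\<^sub>t\<^sub>t\<close>: it is
  \<open>b / (4 |a|\<^sup>2) - c / 8\<close>. Its first two derivatives are written out (\<open>q0\<close> is \<open>1 / |a|\<^sup>2\<close>), so that their
  boundedness follows from their continuity and periodicity.\<close>

locale correction =
  fixes a a1 a2 b b1 b2 c c1 c2 :: "real \<Rightarrow> 'a::real_inner"
  assumes a: "\<And>r. (a has_vector_derivative a1 r) (at r)" "\<And>r. (a1 has_vector_derivative a2 r) (at r)"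
    and b: "\<And>r. (b has_vector_derivative b1 r) (at r)" "\<And>r. (b1 has_vector_derivative b2 r) (at r)"
    and c: "\<And>r. (c has_vector_derivative c1 r) (at r)" "\<And>r. (c1 has_vector_derivative c2 r) (at r)"
    and nz: "\<And>r. a r \<noteq> 0"
begin

definition q0 where "q0 r = inverse (a r \<bullet> a r)"

definition q1 where "q1 r = - (2 * (a r \<bullet> a1 r)) * (q0 r)\<^sup>2"

definition q2 where
  "q2 r = - (2 * (a r \<bullet> a2 r + a1 r \<bullet> a1 r)) * (q0 r)\<^sup>2 - (2 * (a r \<bullet> a1 r)) * (2 * q0 r * q1 r)"

definition k0 where "k0 r = (q0 r / 4) *\<^sub>R b r - (1/8) *\<^sub>R c r"

definition k1 where "k1 r = (q0 r / 4) *\<^sub>R b1 r + (q1 r / 4) *\<^sub>R b r - (1/8) *\<^sub>R c1 r"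

definition k2 where
  "k2 r = ((q0 r / 4) *\<^sub>R b2 r + (q1 r / 4) *\<^sub>R b1 r) + ((q1 r / 4) *\<^sub>R b1 r + (q2 r / 4) *\<^sub>R b r) - (1/8) *\<^sub>R c2 r"

lemma q0_deriv: "(q0 has_real_derivative q1 r) (at r)"
proof -
  have "((\<lambda>r. a r \<bullet> a r) has_real_derivative 2 * (a r \<bullet> a1 r)) (at r)"
    using DERIV_inner[OF a(1) a(1), of r] by (simp add: inner_commute)
  then have "((\<lambda>r. inverse (a r \<bullet> a r)) has_real_derivative
      - (inverse (a r \<bullet> a r) * (2 * (a r \<bullet> a1 r)) * inverse (a r \<bullet> a r))) (at r)"
    by (rule DERIV_inverse') (simp add: nz)
  then show ?thesis unfolding q0_def[abs_def] q1_def by (simp add: power2_eq_square mult_ac)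
qed

lemma q1_deriv: "(q1 has_real_derivative q2 r) (at r)"
proof -
  have p: "((\<lambda>r. - (2 * (a r \<bullet> a1 r))) has_real_derivative - (2 * (a r \<bullet> a2 r + a1 r \<bullet> a1 r))) (at r)"
    by (intro DERIV_minus DERIV_cmult DERIV_inner a)
  have s: "((\<lambda>r. (q0 r)\<^sup>2) has_real_derivative 2 * q0 r * q1 r) (at r)"
    by (rule derivative_eq_intros q0_deriv refl | simp)+
  show ?thesis
    unfolding q1_def[abs_def]
    by (rule DERIV_cong[OF DERIV_mult[OF p s]]) (simp add: q2_def q1_def[symmetric])
qed

lemma k0_deriv: "(k0 has_vector_derivative k1 r) (at r)"
  unfolding k0_def[abs_def] k1_def
  by (intro has_vector_derivative_diff has_vector_derivative_scaleR DERIV_cdivide q0_deriv b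
      bounded_linear.has_vector_derivative[OF bounded_linear_scaleR_right c(1)])

lemma k1_deriv: "(k1 has_vector_derivative k2 r) (at r)"
  unfolding k1_def[abs_def] k2_def
  by (intro has_vector_derivative_diff has_vector_derivative_add has_vector_derivative_scaleR DERIV_cdivide
      q0_deriv q1_deriv b bounded_linear.has_vector_derivative[OF bounded_linear_scaleR_right c(2)])

lemma k0_eq: "(2 * (norm (a r))\<^sup>2) *\<^sub>R k0 r = (1/2) *\<^sub>R b r - ((norm (a r))\<^sup>2 / 4) *\<^sub>R c r"
proof -
  have "(norm (a r))\<^sup>2 * q0 r = 1" using nz[of r] by (simp add: q0_def power2_norm_eq_inner)
  then have 1: "2 * (norm (a r))\<^sup>2 * (q0 r / 4) = 1/2" by (simp add: mult.commute)
  have 2: "2 * n * (1/8) = n / 4" for n :: real by simp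
  show ?thesis
    unfolding k0_def scaleR_diff_right scaleR_scaleR 1 2 by (rule refl)
qed

end

text \<open>All functions involved are continuous on space-time and periodic, hence bounded for times in the compact
  interval \<open>{0..T}\<close>; \<open>B\<close> is the maximum of 1 and of these bounds.\<close>

lemma csf_solution_exists:
  fixes x :: "real \<Rightarrow> real \<Rightarrow> real^'d"
  assumes "T > 0" and "\<delta> > 0" and "c0 > 0"
    and per: "\<And>t. t \<in> {0..<T + \<delta>} \<Longrightarrow> periodic1 (\<lambda>r. x r t)"
    and smooth: "smooth_spacetime {0..<T + \<delta>} x"
    and pde: "\<And>r t. t \<in> {0..<T + \<delta>} \<Longrightarrow>
           (norm (pd_rho x r t))\<^sup>2 *\<^sub>R pd_t {0..<T + \<delta>} x r t = pd_rho (pd_rho x) r t"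
    and lower: "\<And>r t. t \<in> {0..T} \<Longrightarrow> c0 \<le> norm (pd_rho x r t)"
  shows "\<exists>xr xrr xrrr xrrrr xtt xttt xrrt xrrtt z zr zrr B.
    csf_solution x xr xrr xrrr xrrrr (pd_t {0..<T + \<delta>} x) xtt xttt xrrt xrrtt z zr zrr T B c0"
proof -
  let ?S = "{0..<T + \<delta>}"
  define xr where "xr = pd_rho x"
  define xrr where "xrr = pd_rho xr"
  define xrrr where "xrrr = pd_rho xrr"
  define xrrrr where "xrrrr = pd_rho xrrr"
  define xt where "xt = pd_t ?S x"
  define xtt where "xtt = pd_t ?S xt"
  define xttt where "xttt = pd_t ?S xtt"
  define xttr where "xttr = pd_rho xtt"
  define xttrr where "xttrr = pd_rho xttr"
  define xrrt where "xrrt = pd_t ?S xrr"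
  define xrrtt where "xrrtt = pd_t ?S xrrt"
  define xrrtr where "xrrtr = pd_rho xrrt"
  define xrrtrr where "xrrtrr = pd_rho xrrtr"
  note defs = xr_def xrr_def xrrr_def xrrrr_def xt_def xtt_def xttt_def xttr_def xttrr_def
    xrrt_def xrrtt_def xrrtr_def xrrtrr_def
  have mem: "x \<in> iterated_pds ?S x" "xr \<in> iterated_pds ?S x" "xrr \<in> iterated_pds ?S x"
    "xrrr \<in> iterated_pds ?S x" "xrrrr \<in> iterated_pds ?S x" "xt \<in> iterated_pds ?S x"
    "xtt \<in> iterated_pds ?S x" "xttt \<in> iterated_pds ?S x" "xttr \<in> iterated_pds ?S x"
    "xttrr \<in> iterated_pds ?S x" "xrrt \<in> iterated_pds ?S x" "xrrtt \<in> iterated_pds ?S x"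
    "xrrtr \<in> iterated_pds ?S x" "xrrtrr \<in> iterated_pds ?S x"
    unfolding defs by (intro iterated_pds.intros)+
  have sub: "{0..T} \<subseteq> ?S" using assms(2) by auto
  have rd: "((\<lambda>r. v r t) has_vector_derivative pd_rho v r t) (at r)"
    if "v \<in> iterated_pds ?S x" "t \<in> {0..T}" for v r t
    using iterated_pd_derivatives(1)[OF smooth that(1)] that(2) sub by blast
  have td: "(v r has_vector_derivative pd_t ?S v r t) (at t within {0..T})"
    if "v \<in> iterated_pds ?S x" "t \<in> {0..T}" for v r t
    using iterated_pd_derivatives(2)[OF smooth that(1)] that(2) sub
    by (blast intro: has_vector_derivative_within_subset)
  have per': "v (r + 1) t = v r t" if "v \<in> iterated_pds ?S x" "t \<in> {0..T}" for v r t
    by (rule iterated_pd_periodic[OF that(1)]) (use per that(2) sub in \<open>auto simp: periodic1_def\<close>)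
  have cont: "continuous_on (UNIV \<times> {0..T}) (\<lambda>w. v (fst w) (snd w))"
    if "v \<in> iterated_pds ?S x" for v
  proof -
    have "continuous_on (UNIV \<times> ?S) (\<lambda>w. v (fst w) (snd w))"
      using smooth that unfolding smooth_spacetime_def by (auto simp: split_beta)
    then show ?thesis by (rule continuous_on_subset) (use sub in auto)
  qed
  have nz: "xr r t \<noteq> 0" if "t \<in> {0..T}" for r t
    using lower[OF that, of r] \<open>c0 > 0\<close> by (auto simp: xr_def)
  define z where "z r t = correction.k0 (\<lambda>r. xr r t) (\<lambda>r. xrrt r t) (\<lambda>r. xtt r t) r" for r t
  define zr where "zr r t = correction.k1 (\<lambda>r. xr r t) (\<lambda>r. xrr r t) (\<lambda>r. xrrt r t) (\<lambda>r. xrrtr r t) (\<lambda>r. xttr r t) r" for r t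
  define zrr where "zrr r t = correction.k2 (\<lambda>r. xr r t) (\<lambda>r. xrr r t) (\<lambda>r. xrrr r t)
      (\<lambda>r. xrrt r t) (\<lambda>r. xrrtr r t) (\<lambda>r. xrrtrr r t) (\<lambda>r. xttrr r t) r" for r t
  have corr: "correction (\<lambda>r. xr r t) (\<lambda>r. xrr r t) (\<lambda>r. xrrr r t) (\<lambda>r. xrrt r t) (\<lambda>r. xrrtr r t) (\<lambda>r. xrrtrr r t)
      (\<lambda>r. xtt r t) (\<lambda>r. xttr r t) (\<lambda>r. xttrr r t)" if "t \<in> {0..T}" for t
    by unfold_locales
      (use rd[OF mem(2) that, folded defs] rd[OF mem(3) that, folded defs] rd[OF mem(11) that, folded defs]
         rd[OF mem(13) that, folded defs] rd[OF mem(7) that, folded defs] rd[OF mem(9) that, folded defs] nz[OF that] in blast)+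
  note k_defs = correction.k0_def[OF corr] correction.k1_def[OF corr] correction.k2_def[OF corr]
    correction.q0_def[OF corr] correction.q1_def[OF corr] correction.q2_def[OF corr]
  note cont' = cont[OF mem(2)] cont[OF mem(3)] cont[OF mem(4)] cont[OF mem(11)] cont[OF mem(13)]
    cont[OF mem(14)] cont[OF mem(7)] cont[OF mem(9)] cont[OF mem(10)]
  let ?D = "UNIV \<times> {0..T}"
  define Q0 where "Q0 w = inverse (xr (fst w) (snd w) \<bullet> xr (fst w) (snd w))" for w
  define Q1 where "Q1 w = - (2 * (xr (fst w) (snd w) \<bullet> xrr (fst w) (snd w))) * (Q0 w)\<^sup>2" for w
  define Q2 where "Q2 w = - (2 * (xr (fst w) (snd w) \<bullet> xrrr (fst w) (snd w)
      + xrr (fst w) (snd w) \<bullet> xrr (fst w) (snd w))) * (Q0 w)\<^sup>2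
      - (2 * (xr (fst w) (snd w) \<bullet> xrr (fst w) (snd w))) * (2 * Q0 w * Q1 w)" for w
  have Q0: "continuous_on ?D Q0"
    unfolding Q0_def[abs_def]
    by (intro continuous_on_inverse continuous_on_inner cont') (use nz in auto)
  have Q1: "continuous_on ?D Q1"
    unfolding Q1_def[abs_def]
    by (intro continuous_on_mult continuous_on_minus continuous_on_power continuous_on_const
        continuous_on_inner cont' Q0)
  have Q2: "continuous_on ?D Q2"
    unfolding Q2_def[abs_def]
    by (intro continuous_on_mult continuous_on_minus continuous_on_diff continuous_on_add continuous_on_power
        continuous_on_const continuous_on_inner cont' Q0 Q1)
  have zc: "continuous_on ?D (\<lambda>w. z (fst w) (snd w))"
    "continuous_on ?D (\<lambda>w. zr (fst w) (snd w))"
    "continuous_on ?D (\<lambda>w. zrr (fst w) (snd w))"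
  proof -
    have "continuous_on ?D (\<lambda>w. (Q0 w / 4) *\<^sub>R xrrt (fst w) (snd w) - (1/8) *\<^sub>R xtt (fst w) (snd w))"
      by (intro continuous_on_diff continuous_on_scaleR continuous_on_divide continuous_on_const cont' Q0) simp
    then show "continuous_on ?D (\<lambda>w. z (fst w) (snd w))"
      by (rule continuous_on_eq) (auto simp: z_def k_defs Q0_def)
    have "continuous_on ?D (\<lambda>w. (Q0 w / 4) *\<^sub>R xrrtr (fst w) (snd w) + (Q1 w / 4) *\<^sub>R xrrt (fst w) (snd w)
        - (1/8) *\<^sub>R xttr (fst w) (snd w))"
      by (intro continuous_on_diff continuous_on_add continuous_on_scaleR continuous_on_divide continuous_on_const
          cont' Q0 Q1) simp_all
    then show "continuous_on ?D (\<lambda>w. zr (fst w) (snd w))"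
      by (rule continuous_on_eq) (auto simp: zr_def k_defs Q0_def Q1_def)
    have "continuous_on ?D (\<lambda>w. ((Q0 w / 4) *\<^sub>R xrrtrr (fst w) (snd w) + (Q1 w / 4) *\<^sub>R xrrtr (fst w) (snd w))
        + ((Q1 w / 4) *\<^sub>R xrrtr (fst w) (snd w) + (Q2 w / 4) *\<^sub>R xrrt (fst w) (snd w))
        - (1/8) *\<^sub>R xttrr (fst w) (snd w))"
      by (intro continuous_on_diff continuous_on_add continuous_on_scaleR continuous_on_divide continuous_on_const
          cont' Q0 Q1 Q2) simp_all
    then show "continuous_on ?D (\<lambda>w. zrr (fst w) (snd w))"
      by (rule continuous_on_eq) (auto simp: zrr_def k_defs Q0_def Q1_def Q2_def)
  qed
  have zper: "z (r + 1) t = z r t" "zr (r + 1) t = zr r t" "zrr (r + 1) t = zrr r t" if t: "t \<in> {0..T}" for r t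
    unfolding z_def zr_def zrr_def k_defs[OF t]
      per'[OF mem(2) t] per'[OF mem(3) t] per'[OF mem(4) t] per'[OF mem(11) t] per'[OF mem(13) t]
      per'[OF mem(14) t] per'[OF mem(7) t] per'[OF mem(9) t] per'[OF mem(10) t]
    by (rule refl)+
  have "\<exists>B\<ge>1. \<forall>g\<in>{xr, xrr, xrrr, xrrrr, xt, xttt, xrrt, xrrtt, z, zr, zrr}. \<forall>r. \<forall>t\<in>{0..T}. norm (g r t) \<le> B"
  proof (rule common_bound)
    fix g assume g: "g \<in> {xr, xrr, xrrr, xrrrr, xt, xttt, xrrt, xrrtt, z, zr, zrr}"
    have "continuous_on (UNIV \<times> {0..T}) (\<lambda>w. g (fst w) (snd w)) \<and> (\<forall>r. \<forall>t\<in>{0..T}. g (r + 1) t = g r t)"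
    proof (cases "g \<in> iterated_pds ?S x")
      case True
      then show ?thesis using cont per' by blast
    next
      case False
      then have "g \<in> {z, zr, zrr}" using g mem by blast
      then show ?thesis using zc zper by blast
    qed
    then show "\<exists>B. \<forall>r. \<forall>t\<in>{0..T}. norm (g r t) \<le> B"
      by (intro continuous_periodic_bounded) blast+
  qed simp
  then obtain B where B: "B \<ge> 1"
    "\<And>g r t. g \<in> {xr, xrr, xrrr, xrrrr, xt, xttt, xrrt, xrrtt, z, zr, zrr} \<Longrightarrow> t \<in> {0..T} \<Longrightarrow> norm (g r t) \<le> B"
    by blast
  have "csf_solution x xr xrr xrrr xrrrr xt xtt xttt xrrt xrrtt z zr zrr T B c0"
  proof
    show "0 < T" "0 < c0" "1 \<le> B" by (fact assms B)+
    fix r t assume t: "t \<in> {0..T}"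
    show "((\<lambda>r. x r t) has_vector_derivative xr r t) (at r)" "((\<lambda>r. xr r t) has_vector_derivative xrr r t) (at r)"
      "((\<lambda>r. xrr r t) has_vector_derivative xrrr r t) (at r)" "((\<lambda>r. xrrr r t) has_vector_derivative xrrrr r t) (at r)"
      using rd[OF mem(1) t] rd[OF mem(2) t] rd[OF mem(3) t] rd[OF mem(4) t] by (simp_all only: defs)
    show "((\<lambda>r. z r t) has_vector_derivative zr r t) (at r)"
      using correction.k0_deriv[OF corr[OF t]] unfolding z_def[abs_def] zr_def by simp
    show "((\<lambda>r. zr r t) has_vector_derivative zrr r t) (at r)"
      using correction.k1_deriv[OF corr[OF t]] unfolding zr_def[abs_def] zrr_def by simp
    show "(x r has_vector_derivative xt r t) (at t within {0..T})" "(xt r has_vector_derivative xtt r t) (at t within {0..T})"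
      "(xtt r has_vector_derivative xttt r t) (at t within {0..T})" "(xrr r has_vector_derivative xrrt r t) (at t within {0..T})"
      "(xrrt r has_vector_derivative xrrtt r t) (at t within {0..T})"
      using td[OF mem(1) t] td[OF mem(6) t] td[OF mem(7) t] td[OF mem(3) t] td[OF mem(11) t] by (simp_all only: defs)
    show "norm (xr r t) \<le> B \<and> norm (xrr r t) \<le> B \<and> norm (xrrr r t) \<le> B
       \<and> norm (xrrrr r t) \<le> B \<and> norm (xt r t) \<le> B \<and> norm (xttt r t) \<le> B
       \<and> norm (xrrt r t) \<le> B \<and> norm (xrrtt r t) \<le> B
       \<and> norm (z r t) \<le> B \<and> norm (zr r t) \<le> B \<and> norm (zrr r t) \<le> B"
      by (intro conjI B(2) t) simp_all
    show "x (r + 1) t = x r t" by (rule per'[OF mem(1) t])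
    show "z (r + 1) t = z r t" by (rule zper(1)[OF t])
    show "(norm (xr r t))\<^sup>2 *\<^sub>R xt r t = xrr r t" unfolding defs by (rule pde) (use t sub in blast)
    show "(2 * (norm (xr r t))\<^sup>2) *\<^sub>R z r t = (1/2) *\<^sub>R xrrt r t - ((norm (xr r t))\<^sup>2 / 4) *\<^sub>R xtt r t"
      unfolding z_def by (rule correction.k0_eq[OF corr[OF t]])
    show "c0 \<le> norm (xr r t)" unfolding xr_def by (rule lower[OF t])
  qed
  then show ?thesis unfolding xt_def by blast
qed

section \<open>The convergence theorem\<close>

lemma powr_quarter_sq:
  fixes h :: real
  assumes "0 < h"
  shows "(h powr (1/4))\<^sup>2 = sqrt h"
proof -
  have "(h powr (1/4))\<^sup>2 = h powr (1/4 + 1/4)" by (simp only: power2_eq_square powr_add)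
  then show ?thesis using assms by (simp add: powr_half_sqrt)
qed

theorem theorem3p2:
  fixes x :: "real \<Rightarrow> real \<Rightarrow> real^'d" and x0 :: "real \<Rightarrow> real^'d"
    and T \<delta> c\<^sub>0 C\<^sub>0 K :: real
  assumes "CARD('d) \<ge> 2"
    and "T > 0" and "\<delta> > 0" and "c\<^sub>0 > 0" and "C\<^sub>0 > 0"
    and "\<And>t. t \<in> {0..<T + \<delta>} \<Longrightarrow> periodic1 (\<lambda>r. x r t)"
    and "smooth_spacetime {0..<T + \<delta>} x"
    and "\<And>r t. t \<in> {0..<T + \<delta>} \<Longrightarrow>
           (norm (pd_rho x r t))\<^sup>2 *\<^sub>R pd_t {0..<T + \<delta>} x r t = pd_rho (pd_rho x) r t"
    and "\<And>r. x r 0 = x0 r"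
    and "\<And>r t. t \<in> {0..T} \<Longrightarrow> c\<^sub>0 \<le> norm (pd_rho x r t) \<and> norm (pd_rho x r t) \<le> C\<^sub>0"
  shows "\<exists>\<gamma>>0. \<exists>h\<^sub>0>0. \<exists>c>0. \<forall>J p M h \<Delta>t.
    regular_mesh K J p \<longrightarrow> h = mesh_size J p \<longrightarrow> 0 < h \<longrightarrow> h \<le> h\<^sub>0 \<longrightarrow>
    M \<ge> 1 \<longrightarrow> \<Delta>t = T / real M \<longrightarrow> \<Delta>t \<le> \<gamma> * h powr (1/4) \<longrightarrow>
      (\<exists>!XY. case XY of (X, Y) \<Rightarrow> scheme_solution J p M \<Delta>t x0 X Y) \<and>
      (\<forall>X Y. scheme_solution J p M \<Delta>t x0 X Y \<longrightarrow>
         (MAX m\<in>{0..M}. L2_norm (\<lambda>r. x r (real m * \<Delta>t) - X m r))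
           + h * (MAX m\<in>{0..M}. H1_seminorm (\<lambda>r. x r (real m * \<Delta>t) - X m r))
           \<le> c * (h\<^sup>2 + \<Delta>t\<^sup>2) \<and>
         (\<Sum>m<M. \<Delta>t * (L2_norm (\<lambda>r. pd_t {0..<T + \<delta>} x r ((real m + 1/2) * \<Delta>t)
                                    - (X (Suc m) r - X m r) /\<^sub>R \<Delta>t))\<^sup>2)
           \<le> c * (h^4 + \<Delta>t^4))"
proof -
  have "\<exists>xr xrr xrrr xrrrr xtt xttt xrrt xrrtt z zr zrr B.
    csf_solution x xr xrr xrrr xrrrr (pd_t {0..<T + \<delta>} x) xtt xttt xrrt xrrtt z zr zrr T B c\<^sub>0"
    by (rule csf_solution_exists[OF assms(2,3,4,6,7,8)]) (use assms(10) in auto)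
  then obtain xr xrr xrrr xrrrr xtt xttt xrrt xrrtt z zr zrr B where
    "csf_solution x xr xrr xrrr xrrrr (pd_t {0..<T + \<delta>} x) xtt xttt xrrt xrrtt z zr zrr T B c\<^sub>0" by blast
  then interpret csf_solution x xr xrr xrrr xrrrr "pd_t {0..<T + \<delta>} x" xtt xttt xrrt xrrtt z zr zrr T B c\<^sub>0 .
  define CR where "CR = 17 * (K + 1) * B^3"
  define A where "A = \<bar>amp * CR * sqrt K\<bar>"
  \<comment> \<open>the bound required of the difference quotients of the error\<close>
  define \<sigma> where "\<sigma> = min 1 (c\<^sub>0 / 4)"
  \<comment> \<open>both \<open>h\<close> and, up to the factor \<open>sqrt h\<close>, also \<open>\<Delta>t\<^sup>2\<close> will be at most \<open>g\<close>\<close>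
  define g where "g = min 1 (min (c\<^sub>0 / (4 * B)) (\<sigma> / (2 * (A + 1))))"
  define c1 where "c1 = sqrt (12 * B\<^sup>2 + 12 * (T * (exp (growth * T) / omega * CR\<^sup>2)))"
  define c2 where "c2 = sqrt (8 * B\<^sup>2 + 2 * (exp (growth * T) * CR\<^sup>2))"
  define c3 where "c3 = 15 * B\<^sup>2 * T + 24 * (exp (growth * T) / omega * CR\<^sup>2)"
  have B: "0 < B" using B_ge by simp
  have \<sigma>: "0 < \<sigma>" using c0_pos by (simp add: \<sigma>_def)
  have A: "0 \<le> A" by (simp add: A_def)
  have g: "0 < g" "g \<le> 1" "B * g \<le> c\<^sub>0 / 4" "A * (2 * g) \<le> \<sigma>"
  proof -
    show "0 < g" using B \<sigma> A c0_pos by (simp add: g_def)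
    show "g \<le> 1" by (simp add: g_def)
    have "B * g \<le> B * (c\<^sub>0 / (4 * B))" using B by (intro mult_left_mono) (auto simp: g_def)
    then show "B * g \<le> c\<^sub>0 / 4" using B by simp
    have "g \<le> \<sigma> / (2 * (A + 1))" by (simp add: g_def)
    then have "g * (2 * (A + 1)) \<le> \<sigma>" using A by (simp add: pos_le_divide_eq)
    then show "A * (2 * g) \<le> \<sigma>" using \<open>0 < g\<close> by (simp add: algebra_simps)
  qed
  have nonneg: "0 \<le> c1" "0 \<le> c2" "0 \<le> c3"
    unfolding c1_def c2_def c3_def using T_pos omega_pos by (auto intro!: add_nonneg_nonneg mult_nonneg_nonneg)
  have main: "(\<exists>!XY. case XY of (X, Y) \<Rightarrow> scheme_solution J p M \<Delta>t x0 X Y) \<and>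
      (\<forall>X Y. scheme_solution J p M \<Delta>t x0 X Y \<longrightarrow>
         (MAX m\<in>{0..M}. L2_norm (\<lambda>r. x r (real m * \<Delta>t) - X m r))
           + h * (MAX m\<in>{0..M}. H1_seminorm (\<lambda>r. x r (real m * \<Delta>t) - X m r))
           \<le> (c1 + c2 + c3 + 1) * (h\<^sup>2 + \<Delta>t\<^sup>2) \<and>
         (\<Sum>m<M. \<Delta>t * (L2_norm (\<lambda>r. pd_t {0..<T + \<delta>} x r ((real m + 1/2) * \<Delta>t)
                                    - (X (Suc m) r - X m r) /\<^sub>R \<Delta>t))\<^sup>2)
           \<le> (c1 + c2 + c3 + 1) * (h^4 + \<Delta>t^4))"
    if mesh: "regular_mesh K J p" and h: "h = mesh_size J p" "0 < h" "h \<le> g"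
      and M: "M \<ge> 1" "\<Delta>t = T / real M" and dt: "\<Delta>t \<le> sqrt g * h powr (1/4)"
    for J p M h \<Delta>t
  proof -
    have ism: "is_mesh J p" using mesh by (simp add: regular_mesh_def)
    have h1: "h \<le> 1" using h(3) g(2) by simp
    interpret m: csf_mesh x xr xrr xrrr xrrrr "pd_t {0..<T + \<delta>} x" xtt xttt xrrt xrrtt z zr zrr T B c\<^sub>0 J p K
      by unfold_locales (use ism mesh h h1 in auto)
    have dt_pos: "0 < \<Delta>t" using M T_pos by simp
    have dt_sq: "\<Delta>t\<^sup>2 \<le> g * sqrt h"
    proof -
      have "\<Delta>t\<^sup>2 \<le> (sqrt g * h powr (1/4))\<^sup>2" using dt dt_pos by (intro power_mono) auto
      then show ?thesis using powr_quarter_sq[OF h(2)] g(1) by (simp add: power_mult_distrib)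
    qed
    have sqrt_h: "sqrt h \<le> 1" "0 < sqrt h" using h1 h(2) by simp_all
    have dt_g: "\<Delta>t\<^sup>2 \<le> g" 
    proof -
      have "g * sqrt h \<le> g * 1" using sqrt_h g(1) by (intro mult_left_mono) auto
      then show ?thesis using dt_sq by linarith
    qed
    \<comment> \<open>so \<open>h\<^sup>2 + \<Delta>t\<^sup>2 \<le> 2 g sqrt h\<close>, which compensates the loss of \<open>h\<^sup>-\<^sup>1\<^sup>/\<^sup>2\<close> in the inverse inequality\<close>
    have h_sq: "h\<^sup>2 \<le> g * sqrt h"
    proof -
      have "sqrt h * sqrt h \<le> 1 * sqrt h" using sqrt_h by (intro mult_right_mono) auto
      then have "h \<le> sqrt h" using h(2) by simp
      then have "h * h \<le> g * sqrt h" using h g by (intro mult_mono) auto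
      then show ?thesis by (simp add: power2_eq_square)
    qed
    have CR: "m.Cres = CR" by (simp add: m.Cres_def CR_def)
    interpret f: csf_fem x xr xrr xrrr xrrrr "pd_t {0..<T + \<delta>} x" xtt xttt xrrt xrrtt z zr zrr T B c\<^sub>0 J p K
      M "\<Delta>t / 2" x0
    proof unfold_locales
      show "2 * (\<Delta>t / 2) * real M = T" using M by simp
      show "0 < \<Delta>t / 2" using dt_pos by simp
      have "\<Delta>t\<^sup>2 \<le> 1\<^sup>2" using dt_g g(2) by simp
      then have "\<Delta>t \<le> 1" by (rule power2_le_imp_le) simp
      then show "2 * (\<Delta>t / 2) \<le> 1" by simp
      have "B * h \<le> B * g" using h(3) B by simp
      then show "B * mesh_size J p \<le> c\<^sub>0 / 4" using g(3) unfolding h(1) by simp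
      have "B * \<Delta>t\<^sup>2 \<le> B * g" using dt_g B by simp
      then show "B * (2 * (\<Delta>t / 2))\<^sup>2 \<le> c\<^sub>0 / 4" using g(3) by simp
      have "amp * (CR * (h\<^sup>2 + \<Delta>t\<^sup>2)) * sqrt K = (amp * CR * sqrt K) * (h\<^sup>2 + \<Delta>t\<^sup>2)" by simp
      also have "\<dots> \<le> A * (h\<^sup>2 + \<Delta>t\<^sup>2)" unfolding A_def by (intro mult_right_mono) auto
      also have "\<dots> \<le> A * (g * sqrt h + g * sqrt h)" using A h_sq dt_sq by (intro mult_left_mono) auto
      also have "\<dots> = (A * (2 * g)) * sqrt h" by simp
      also have "\<dots> \<le> \<sigma> * sqrt h" using g(4) sqrt_h by (intro mult_right_mono) auto
      finally show "amp * (m.Cres * ((mesh_size J p)\<^sup>2 + (2 * (\<Delta>t / 2))\<^sup>2)) * sqrt K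
          \<le> min 1 (c\<^sub>0 / 4) * sqrt (mesh_size J p)"
        unfolding CR h(1) \<sigma>_def by simp
      show "x r 0 = x0 r" for r by (rule assms(9))
    qed
    have dt2: "2 * (\<Delta>t / 2) = \<Delta>t" by simp
    have tm: "f.tm k = real k * \<Delta>t" for k by (simp add: f.tm_def)
    have q0: "0 \<le> h\<^sup>2 + \<Delta>t\<^sup>2" "0 \<le> h^4 + \<Delta>t^4" by simp_all
    show ?thesis
    proof (intro conjI allI impI)
      show "\<exists>!XY. case XY of (X, Y) \<Rightarrow> scheme_solution J p M \<Delta>t x0 X Y"
        using f.scheme_exists_unique unfolding dt2 .
    next
      fix X Y assume "scheme_solution J p M \<Delta>t x0 X Y"
      then have run: "f.fe_run M X Y" using f.scheme_solution_iff[unfolded dt2] by blast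
      have L2: "L2_norm (\<lambda>r. x r (real k * \<Delta>t) - X k r) \<le> c1 * (h\<^sup>2 + \<Delta>t\<^sup>2)" if "k \<le> M" for k
        using f.L2_error[OF run that] unfolding tm dt2 CR c1_def h(1) .
      have H1: "H1_seminorm (\<lambda>r. x r (real k * \<Delta>t) - X k r) \<le> c2 * (h\<^sup>2 + \<Delta>t\<^sup>2) / h" if "k \<le> M" for k
      proof -
        have "h * H1_seminorm (\<lambda>r. x r (real k * \<Delta>t) - X k r) \<le> c2 * (h\<^sup>2 + \<Delta>t\<^sup>2)"
          using f.H1_error[OF run that] unfolding tm dt2 CR c2_def h(1) .
        then show ?thesis using h(2) by (simp add: pos_le_divide_eq mult.commute)
      qed
      have max1: "(MAX k\<in>{0..M}. L2_norm (\<lambda>r. x r (real k * \<Delta>t) - X k r)) \<le> c1 * (h\<^sup>2 + \<Delta>t\<^sup>2)"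
        using L2 by (intro Max.boundedI) auto
      have "(MAX k\<in>{0..M}. H1_seminorm (\<lambda>r. x r (real k * \<Delta>t) - X k r)) \<le> c2 * (h\<^sup>2 + \<Delta>t\<^sup>2) / h"
        using H1 by (intro Max.boundedI) auto
      then have max2: "h * (MAX k\<in>{0..M}. H1_seminorm (\<lambda>r. x r (real k * \<Delta>t) - X k r)) \<le> c2 * (h\<^sup>2 + \<Delta>t\<^sup>2)"
        using mult_left_mono[of _ "c2 * (h\<^sup>2 + \<Delta>t\<^sup>2) / h" h] h(2) by simp
      have "c1 * (h\<^sup>2 + \<Delta>t\<^sup>2) + c2 * (h\<^sup>2 + \<Delta>t\<^sup>2) \<le> (c1 + c2 + c3 + 1) * (h\<^sup>2 + \<Delta>t\<^sup>2)"
        unfolding distrib_right[symmetric] using nonneg by (intro mult_right_mono q0) simp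
      then show "(MAX m\<in>{0..M}. L2_norm (\<lambda>r. x r (real m * \<Delta>t) - X m r))
           + h * (MAX m\<in>{0..M}. H1_seminorm (\<lambda>r. x r (real m * \<Delta>t) - X m r))
           \<le> (c1 + c2 + c3 + 1) * (h\<^sup>2 + \<Delta>t\<^sup>2)"
        using max1 max2 by linarith
      have mid: "f.tm k + \<Delta>t / 2 = (real k + 1/2) * \<Delta>t" for k by (simp add: tm algebra_simps)
      have "(\<Sum>m<M. \<Delta>t * (L2_norm (\<lambda>r. pd_t {0..<T + \<delta>} x r ((real m + 1/2) * \<Delta>t)
                                    - (X (Suc m) r - X m r) /\<^sub>R \<Delta>t))\<^sup>2) \<le> c3 * (h^4 + \<Delta>t^4)"
        using f.rate_error[OF run] unfolding mid dt2 CR c3_def h(1) .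
      also have "\<dots> \<le> (c1 + c2 + c3 + 1) * (h^4 + \<Delta>t^4)"
        using nonneg by (intro mult_right_mono q0) simp
      finally show "(\<Sum>m<M. \<Delta>t * (L2_norm (\<lambda>r. pd_t {0..<T + \<delta>} x r ((real m + 1/2) * \<Delta>t)
                                    - (X (Suc m) r - X m r) /\<^sub>R \<Delta>t))\<^sup>2)
           \<le> (c1 + c2 + c3 + 1) * (h^4 + \<Delta>t^4)" .
    qed
  qed
  have pos: "0 < sqrt g" "0 < c1 + c2 + c3 + 1" using g(1) nonneg by simp_all
  show ?thesis
    by (rule exI[of _ "sqrt g"], rule conjI[OF pos(1)], rule exI[of _ g], rule conjI[OF g(1)],
        rule exI[of _ "c1 + c2 + c3 + 1"], rule conjI[OF pos(2)], intro allI impI, rule main; assumption)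
qed

end
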